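(* Let $I\subseteq R=\mathbb{K}[x_1,\ldots,x_n]$ be a homogeneous ideal that is geometrically vertex decomposable or weakly geometrically vertex decomposable, and let $\mathrm{in}_y(I)=C_{y,I}\cap(N_{y,I}+\langle y\rangle)$ be its geometric vertex decomposition with respect to a variable $y=x_j$ and a $y$-compatible monomial order, as in the definition of (weakly) geometrically vertex decomposable ideal. If the decomposition is nondegenerate, then $$e(R/I)=e(R/N_{y,I})+e(R/C_{y,I}).$$ If the decomposition is degenerate, then $e(R/I)=e(R/N_{y,I})=e(R/C_{y,I})$ if $C_{y,I}\ne\langle1\rangle$, and $e(R/I)=e(R/N_{y,I})$ if $C_{y,I}=\langle1\rangle$.
   Context: $\mathbb{K}$ is an algebraically closed field of characteristic $0$ and $R=\mathbb{K}[x_1,\ldots,x_n]$ has the standard grading. Fix a variable $y=x_j$. A nonzero $f\in R$ is written $f=\sum_{i=0}^d\alpha_i y^i$ with $\alpha_i\in\mathbb{K}[x_1,\ldots,\widehat{x_j},\ldots,x_n]$ and $\alpha_d\ne0$; its initial $y$-form is $\mathrm{in}_y(f)=\alpha_d y^d$. For an ideal $J$, $\mathrm{in}_y(J)=\langle \mathrm{in}_y(f) : f\in J\rangle$. A monomial order $<$ is $y$-compatible if $\mathrm{in}_<(\mathrm{in}_y(f))=\mathrm{in}_<(f)$ for all $f\in R$. Given an ideal $I$ and a Gröbner basis $\{g_1,\ldots,g_m\}$ of $I$ with respect to a $y$-compatible order, write $g_i=y^{d_i}q_i+r_i$ with $\mathrm{in}_y(g_i)=y^{d_i}q_i$ and $y$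 not dividing any term of $q_i$. Put $C_{y,I}=\langle q_1,\ldots,q_m\rangle$ and $N_{y,I}=\langle q_i : d_i=0\rangle$; these do not depend on the choice of order or Gröbner basis, and are regarded as ideals of $R$ unless their contraction is mentioned. If $\mathrm{in}_y(I)=C_{y,I}\cap(N_{y,I}+\langle y\rangle)$, this is called a geometric vertex decomposition of $I$ with respect to $y$. It is degenerate if $\sqrt{C_{y,I}}=\sqrt{N_{y,I}}$ or $C_{y,I}=\langle1\rangle$, and nondegenerate otherwise. An ideal $I$ is unmixed if $\dim(R/I)=\dim(R/P)$ for all associated primes $P$ of $R/I$. An ideal $I\subseteq\mathbb{K}[x_1,\ldots,x_n]$ is geometrically vertex decomposable if $I$ is unmixed and either (1) $I=\langle1\rangle$ or $I$ is generated by a (possibly empty) subset of the variables, or (2) there is a variable $y=x_j$ and a $y$-compatible monomial order giving a geometric vertex decomposition $\mathrm{in}_y(I)=C_{y,I}\cap(N_{y,I}+\langle y\rangle)$ such that the contractions of $C_{y,I}$ and $N_{y,I}$ to $R'=\mathbb{K}[x_1,\ldots,\widehat{x_j},\ldots,x_n]$ are geometrically vertex decomposable. An ideal $I$ is weakly geometrically vertex decomposable if $I$ is unmixed and one of the following holds: (1) $I=\langle1\rangle$ or $I$ is generated by a (possibly empty) subset of the variables; (2) for some variable $y=x_j$ there is a degenerate geometric vertex decomposition of $I$ and the contraction of $N_{y,I}$ to $R'$ is weakly geometrically vertex decomposable; (3) for some variable $y=x_j$ there is a nondegenerate geometric vertex decomposition of $I$, the contraction of $C_{y,I}$ to $R'$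 is geometrically vertex decomposable, and $N_{y,I}$ is radical and Cohen–Macaulay. For a finitely generated graded module $M$ of dimension $d$ with Hilbert series $h_M(t)/(1-t)^d$, the multiplicity is $e(M)=h_M(1)$; $e(0)=0$. *)

theory Defs
  imports
    "HOL-Library.Poly_Mapping"
    "HOL-Library.Extended_Nat"
    "HOL-Algebra.Embedded_Algebras"
    "HOL-Algebra.Ring_Divisibility"
    "HOL-Computational_Algebra.Polynomial_FPS"
begin

section \<open>Commutative algebra\<close>

text \<open>
  A prime chain of length \<open>n\<close> has \<open>n + 1\<close> members. The zero ring has no prime ideals; the
  supremum in \<^typ>\<open>enat\<close> then assigns it dimension 0 (a convention).
\<close>

definition prime_chain :: "('a, 'b) ring_scheme \<Rightarrow> nat \<Rightarrow> (nat \<Rightarrow> 'a set) \<Rightarrow> bool" where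
  "prime_chain A n P \<longleftrightarrow>
     (\<forall>i\<le>n. primeideal (P i) A) \<and> (\<forall>i<n. P i \<subset> P (Suc i))"

definition krull_dim :: "('a, 'b) ring_scheme \<Rightarrow> enat" where
  "krull_dim A = Sup {enat n |n. \<exists>P. prime_chain A n P}"

definition height :: "('a, 'b) ring_scheme \<Rightarrow> 'a set \<Rightarrow> enat" where
  "height A Q = Sup {enat n |n. \<exists>P. prime_chain A n P \<and> P n = Q}"

definition radical :: "('a, 'b) ring_scheme \<Rightarrow> 'a set \<Rightarrow> 'a set" where
  "radical A I = {r \<in> carrier A. \<exists>n::nat. r [^]\<^bsub>A\<^esub> n \<in> I}"

text \<open>Associated primes of the module \<open>A/I\<close>: the prime annihilators of cosets \<open>f + I\<close>.\<close>

definition associated_primes :: "('a, 'b) ring_scheme \<Rightarrow> 'a set \<Rightarrow> 'a set set" where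
  "associated_primes A I =
     {P. primeideal P A \<and> (\<exists>f\<in>carrier A. P = {r \<in> carrier A. r \<otimes>\<^bsub>A\<^esub> f \<in> I})}"

definition unmixed :: "('a, 'b) ring_scheme \<Rightarrow> 'a set \<Rightarrow> bool" where
  "unmixed A I \<longleftrightarrow> ideal I A \<and>
     (\<forall>P\<in>associated_primes A I. krull_dim (A Quot I) = krull_dim (A Quot P))"

definition regular_sequence :: "('a, 'b) ring_scheme \<Rightarrow> 'a list \<Rightarrow> bool" where
  "regular_sequence A fs \<longleftrightarrow> set fs \<subseteq> carrier A \<and> Idl\<^bsub>A\<^esub> (set fs) \<noteq> carrier A \<and>
     (\<forall>i<length fs. \<forall>r\<in>carrier A.
        r \<otimes>\<^bsub>A\<^esub> (fs ! i) \<in> Idl\<^bsub>A\<^esub> (set (take i fs)) \<longrightarrow> r \<in> Idl\<^bsub>A\<^esub> (set (take i fs)))"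

definition depth :: "('a, 'b) ring_scheme \<Rightarrow> 'a set \<Rightarrow> enat" where
  "depth A Q = Sup {enat (length fs) |fs. regular_sequence A fs \<and> set fs \<subseteq> Q}"

text \<open>
  Not only for local rings: a Noetherian ring is Cohen--Macaulay if the depth of every maximal
  ideal equals its height (Eisenbud, Commutative Algebra, Section 18.2). The zero ring qualifies.
\<close>

definition cohen_macaulay :: "('a, 'b) ring_scheme \<Rightarrow> bool" where
  "cohen_macaulay A \<longleftrightarrow> cring A \<and> noetherian_ring A \<and>
     (\<forall>Q. maximalideal Q A \<longrightarrow> depth A Q = height A Q)"


section \<open>Polynomial rings in finitely many indeterminates\<close>

text \<open>
  An element of \<open>'k mpoly\<close> maps exponent vectors to coefficients; the indeterminates are indexed
  by natural numbers. \<open>poly_ring X\<close> is the subring of those polynomials that only involve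
  indeterminates from \<open>X\<close>. For \<open>Y \<subseteq> X\<close> the inclusion of \<open>poly_ring Y\<close> in \<open>poly_ring X\<close> is the
  identity on elements, so that contraction is intersection with \<open>carrier (poly_ring Y)\<close>.
\<close>

(* Poly_Mapping.thy hides these names *)
abbreviation (input) "keys \<equiv> Poly_Mapping.keys"
abbreviation (input) "lookup \<equiv> Poly_Mapping.lookup"
abbreviation (input) "single \<equiv> Poly_Mapping.single"

type_synonym monom = "nat \<Rightarrow>\<^sub>0 nat"
type_synonym 'k mpoly = "(nat \<Rightarrow>\<^sub>0 nat) \<Rightarrow>\<^sub>0 'k"

definition monoms :: "nat set \<Rightarrow> monom set" where
  "monoms X = {m. keys m \<subseteq> X}"

definition poly_ring :: "nat set \<Rightarrow> 'k::field mpoly ring" where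
  "poly_ring X = \<lparr>carrier = {p. keys p \<subseteq> monoms X},
     monoid.mult = (*), one = 1, zero = 0, add = (+)\<rparr>"

definition const :: "'k::field \<Rightarrow> 'k mpoly" where
  "const c = single 0 c"

definition var :: "nat \<Rightarrow> 'k::field mpoly" where
  "var j = single (single j 1) 1"

lemma cring_poly_ring: "cring (poly_ring X :: 'k::field mpoly ring)"
proof -
  have mult: "keys (p * q) \<subseteq> monoms X" if "keys p \<subseteq> monoms X" "keys q \<subseteq> monoms X"
    for p q :: "'k mpoly"
  proof
    fix m assume "m \<in> keys (p * q)"
    then obtain a b where ab: "a \<in> keys p" "b \<in> keys q" "m = a + b"
      using keys_mult[of p q] by blast
    have "keys a \<subseteq> X" "keys b \<subseteq> X"
      using that ab by (auto simp: monoms_def)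
    then show "m \<in> monoms X"
      using ab(3) Poly_Mapping.keys_add[of a b] by (auto simp: monoms_def)
  qed
  have add: "keys (p + q) \<subseteq> monoms X" if "keys p \<subseteq> monoms X" "keys q \<subseteq> monoms X"
    for p q :: "'k mpoly"
    using that keys_add[of p q] by blast
  have "\<exists>q\<in>carrier (poly_ring X). q \<oplus>\<^bsub>poly_ring X\<^esub> p = \<zero>\<^bsub>poly_ring X\<^esub>"
    if "p \<in> carrier (poly_ring X)" for p :: "'k mpoly"
    using that by (intro bexI[of _ "- p"]) (simp_all add: poly_ring_def)
  then show ?thesis
    by (intro cringI abelian_groupI comm_monoidI)
      (simp_all add: poly_ring_def mult add algebra_simps, simp_all add: monoms_def)
qed

definition total_deg :: "monom \<Rightarrow> nat" where
  "total_deg m = (\<Sum>j\<in>keys m. lookup m j)"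

definition homogeneous :: "nat \<Rightarrow> 'k::field mpoly \<Rightarrow> bool" where
  "homogeneous i f \<longleftrightarrow> (\<forall>m\<in>keys f. total_deg m = i)"

definition homogeneous_ideal :: "nat set \<Rightarrow> 'k::field mpoly set \<Rightarrow> bool" where
  "homogeneous_ideal X I \<longleftrightarrow>
     (\<exists>S\<subseteq>carrier (poly_ring X). (\<forall>f\<in>S. \<exists>i. homogeneous i f) \<and> I = Idl\<^bsub>poly_ring X\<^esub> S)"


section \<open>Hilbert series and multiplicity\<close>

text \<open>
  The dimension of the degree \<open>i\<close> part of \<open>poly_ring X / I\<close> over (the image of) the ground field.
\<close>

definition hilbert_function :: "nat set \<Rightarrow> 'k::field mpoly set \<Rightarrow> nat \<Rightarrow> nat" where
  "hilbert_function X I i =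
     ring.dim (poly_ring X Quot I)
       ((\<lambda>c. I +>\<^bsub>poly_ring X\<^esub> const c) ` UNIV)
       ((\<lambda>f. I +>\<^bsub>poly_ring X\<^esub> f) ` {f \<in> carrier (poly_ring X). homogeneous i f})"

definition hilbert_series :: "nat set \<Rightarrow> 'k::field mpoly set \<Rightarrow> int fps" where
  "hilbert_series X I = Abs_fps (\<lambda>i. int (hilbert_function X I i))"

text \<open>
  The multiplicity \<open>e(poly_ring X / I)\<close> for a homogeneous ideal \<open>I\<close>. If the quotient is the zero
  ring, its Hilbert series is 0, hence \<open>h = 0\<close> and the multiplicity is 0.
\<close>

definition multiplicity :: "nat set \<Rightarrow> 'k::field mpoly set \<Rightarrow> int" where
  "multiplicity X I =
     (THE e. \<exists>h :: int poly.
        hilbert_series X I * (1 - fps_X) ^ the_enat (krull_dim (poly_ring X Quot I)) = fps_of_poly h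
        \<and> e = poly h 1)"


section \<open>Monomial orders and Groebner bases\<close>

text \<open>\<open>(s, t) \<in> ord\<close> means that \<open>s\<close> is less than or equal to \<open>t\<close>.\<close>

definition monomial_order :: "nat set \<Rightarrow> monom rel \<Rightarrow> bool" where
  "monomial_order X ord \<longleftrightarrow> well_order_on (monoms X) ord \<and>
     (\<forall>(s, t)\<in>ord. \<forall>u\<in>monoms X. (s + u, t + u) \<in> ord)"

definition lead_monom :: "monom rel \<Rightarrow> 'k::field mpoly \<Rightarrow> monom" where
  "lead_monom ord f = (THE t. t \<in> keys f \<and> (\<forall>s\<in>keys f. (s, t) \<in> ord))"

definition initial_term :: "monom rel \<Rightarrow> 'k::field mpoly \<Rightarrow> 'k mpoly" where
  "initial_term ord f =
     (if f = 0 then 0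
      else single (lead_monom ord f) (lookup f (lead_monom ord f)))"

definition groebner_basis ::
    "nat set \<Rightarrow> monom rel \<Rightarrow> 'k::field mpoly set \<Rightarrow> 'k mpoly set \<Rightarrow> bool" where
  "groebner_basis X ord G I \<longleftrightarrow> finite G \<and> G \<subseteq> I - {0} \<and>
     Idl\<^bsub>poly_ring X\<^esub> (initial_term ord ` G) = Idl\<^bsub>poly_ring X\<^esub> (initial_term ord ` I)"


section \<open>Initial \<open>y\<close>-forms and geometric vertex decompositions\<close>

text \<open>
  The indeterminate \<open>y\<close> is given by its index. \<open>y_coeff y i f\<close> is the coefficient \<open>\<alpha>\<^sub>i\<close> in
  \<open>f = \<Sum>\<^sub>i \<alpha>\<^sub>i y\<^sup>i\<close>, a polynomial in the other indeterminates.
\<close>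

definition y_degree :: "nat \<Rightarrow> 'k::field mpoly \<Rightarrow> nat" where
  "y_degree y f = Max (insert 0 ((\<lambda>m. lookup m y) ` keys f))"

definition y_coeff :: "nat \<Rightarrow> nat \<Rightarrow> 'k::field mpoly \<Rightarrow> 'k mpoly" where
  "y_coeff y i f =
     (\<Sum>m | m \<in> keys f \<and> lookup m y = i.
        single (m - single y i) (lookup f m))"

definition y_lead_coeff :: "nat \<Rightarrow> 'k::field mpoly \<Rightarrow> 'k mpoly" where
  "y_lead_coeff y f = y_coeff y (y_degree y f) f"

definition initial_y_form :: "nat \<Rightarrow> 'k::field mpoly \<Rightarrow> 'k mpoly" where
  "initial_y_form y f = y_lead_coeff y f * var y ^ y_degree y f"

lemma var_power: "var y ^ i = single (single y i) (1::'k::field)"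
proof (induction i)
  case 0
  then show ?case by simp
next
  case (Suc i)
  then show ?case
    by (simp add: var_def Poly_Mapping.mult_single flip: Poly_Mapping.single_add)
qed

lemma y_expansion: "f = (\<Sum>i\<le>y_degree y f. y_coeff y i f * var y ^ i)"
proof -
  let ?d = "y_degree y f"
  have le: "lookup m y \<le> ?d" if "m \<in> keys f" for m
    using that unfolding y_degree_def by (intro Max_ge) auto
  have split: "m - single y i + single y i = m"
    if "lookup m y = i" for m :: monom and i
    using that by (intro poly_mapping_eqI)
      (auto simp: lookup_add lookup_minus lookup_single when_def)
  have term_eq: "y_coeff y i f * var y ^ i
      = (\<Sum>m | m \<in> keys f \<and> lookup m y = i. single m (lookup f m))" for i
    unfolding y_coeff_def var_power sum_distrib_right
    by (intro sum.cong) (auto simp: Poly_Mapping.mult_single split)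
  have "(\<Sum>i\<le>?d. y_coeff y i f * var y ^ i)
      = (\<Sum>m\<in>keys f. single m (lookup f m))"
    unfolding term_eq using le
    by (intro sum.group[where g = "\<lambda>m. lookup m y", simplified]) auto
  also have "\<dots> = f"
    by (intro poly_mapping_eqI)
      (auto simp: lookup_sum lookup_single when_def sum.delta' in_keys_iff)
  finally show ?thesis ..
qed

definition initial_y_ideal :: "nat set \<Rightarrow> nat \<Rightarrow> 'k::field mpoly set \<Rightarrow> 'k mpoly set" where
  "initial_y_ideal X y J = Idl\<^bsub>poly_ring X\<^esub> (initial_y_form y ` J)"

definition y_compatible :: "'k::field itself \<Rightarrow> nat set \<Rightarrow> nat \<Rightarrow> monom rel \<Rightarrow> bool" where
  "y_compatible TYPE('k) X y ord \<longleftrightarrow>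
     (\<forall>f \<in> carrier (poly_ring X :: 'k mpoly ring).
        initial_term ord (initial_y_form y f) = initial_term ord f)"

text \<open>
  For \<open>G\<close> a Groebner basis of \<open>I\<close> with respect to a \<open>y\<close>-compatible order, these are the ideals
  \<open>C\<^sub>y\<^sub>,\<^sub>I\<close> and \<open>N\<^sub>y\<^sub>,\<^sub>I\<close>; \<open>y_lead_coeff y g\<close> is the polynomial \<open>q\<close> in
  \<open>g = y\<^sup>d q + r\<close>.
\<close>

definition C_ideal :: "nat set \<Rightarrow> nat \<Rightarrow> 'k::field mpoly set \<Rightarrow> 'k mpoly set" where
  "C_ideal X y G = Idl\<^bsub>poly_ring X\<^esub> (y_lead_coeff y ` G)"

definition N_ideal :: "nat set \<Rightarrow> nat \<Rightarrow> 'k::field mpoly set \<Rightarrow> 'k mpoly set" where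
  "N_ideal X y G = Idl\<^bsub>poly_ring X\<^esub> (y_lead_coeff y ` {g \<in> G. y_degree y g = 0})"

definition geometric_vertex_decomposition ::
    "nat set \<Rightarrow> nat \<Rightarrow> monom rel \<Rightarrow> 'k::field mpoly set \<Rightarrow> 'k mpoly set \<Rightarrow> bool" where
  "geometric_vertex_decomposition X y ord G I \<longleftrightarrow>
     ideal I (poly_ring X) \<and> y \<in> X \<and>
     monomial_order X ord \<and> y_compatible TYPE('k) X y ord \<and> groebner_basis X ord G I \<and>
     initial_y_ideal X y I =
       C_ideal X y G \<inter> (N_ideal X y G <+>\<^bsub>poly_ring X\<^esub> PIdl\<^bsub>poly_ring X\<^esub> (var y))"

definition degenerate :: "nat set \<Rightarrow> nat \<Rightarrow> 'k::field mpoly set \<Rightarrow> bool" where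
  "degenerate X y G \<longleftrightarrow>
     radical (poly_ring X) (C_ideal X y G) = radical (poly_ring X) (N_ideal X y G) \<or>
     C_ideal X y G = carrier (poly_ring X)"

definition contract :: "nat set \<Rightarrow> 'k::field mpoly set \<Rightarrow> 'k mpoly set" where
  "contract Y J = J \<inter> carrier (poly_ring Y)"

definition unit_or_generated_by_variables :: "nat set \<Rightarrow> 'k::field mpoly set \<Rightarrow> bool" where
  "unit_or_generated_by_variables X I \<longleftrightarrow>
     I = carrier (poly_ring X) \<or> (\<exists>S\<subseteq>X. I = Idl\<^bsub>poly_ring X\<^esub> (var ` S))"

inductive geometrically_vertex_decomposable ::
    "nat set \<Rightarrow> 'k::field mpoly set \<Rightarrow> bool" where
  base: "geometrically_vertex_decomposable X I"
    if "unmixed (poly_ring X) I"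
      and "unit_or_generated_by_variables X I"
| decomp: "geometrically_vertex_decomposable X I"
    if "unmixed (poly_ring X) I"
      and "geometric_vertex_decomposition X y ord G I"
      and "geometrically_vertex_decomposable (X - {y}) (contract (X - {y}) (C_ideal X y G))"
      and "geometrically_vertex_decomposable (X - {y}) (contract (X - {y}) (N_ideal X y G))"

inductive weakly_geometrically_vertex_decomposable ::
    "nat set \<Rightarrow> 'k::field mpoly set \<Rightarrow> bool" where
  base: "weakly_geometrically_vertex_decomposable X I"
    if "unmixed (poly_ring X) I"
      and "unit_or_generated_by_variables X I"
| degenerate: "weakly_geometrically_vertex_decomposable X I"
    if "unmixed (poly_ring X) I"
      and "geometric_vertex_decomposition X y ord G I"
      and "degenerate X y G"
      and "weakly_geometrically_vertex_decomposable (X - {y})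
             (contract (X - {y}) (N_ideal X y G))"
| nondegenerate: "weakly_geometrically_vertex_decomposable X I"
    if "unmixed (poly_ring X) I"
      and "geometric_vertex_decomposition X y ord G I"
      and "\<not> degenerate X y G"
      and "geometrically_vertex_decomposable (X - {y}) (contract (X - {y}) (C_ideal X y G))"
      and "radical (poly_ring X) (N_ideal X y G) = N_ideal X y G"
      and "cohen_macaulay (poly_ring X Quot N_ideal X y G)"

text \<open>
  A decomposition of \<open>I\<close> that witnesses the recursive clause of the respective definition.
\<close>

definition gvd_witness ::
    "nat set \<Rightarrow> nat \<Rightarrow> monom rel \<Rightarrow> 'k::field mpoly set \<Rightarrow> 'k mpoly set \<Rightarrow> bool" where
  "gvd_witness X y ord G I \<longleftrightarrow>
     geometric_vertex_decomposition X y ord G I \<and>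
     geometrically_vertex_decomposable (X - {y}) (contract (X - {y}) (C_ideal X y G)) \<and>
     geometrically_vertex_decomposable (X - {y}) (contract (X - {y}) (N_ideal X y G))"

definition weak_gvd_witness ::
    "nat set \<Rightarrow> nat \<Rightarrow> monom rel \<Rightarrow> 'k::field mpoly set \<Rightarrow> 'k mpoly set \<Rightarrow> bool" where
  "weak_gvd_witness X y ord G I \<longleftrightarrow>
     geometric_vertex_decomposition X y ord G I \<and>
     (degenerate X y G \<and>
      weakly_geometrically_vertex_decomposable (X - {y}) (contract (X - {y}) (N_ideal X y G))
      \<or>
      \<not> degenerate X y G \<and>
      geometrically_vertex_decomposable (X - {y}) (contract (X - {y}) (C_ideal X y G)) \<and>
      radical (poly_ring X) (N_ideal X y G) = N_ideal X y G \<and>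
      cohen_macaulay (poly_ring X Quot N_ideal X y G))"

end

theory Submission
  imports Defs
begin

text \<open>Multiplicities are read off from Hilbert series. Let \<open>H\<^sub>J\<close> be the Hilbert series of \<open>R/J\<close>. It
  does not change when \<open>I\<close> is replaced by its initial ideal \<open>C \<inter> (N + (y))\<close>, which satisfies
  \<open>(in\<^sub>y(I) : y) = C\<close> and \<open>in\<^sub>y(I) + (y) = N + (y)\<close>. Since \<open>y\<close> is regular on \<open>R/N\<close>, this yields
  \<open>H\<^sub>I = (1 - t) H\<^sub>N + t H\<^sub>C\<close> (lemmas \<open>hs_decomposition\<close> and \<open>hs_N\<close>). By \<open>krull_dim_eq\<close> the Krull
  dimension of \<open>R/J\<close> is the order of the pole of \<open>H\<^sub>J\<close> at \<open>t = 1\<close>, and the multiplicity is the value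
  of the numerator there.

  In the degenerate case \<open>N\<close> is radical: ideals generated by variables are, and radicality passes
  from \<open>C\<close> and \<open>N\<close> to \<open>I\<close> (lemma \<open>radical_of_C_N\<close>). Equal radicals of \<open>C\<close> and \<open>N\<close> therefore mean
  \<open>C = N\<close>, and then \<open>H\<^sub>I = H\<^sub>N = H\<^sub>C\<close>. If \<open>C\<close> is the unit ideal, then \<open>H\<^sub>I = (1 - t) H\<^sub>N\<close> has the
  numerator of \<open>H\<^sub>N\<close>.

  In the nondegenerate case the numerators can be added as soon as the two summands \<open>(1 - t) H\<^sub>N\<close> and
  \<open>t H\<^sub>C\<close> have poles of the same order. All numerators are positive at \<open>1\<close>, so nothing cancels and
  the order for \<open>H\<^sub>I\<close> is the larger of the two. It remains to show that neither order is smaller than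
  the dimension \<open>d\<close> of \<open>R/I\<close>; this is where unmixedness enters, through associated primes \<open>P\<close> of \<open>I\<close>
  that avoid a given set of forms.

  For \<open>N + (y)\<close> (lemma \<open>dim_le_dim_N\<close>) take a form \<open>q\<close> without \<open>y\<close> in \<open>C\<close> that is not in the radical
  of \<open>N\<close>, and \<open>P\<close> avoiding the powers of \<open>q\<close>. As \<open>I\<close> contains some \<open>q y - r\<close> where \<open>r\<close> does not
  involve \<open>y\<close>, the variable \<open>y\<close> is a fraction modulo \<open>P\<close>, and the other variables suffice to produce
  the dimension. For \<open>C\<close> (lemma \<open>dim_le_dim_C\<close>) take \<open>P\<close> avoiding the forms that are monic in \<open>y\<close>.
  If \<open>R/C\<close> had smaller dimension, \<open>C\<close> would contain, modulo \<open>P\<close>, two coprime denominators of the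
  fraction \<open>y\<close>. Lemma \<open>almost_integral\<close> then gives one denominator for all powers of \<open>y\<close>, hence \<open>y\<close>
  is integral and \<open>P\<close> contains a monic form after all.\<close>

section \<open>Polynomials, gradings and ideals\<close>

lemma in_poly_ring: "f \<in> carrier (poly_ring X) \<longleftrightarrow> keys f \<subseteq> monoms X"
  by (simp add: poly_ring_def)

lemma poly_ring_simps [simp]:
  "x \<oplus>\<^bsub>poly_ring X\<^esub> y = x + y" "x \<otimes>\<^bsub>poly_ring X\<^esub> y = x * y"
  "\<one>\<^bsub>poly_ring X\<^esub> = 1" "\<zero>\<^bsub>poly_ring X\<^esub> = 0"
  by (simp_all add: poly_ring_def)

lemma monoms_add: "u \<in> monoms X \<Longrightarrow> v \<in> monoms X \<Longrightarrow> u + v \<in> monoms X"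
  using Poly_Mapping.keys_add[of u v] by (auto simp: monoms_def)

lemma monoms_zero [simp]: "0 \<in> monoms X"
  by (simp add: monoms_def)

lemma lookup_monoms: "m \<in> monoms X \<Longrightarrow> j \<notin> X \<Longrightarrow> lookup m j = 0"
  by (auto simp: monoms_def in_keys_iff)

lemma monoms_remove: "m \<in> monoms (X - {y}) \<longleftrightarrow> m \<in> monoms X \<and> lookup m y = 0"
  by (auto simp: monoms_def in_keys_iff subset_iff)

lemma poly_ring_mono: "Y \<subseteq> X \<Longrightarrow> carrier (poly_ring Y) \<subseteq> carrier (poly_ring X)"
  unfolding in_poly_ring monoms_def subset_iff mem_Collect_eq by blast

lemma poly_ring_zero [simp, intro]: "0 \<in> carrier (poly_ring X)"
  by (simp add: in_poly_ring)

lemma poly_ring_one [simp, intro]: "1 \<in> carrier (poly_ring X)"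
  by (simp add: in_poly_ring)

lemma poly_ring_single [intro]: "m \<in> monoms X \<Longrightarrow> single m c \<in> carrier (poly_ring X)"
  by (simp add: in_poly_ring)

lemma poly_ring_const [simp, intro]: "const c \<in> carrier (poly_ring X)"
  by (simp add: const_def poly_ring_single)

lemma poly_ring_var [intro]: "j \<in> X \<Longrightarrow> var j \<in> carrier (poly_ring X)"
  unfolding var_def by (rule poly_ring_single) (simp add: monoms_def)

lemma poly_ring_add [intro]:
  "f \<in> carrier (poly_ring X) \<Longrightarrow> g \<in> carrier (poly_ring X) \<Longrightarrow> f + g \<in> carrier (poly_ring X)"
  using keys_add[of f g] by (auto simp: in_poly_ring)

lemma poly_ring_mult [intro]:
  fixes f g :: "'k::field mpoly"
  shows "f \<in> carrier (poly_ring X) \<Longrightarrow> g \<in> carrier (poly_ring X) \<Longrightarrow> f * g \<in> carrier (poly_ring X)"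
  using keys_mult[of f g] monoms_add[of _ X] by (fastforce simp: in_poly_ring)

lemma poly_ring_uminus [intro]:
  "f \<in> carrier (poly_ring X) \<Longrightarrow> - f \<in> carrier (poly_ring X)"
  by (simp add: in_poly_ring)

lemma poly_ring_diff [intro]:
  "f \<in> carrier (poly_ring X) \<Longrightarrow> g \<in> carrier (poly_ring X) \<Longrightarrow> f - g \<in> carrier (poly_ring X)"
  using poly_ring_add[of f X "- g"] by auto

lemma poly_ring_sum [intro]:
  "(\<And>i. i \<in> F \<Longrightarrow> f i \<in> carrier (poly_ring X)) \<Longrightarrow> (\<Sum>i\<in>F. f i) \<in> carrier (poly_ring X)"
  by (induction F rule: infinite_finite_induct) auto

lemma poly_ring_power [intro]:
  "f \<in> carrier (poly_ring X) \<Longrightarrow> f ^ n \<in> carrier (poly_ring X)"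
  by (induction n) auto

lemma nat_pow_poly_ring [simp]: "f [^]\<^bsub>poly_ring X\<^esub> (n::nat) = f ^ n"
  by (induction n) (simp_all add: nat_pow_def poly_ring_def mult.commute)

lemma const_simps [simp]:
  "const 0 = 0" "const 1 = 1" "const (c + d) = const c + const d" "const (c * d) = const c * const d"
  by (simp_all add: const_def single_add mult_single)

lemma const_uminus [simp]: "const (- c) = - const c"
  by (simp add: const_def single_uminus)

lemma poly_mapping_sum_single: "f = (\<Sum>m\<in>keys f. single m (lookup f m))"
  by (intro poly_mapping_eqI)
    (auto simp: lookup_sum lookup_single when_def sum.delta' in_keys_iff)

lemma lookup_const_mult: "lookup (const c * f) m = c * lookup f m"
  unfolding const_def mult_map_scale_conv_mult[symmetric]
  by (simp add: Poly_Mapping.map.rep_eq when_def)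

lemma lookup_single_mult:
  fixes f :: "'k::field mpoly"
  shows "lookup (single u c * f) (u + m) = c * lookup f m"
proof -
  have "single u c * f = (\<Sum>v\<in>keys f. single (u + v) (c * lookup f v))"
    by (subst poly_mapping_sum_single[of f]) (simp add: sum_distrib_left mult_single)
  then have "lookup (single u c * f) (u + m) = (\<Sum>v\<in>keys f. (c * lookup f v when v = m))"
    by (simp add: lookup_sum lookup_single)
  then show ?thesis
    by (simp add: when_def sum.delta' in_keys_iff)
qed

lemma var_nonzero [simp]: "(var y :: 'k::field mpoly) \<noteq> 0"
  by (metis lookup_single_eq lookup_zero var_def zero_neq_one)

subsection \<open>Gradings\<close>

text \<open>The grading is arbitrary because two are needed, by the total degree and by the degree in one
  variable.\<close>

definition part :: "(monom \<Rightarrow> nat) \<Rightarrow> nat \<Rightarrow> 'k::field mpoly \<Rightarrow> 'k mpoly" where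
  "part \<phi> k f = Abs_poly_mapping (\<lambda>m. lookup f m when \<phi> m = k)"

lemma lookup_part: "lookup (part \<phi> k f) m = (lookup f m when \<phi> m = k)"
proof -
  have "finite {m. (lookup f m when \<phi> m = k) \<noteq> 0}"
    by (rule finite_subset[OF _ finite_keys[of f]]) (auto simp: in_keys_iff)
  then show ?thesis
    unfolding part_def by simp
qed

lemma keys_part: "keys (part \<phi> k f) = {m \<in> keys f. \<phi> m = k}"
  by (auto simp: in_keys_iff lookup_part)

lemma part_in_poly_ring [intro]: "f \<in> carrier (poly_ring X) \<Longrightarrow> part \<phi> k f \<in> carrier (poly_ring X)"
  by (auto simp: in_poly_ring keys_part)

lemma part_add: "part \<phi> k (f + g) = part \<phi> k f + part \<phi> k g"
  by (intro poly_mapping_eqI) (simp add: lookup_part lookup_add when_def)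

lemma part_zero [simp]: "part \<phi> k 0 = 0"
  by (intro poly_mapping_eqI) (simp add: lookup_part)

lemma part_sum: "part \<phi> k (\<Sum>i\<in>F. f i) = (\<Sum>i\<in>F. part \<phi> k (f i))"
  by (induction F rule: infinite_finite_induct) (simp_all add: part_add)

lemma part_const_mult: "part \<phi> k (const c * f) = const c * part \<phi> k f"
  by (intro poly_mapping_eqI) (simp add: lookup_part lookup_const_mult when_def)

lemma part_eq_self: "(\<And>m. m \<in> keys f \<Longrightarrow> \<phi> m = k) \<Longrightarrow> part \<phi> k f = f"
  by (intro poly_mapping_eqI) (auto simp: lookup_part when_def in_keys_iff)

lemma part_eq_0: "(\<And>m. m \<in> keys f \<Longrightarrow> \<phi> m \<noteq> k) \<Longrightarrow> part \<phi> k f = 0"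
  by (intro poly_mapping_eqI) (auto simp: lookup_part when_def in_keys_iff)

definition grade_bound :: "(monom \<Rightarrow> nat) \<Rightarrow> 'k::field mpoly \<Rightarrow> nat" where
  "grade_bound \<phi> f = Max (insert 0 (\<phi> ` keys f))"

lemma grade_boundD: "m \<in> keys f \<Longrightarrow> \<phi> m \<le> grade_bound \<phi> f"
  unfolding grade_bound_def by (intro Max_ge) auto

lemma grade_bound_leI: "(\<And>m. m \<in> keys f \<Longrightarrow> \<phi> m \<le> N) \<Longrightarrow> grade_bound \<phi> f \<le> N"
  unfolding grade_bound_def by (intro Max.boundedI) auto

lemma sum_parts: "grade_bound \<phi> f \<le> N \<Longrightarrow> f = (\<Sum>k\<le>N. part \<phi> k f)"
proof (intro poly_mapping_eqI)
  fix m assume N: "grade_bound \<phi> f \<le> N"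
  have "lookup (\<Sum>k\<le>N. part \<phi> k f) m = (\<Sum>k\<le>N. lookup f m when \<phi> m = k)"
    by (simp add: lookup_sum lookup_part)
  also have "\<dots> = lookup f m"
  proof (cases "m \<in> keys f")
    case True
    then show ?thesis
      using grade_boundD[OF True, of \<phi>] N by (simp add: when_def sum.delta')
  qed (simp add: in_keys_iff)
  finally show "lookup f m = lookup (\<Sum>k\<le>N. part \<phi> k f) m" by simp
qed

lemma part_above: "grade_bound \<phi> f < k \<Longrightarrow> part \<phi> k f = 0"
  by (rule part_eq_0) (use grade_boundD[of _ f \<phi>] in force)

text \<open>Both the total degree and the degree in one variable are additive; the product formula for the
  graded pieces is the same for the two gradings.\<close>

lemma part_mult:
  assumes add: "\<And>u v. \<phi> (u + v) = \<phi> u + \<phi> v"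
  shows "part \<phi> k (f * g) = (\<Sum>i\<le>k. part \<phi> i f * part \<phi> (k - i) g)"
proof -
  let ?N = "max k (max (grade_bound \<phi> f) (grade_bound \<phi> g))"
  have prod: "part \<phi> k (part \<phi> i f * part \<phi> j g)
      = (if i + j = k then part \<phi> i f * part \<phi> j g else 0)" for i j
  proof -
    have "\<phi> m = i + j" if "m \<in> keys (part \<phi> i f * part \<phi> j g)" for m
      using that keys_mult[of "part \<phi> i f" "part \<phi> j g"] by (auto simp: keys_part add)
    then show ?thesis
      by (auto intro: part_eq_self part_eq_0)
  qed
  have "part \<phi> k (f * g) = part \<phi> k ((\<Sum>i\<le>?N. part \<phi> i f) * (\<Sum>j\<le>?N. part \<phi> j g))"
    using sum_parts[of \<phi> f ?N] sum_parts[of \<phi> g ?N] by simp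
  also have "\<dots> = (\<Sum>i\<le>?N. \<Sum>j\<le>?N. if i + j = k then part \<phi> i f * part \<phi> j g else 0)"
    by (simp only: sum_product part_sum prod)
  also have "\<dots> = (\<Sum>i\<le>?N. if i \<le> k then part \<phi> i f * part \<phi> (k - i) g else 0)"
  proof (intro sum.cong refl)
    fix i
    have "(\<Sum>j\<le>?N. if i + j = k then part \<phi> i f * part \<phi> j g else 0)
        = (\<Sum>j\<le>?N. if i \<le> k \<and> j = k - i then part \<phi> i f * part \<phi> j g else 0)"
      by (intro sum.cong) auto
    also have "\<dots> = (if i \<le> k then part \<phi> i f * part \<phi> (k - i) g else 0)"
      by (cases "i \<le> k") (simp_all add: sum.delta')
    finally show "(\<Sum>j\<le>?N. if i + j = k then part \<phi> i f * part \<phi> j g else 0)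
      = (if i \<le> k then part \<phi> i f * part \<phi> (k - i) g else 0)" .
  qed
  also have "\<dots> = (\<Sum>i\<le>k. part \<phi> i f * part \<phi> (k - i) g)"
    by (rule sum.mono_neutral_cong_right) auto
  finally show ?thesis .
qed

lemma total_deg_eq: "keys m \<subseteq> S \<Longrightarrow> finite S \<Longrightarrow> total_deg m = (\<Sum>j\<in>S. lookup m j)"
  unfolding total_deg_def by (rule sum.mono_neutral_left) (auto simp: in_keys_iff)

lemma total_deg_add: "total_deg (u + v) = total_deg u + total_deg v"
proof -
  have "keys (u + v) \<subseteq> keys u \<union> keys v" by (rule keys_add)
  then show ?thesis
    by (simp add: total_deg_eq[of _ "keys u \<union> keys v"] lookup_add sum.distrib)
qed

lemma total_deg_single [simp]: "total_deg (single j k) = k"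
  by (simp add: total_deg_def)

lemma total_deg_zero [simp]: "total_deg 0 = 0"
  by (simp add: total_deg_def)

lemma total_deg_eq_0: "total_deg m = 0 \<longleftrightarrow> m = 0"
  by (auto simp: total_deg_def in_keys_iff intro!: poly_mapping_eqI)

abbreviation hcomp :: "nat \<Rightarrow> 'k::field mpoly \<Rightarrow> 'k mpoly" where
  "hcomp \<equiv> part total_deg"

lemmas hcomp_mult = part_mult[of total_deg, OF total_deg_add]

lemma homogeneous_hcomp [intro]: "homogeneous s (hcomp s f)"
  by (simp add: homogeneous_def keys_part)

lemma hcomp_homogeneous: "homogeneous e f \<Longrightarrow> hcomp k f = (if k = e then f else 0)"
  by (auto simp: homogeneous_def intro: part_eq_self part_eq_0)

lemma homogeneous_iff: "homogeneous e f \<longleftrightarrow> hcomp e f = f"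
  by (metis hcomp_homogeneous homogeneous_hcomp)

lemma homogeneous_0 [simp, intro]: "homogeneous e 0"
  by (simp add: homogeneous_def)

lemma homogeneous_add: "homogeneous e f \<Longrightarrow> homogeneous e g \<Longrightarrow> homogeneous e (f + g)"
  by (simp add: homogeneous_iff part_add)

lemma homogeneous_const_mult: "homogeneous e f \<Longrightarrow> homogeneous e (const c * f)"
  by (simp add: homogeneous_iff part_const_mult)

lemma homogeneous_mult:
  "homogeneous d f \<Longrightarrow> homogeneous e g \<Longrightarrow> homogeneous (d + e) (f * g)"
  using keys_mult[of f g] by (fastforce simp: homogeneous_def total_deg_add)

lemma homogeneous_power: "homogeneous d f \<Longrightarrow> homogeneous (n * d) (f ^ n)"
proof (induction n)
  case (Suc n)
  then show ?case using homogeneous_mult[of d f "n * d" "f ^ n"] by simp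
qed (simp add: homogeneous_def)

lemma homogeneous_var [intro]: "homogeneous 1 (var j)"
  by (simp add: homogeneous_def var_def)

lemma homogeneous_const [intro]: "homogeneous 0 (const c)"
  by (simp add: homogeneous_def const_def)

lemma homogeneous_1 [intro]: "homogeneous 0 1"
  by (simp add: homogeneous_def)

lemma homogeneous_0_const:
  assumes "homogeneous 0 f"
  shows "f = const (lookup f 0)"
  using assms by (intro poly_mapping_eqI)
    (auto simp: homogeneous_def const_def lookup_single when_def total_deg_eq_0 in_keys_iff)

lemma hcomp_homogeneous_mult:
  assumes "homogeneous e f"
  shows "hcomp s (f * g) = (if e \<le> s then f * hcomp (s - e) g else 0)"
proof -
  have "hcomp s (f * g) = (\<Sum>i\<le>s. if i = e then f * hcomp (s - i) g else 0)"
    unfolding hcomp_mult hcomp_homogeneous[OF assms] by (intro sum.cong) auto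
  also have "\<dots> = (if e \<le> s then f * hcomp (s - e) g else 0)"
    by (simp add: sum.delta')
  finally show ?thesis .
qed

subsection \<open>Coefficients with respect to one variable\<close>

lemma y_coeff_mult_power: "y_coeff y i f * var y ^ i = part (\<lambda>m. lookup m y) i f"
proof -
  have split: "m - single y i + single y i = m" if "lookup m y = i" for m :: monom
    using that by (intro poly_mapping_eqI)
      (auto simp: lookup_add lookup_minus lookup_single when_def)
  have "y_coeff y i f * var y ^ i
      = (\<Sum>m | m \<in> keys f \<and> lookup m y = i. single m (lookup f m))"
    unfolding y_coeff_def var_power sum_distrib_right
    by (intro sum.cong) (auto simp: Poly_Mapping.mult_single split)
  also have "\<dots> = (\<Sum>m\<in>keys (part (\<lambda>m. lookup m y) i f).
      single m (lookup (part (\<lambda>m. lookup m y) i f) m))"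
    by (intro sum.cong) (auto simp: keys_part lookup_part)
  also have "\<dots> = part (\<lambda>m. lookup m y) i f"
    by (rule poly_mapping_sum_single[symmetric])
  finally show ?thesis .
qed

lemma lookup_y_coeff:
  "lookup (y_coeff y i f) m = (lookup f (m + single y i) when lookup m y = 0)"
proof -
  have "lookup (y_coeff y i f) m = lookup (single (single y i) 1 * y_coeff y i f) (single y i + m)"
    by (subst lookup_single_mult) simp
  also have "\<dots> = lookup (y_coeff y i f * var y ^ i) (single y i + m)"
    by (simp add: var_power mult.commute)
  also have "\<dots> = (lookup f (m + single y i) when lookup m y = 0)"
    by (simp add: y_coeff_mult_power lookup_part lookup_add add.commute)
  finally show ?thesis .
qed

lemma y_coeff_add: "y_coeff y i (f + g) = y_coeff y i f + y_coeff y i g"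
  by (intro poly_mapping_eqI) (simp add: lookup_y_coeff lookup_add when_def)

lemma y_coeff_diff: "y_coeff y i (f - g) = y_coeff y i f - y_coeff y i g"
  by (intro poly_mapping_eqI) (simp add: lookup_y_coeff lookup_minus when_def)

lemma y_coeff_zero [simp]: "y_coeff y i 0 = 0"
  by (intro poly_mapping_eqI) (simp add: lookup_y_coeff)

lemma y_coeff_sum: "y_coeff y i (\<Sum>j\<in>F. f j) = (\<Sum>j\<in>F. y_coeff y i (f j))"
  by (induction F rule: infinite_finite_induct) (simp_all add: y_coeff_add)

lemma y_coeff_mult: "y_coeff y k (f * g) = (\<Sum>i\<le>k. y_coeff y i f * y_coeff y (k - i) g)"
proof -
  have "y_coeff y k (f * g) * var y ^ k
      = (\<Sum>i\<le>k. part (\<lambda>m. lookup m y) i f * part (\<lambda>m. lookup m y) (k - i) g)"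
    unfolding y_coeff_mult_power by (rule part_mult) (simp add: lookup_add)
  also have "\<dots> = (\<Sum>i\<le>k. y_coeff y i f * y_coeff y (k - i) g * var y ^ k)"
  proof (intro sum.cong refl)
    fix i assume "i \<in> {..k}"
    then have "var y ^ k = var y ^ i * (var y ^ (k - i) :: 'a mpoly)"
      by (simp flip: power_add)
    then show "part (\<lambda>m. lookup m y) i f * part (\<lambda>m. lookup m y) (k - i) g
        = y_coeff y i f * y_coeff y (k - i) g * var y ^ k"
      by (simp add: y_coeff_mult_power[symmetric] algebra_simps)
  qed
  also have "\<dots> = (\<Sum>i\<le>k. y_coeff y i f * y_coeff y (k - i) g) * var y ^ k"
    by (simp add: sum_distrib_right)
  finally show ?thesis
    by simp
qed

lemma y_coeff_in_poly_ring [intro]: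
  assumes "f \<in> carrier (poly_ring X)"
  shows "y_coeff y i f \<in> carrier (poly_ring (X - {y}))"
proof -
  have "m \<in> monoms (X - {y})" if m: "m \<in> keys (y_coeff y i f)" for m
  proof -
    have "m + single y i \<in> keys f" and y: "lookup m y = 0"
      using m by (auto simp: in_keys_iff lookup_y_coeff when_def split: if_splits)
    then have "m + single y i \<in> monoms X"
      using assms by (auto simp: in_poly_ring)
    then have "j \<in> X" if "lookup m j \<noteq> 0" for j
      using that lookup_monoms[of "m + single y i" X j] by (auto simp: lookup_add)
    then show ?thesis
      using y by (auto simp: monoms_def in_keys_iff)
  qed
  then show ?thesis by (auto simp: in_poly_ring)
qed

lemma y_coeff_in_poly_ring' [intro]:
  "f \<in> carrier (poly_ring X) \<Longrightarrow> y_coeff y i f \<in> carrier (poly_ring X)"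
  using y_coeff_in_poly_ring[of f X y i] poly_ring_mono[of "X - {y}" X] by auto

lemma y_coeff_free:
  assumes "f \<in> carrier (poly_ring (X - {y}))"
  shows "y_coeff y i f = (if i = 0 then f else 0)"
proof (intro poly_mapping_eqI)
  fix m
  have *: "lookup f u = 0" if "lookup u y \<noteq> 0" for u
    using that assms by (force simp: in_poly_ring in_keys_iff monoms_remove)
  have "lookup f m = 0" if "lookup m y \<noteq> 0"
    using *[OF that] .
  moreover have "lookup f (m + single y i) = 0" if "i \<noteq> 0"
    using that by (intro *) (simp add: lookup_add)
  ultimately show "lookup (y_coeff y i f) m = lookup (if i = 0 then f else 0) m"
    by (cases "i = 0") (auto simp: lookup_y_coeff when_def)
qed

lemma y_coeff_free_mult:
  assumes "f \<in> carrier (poly_ring (X - {y}))"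
  shows "y_coeff y k (f * g) = f * y_coeff y k g"
proof -
  have "y_coeff y k (f * g) = (\<Sum>i\<le>k. if i = 0 then f * y_coeff y (k - i) g else 0)"
    unfolding y_coeff_mult y_coeff_free[OF assms] by (intro sum.cong) auto
  then show ?thesis by (simp add: sum.delta')
qed

lemma y_coeff_const_mult: "y_coeff y i (const c * f) = const c * y_coeff y i f"
  by (rule y_coeff_free_mult[of _ UNIV]) auto

lemma y_coeff_var_power: "y_coeff y i (var y ^ k) = (if i = k then 1 else 0)"
  by (intro poly_mapping_eqI)
    (auto simp: lookup_y_coeff var_power lookup_single lookup_one lookup_add when_def
      dest: arg_cong[of _ _ "\<lambda>m. lookup m y"])

lemma y_coeff_mult_var:
  "y_coeff y k (f * var y ^ e) = (if e \<le> k then y_coeff y (k - e) f else 0)"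
proof -
  have "y_coeff y k (var y ^ e * f) = (\<Sum>i\<le>k. if i = e then y_coeff y (k - i) f else 0)"
    unfolding y_coeff_mult y_coeff_var_power by (intro sum.cong) auto
  then show ?thesis by (simp add: sum.delta' mult.commute)
qed

lemma y_degree_eq: "y_degree y f = grade_bound (\<lambda>m. lookup m y) f"
  by (simp add: y_degree_def grade_bound_def)

lemma y_coeff_above: "y_degree y f < k \<Longrightarrow> y_coeff y k f = 0"
  using y_coeff_mult_power[of y k f] part_above[of "\<lambda>m. lookup m y" f k]
  by (simp add: y_degree_eq)

lemma y_degree_leI:
  assumes "\<And>k. d < k \<Longrightarrow> y_coeff y k f = 0"
  shows "y_degree y f \<le> d"
proof (unfold y_degree_eq, rule grade_bound_leI, rule ccontr)
  fix m assume m: "m \<in> keys f" "\<not> lookup m y \<le> d"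
  then have "part (\<lambda>m. lookup m y) (lookup m y) f = 0"
    using assms[of "lookup m y"] y_coeff_mult_power[of y "lookup m y" f] by simp
  then show False
    using m(1) lookup_part[of "\<lambda>m. lookup m y" "lookup m y" f m] by (simp add: in_keys_iff)
qed

lemma y_expansion_le:
  assumes "\<And>k. d < k \<Longrightarrow> y_coeff y k f = 0"
  shows "f = (\<Sum>i\<le>d. y_coeff y i f * var y ^ i)"
proof -
  have "(\<Sum>i\<le>d. y_coeff y i f * var y ^ i) = (\<Sum>i\<le>y_degree y f. y_coeff y i f * var y ^ i)"
    using y_degree_leI[OF assms] by (intro sum.mono_neutral_right) (auto simp: y_coeff_above)
  then show ?thesis using y_expansion[of f y] by simp
qed

lemma y_coeff_hcomp: "hcomp s (y_coeff y k f) = y_coeff y k (hcomp (s + k) f)"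
  by (intro poly_mapping_eqI) (auto simp: lookup_y_coeff lookup_part total_deg_add when_def)

lemma y_coeff_eq_0_iff: "(\<forall>k. y_coeff y k f = 0) \<longleftrightarrow> f = 0"
  using y_expansion[of f y] by auto

subsection \<open>Ideals of polynomial rings\<close>

lemma ideal_poly_ringI:
  assumes "J \<subseteq> carrier (poly_ring X)" "0 \<in> J"
    and "\<And>f g. f \<in> J \<Longrightarrow> g \<in> J \<Longrightarrow> f + g \<in> J"
    and "\<And>r f. r \<in> carrier (poly_ring X) \<Longrightarrow> f \<in> J \<Longrightarrow> r * f \<in> J"
  shows "ideal J (poly_ring X)"
proof -
  interpret cring "poly_ring X" by (rule cring_poly_ring)
  have inv: "\<ominus>\<^bsub>poly_ring X\<^esub> f = - f" if "f \<in> carrier (poly_ring X)" for f :: "'a mpoly"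
    using that by (intro minus_equality) auto
  have "- f \<in> J" if "f \<in> J" for f
    using assms(4)[of "- 1" f] that by auto
  then have "subgroup J (add_monoid (poly_ring X))"
    using assms inv by (intro add.subgroupI) (auto simp: subsetD)
  moreover have "f * r \<in> J" if "r \<in> carrier (poly_ring X)" "f \<in> J" for r f
    using assms(4)[OF that] by (subst mult.commute)
  ultimately show ?thesis
    using assms ring_axioms by (intro idealI) auto
qed

context
  fixes J :: "'k::field mpoly set" and X
  assumes J: "ideal J (poly_ring X)"
begin

lemma ideal_subset: "J \<subseteq> carrier (poly_ring X)"
  using ideal.Icarr[OF J] by auto

lemma ideal_carr: "f \<in> J \<Longrightarrow> f \<in> carrier (poly_ring X)"
  using ideal_subset by auto

lemma ideal_0: "0 \<in> J"
  using additive_subgroup.zero_closed[OF ideal.axioms(1)[OF J]] by simp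

lemma ideal_add: "f \<in> J \<Longrightarrow> g \<in> J \<Longrightarrow> f + g \<in> J"
  using additive_subgroup.a_closed[OF ideal.axioms(1)[OF J]] by simp

lemma ideal_mult: "r \<in> carrier (poly_ring X) \<Longrightarrow> f \<in> J \<Longrightarrow> r * f \<in> J"
  using ideal.I_l_closed[OF J] by simp

lemma ideal_mult': "r \<in> carrier (poly_ring X) \<Longrightarrow> f \<in> J \<Longrightarrow> f * r \<in> J"
  using ideal_mult[of r f] by (simp add: mult.commute)

lemma ideal_const_mult: "f \<in> J \<Longrightarrow> const c * f \<in> J"
  by (rule ideal_mult) auto

lemma ideal_uminus: "f \<in> J \<Longrightarrow> - f \<in> J"
  using ideal_mult[of "- 1" f] by auto

lemma ideal_uminus_iff: "- f \<in> J \<longleftrightarrow> f \<in> J"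
  using ideal_uminus[of f] ideal_uminus[of "- f"] by auto

lemma ideal_diff: "f \<in> J \<Longrightarrow> g \<in> J \<Longrightarrow> f - g \<in> J"
  using ideal_add[OF _ ideal_uminus, of f g] by simp

lemma ideal_sum: "(\<And>i. i \<in> F \<Longrightarrow> f i \<in> J) \<Longrightarrow> (\<Sum>i\<in>F. f i) \<in> J"
  by (induction F rule: infinite_finite_induct) (auto intro: ideal_add ideal_0)

lemma ideal_add_iff: "f \<in> J \<Longrightarrow> f + g \<in> J \<longleftrightarrow> g \<in> J"
  using ideal_add[of f g] ideal_diff[of "f + g" f] by auto

lemma ideal_diff_iff: "f - g \<in> J \<Longrightarrow> f \<in> J \<longleftrightarrow> g \<in> J"
  using ideal_add[of "f - g" g] ideal_diff[of f "f - g"] by auto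

lemma ideal_proper_iff: "J \<noteq> carrier (poly_ring X) \<longleftrightarrow> 1 \<notin> J"
proof -
  have "carrier (poly_ring X) \<subseteq> J" if "1 \<in> J"
    using ideal_mult[OF _ that] by auto
  then show ?thesis using ideal_subset by auto
qed

end

lemma primeideal_poly_ring_iff:
  "primeideal P (poly_ring X) \<longleftrightarrow> ideal P (poly_ring X) \<and> 1 \<notin> P \<and>
    (\<forall>a\<in>carrier (poly_ring X). \<forall>b\<in>carrier (poly_ring X). a * b \<in> P \<longrightarrow> a \<in> P \<or> b \<in> P)"
  (is "?l \<longleftrightarrow> ?r")
proof
  assume ?l
  then show ?r
    using ideal_proper_iff[of P X] primeideal.axioms(1)[of P] primeideal.I_notcarr[of P]
      primeideal.I_prime[of P "poly_ring X"] by auto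
next
  assume r: ?r
  then show ?l
    using ideal_proper_iff[of P X] by (intro primeidealI cring_poly_ring) auto
qed

lemma Idl_ideal: "S \<subseteq> carrier (poly_ring X) \<Longrightarrow> ideal (Idl\<^bsub>poly_ring X\<^esub> S) (poly_ring X)"
  by (rule ring.genideal_ideal[OF cring.axioms(1)[OF cring_poly_ring]])

lemma Idl_incl: "S \<subseteq> carrier (poly_ring X) \<Longrightarrow> S \<subseteq> Idl\<^bsub>poly_ring X\<^esub> S"
  by (rule ring.genideal_self[OF cring.axioms(1)[OF cring_poly_ring]])

lemma Idl_least: "ideal J (poly_ring X) \<Longrightarrow> S \<subseteq> J \<Longrightarrow> Idl\<^bsub>poly_ring X\<^esub> S \<subseteq> J"
  by (rule ring.genideal_minimal[OF cring.axioms(1)[OF cring_poly_ring]])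

lemma ideal_carrier: "ideal (carrier (poly_ring X)) (poly_ring X)"
  by (rule ideal_poly_ringI) auto

text \<open>The ideals \<open>(J : f)\<close> and \<open>J + (f)\<close>.\<close>

definition colon :: "nat set \<Rightarrow> 'k::field mpoly set \<Rightarrow> 'k mpoly \<Rightarrow> 'k mpoly set" where
  "colon X J f = {r \<in> carrier (poly_ring X). r * f \<in> J}"

definition adjoin :: "nat set \<Rightarrow> 'k::field mpoly set \<Rightarrow> 'k mpoly \<Rightarrow> 'k mpoly set" where
  "adjoin X J f = {g + r * f |g r. g \<in> J \<and> r \<in> carrier (poly_ring X)}"

lemma ideal_colon:
  assumes J: "ideal J (poly_ring X)"
  shows "ideal (colon X J f) (poly_ring X)"
  using ideal_0[OF J] ideal_add[OF J] ideal_mult[OF J]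
  by (intro ideal_poly_ringI) (auto simp: colon_def algebra_simps)

lemma colon_mono: "J \<subseteq> J' \<Longrightarrow> colon X J f \<subseteq> colon X J' f"
  by (auto simp: colon_def)

lemma colon_incl:
  assumes J: "ideal J (poly_ring X)" and f: "f \<in> carrier (poly_ring X)"
  shows "J \<subseteq> colon X J f"
  using ideal_mult'[OF J f] ideal_carr[OF J] by (auto simp: colon_def)

lemma ideal_adjoin:
  fixes J :: "'k::field mpoly set"
  assumes J: "ideal J (poly_ring X)" and f: "f \<in> carrier (poly_ring X)"
  shows "ideal (adjoin X J f) (poly_ring X)"
proof (rule ideal_poly_ringI)
  show "adjoin X J f \<subseteq> carrier (poly_ring X)"
    using f ideal_carr[OF J] by (auto simp: adjoin_def)
  show "0 \<in> adjoin X J f"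
    using ideal_0[OF J] by (force simp: adjoin_def)
next
  fix a b :: "'k mpoly" assume "a \<in> adjoin X J f" "b \<in> adjoin X J f"
  then obtain g r g' r' where "a = g + r * f" "b = g' + r' * f" "g \<in> J" "g' \<in> J"
    "r \<in> carrier (poly_ring X)" "r' \<in> carrier (poly_ring X)"
    by (auto simp: adjoin_def)
  then show "a + b \<in> adjoin X J f"
    using ideal_add[OF J] unfolding adjoin_def
    by (intro CollectI exI[of _ "g + g'"] exI[of _ "r + r'"]) (auto simp: algebra_simps)
next
  fix a b :: "'k mpoly" assume a: "a \<in> carrier (poly_ring X)" "b \<in> adjoin X J f"
  then obtain g r where "b = g + r * f" "g \<in> J" "r \<in> carrier (poly_ring X)"
    by (auto simp: adjoin_def)
  then show "a * b \<in> adjoin X J f"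
    using ideal_mult[OF J] a unfolding adjoin_def
    by (intro CollectI exI[of _ "a * g"] exI[of _ "a * r"]) (auto simp: algebra_simps)
qed

lemma adjoin_incl: "J \<subseteq> adjoin X J f"
  by (force simp: adjoin_def)

lemma adjoin_mem: "ideal J (poly_ring X) \<Longrightarrow> f \<in> adjoin X J f"
  using ideal_0[of J X] unfolding adjoin_def
  by (intro CollectI exI[of _ 0] exI[of _ 1]) auto

lemma adjoin_least:
  assumes "ideal K (poly_ring X)" "J \<subseteq> K" "f \<in> K"
  shows "adjoin X J f \<subseteq> K"
proof
  fix a assume "a \<in> adjoin X J f"
  then obtain g r where "a = g + r * f" "g \<in> J" "r \<in> carrier (poly_ring X)"
    by (auto simp: adjoin_def)
  then show "a \<in> K"
    using assms ideal_add[OF assms(1)] ideal_mult[OF assms(1)] by auto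
qed

lemma adjoin_mono: "J \<subseteq> K \<Longrightarrow> adjoin X J f \<subseteq> adjoin X K f"
  unfolding adjoin_def by blast

subsection \<open>Homogeneous ideals\<close>

definition graded :: "'k::field mpoly set \<Rightarrow> bool" where
  "graded J \<longleftrightarrow> (\<forall>f\<in>J. \<forall>s. hcomp s f \<in> J)"

lemma gradedD: "graded J \<Longrightarrow> f \<in> J \<Longrightarrow> hcomp s f \<in> J"
  by (simp add: graded_def)

lemma graded_Idl:
  assumes S: "S \<subseteq> carrier (poly_ring X)"
    and h: "\<And>f s. f \<in> S \<Longrightarrow> hcomp s f \<in> Idl\<^bsub>poly_ring X\<^esub> S"
  shows "graded (Idl\<^bsub>poly_ring X\<^esub> S)"
proof -
  let ?J = "Idl\<^bsub>poly_ring X\<^esub> S"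
  have J: "ideal ?J (poly_ring X)" using S by (rule Idl_ideal)
  have "?J \<subseteq> {f \<in> carrier (poly_ring X). \<forall>s. hcomp s f \<in> ?J}"
  proof (rule Idl_least)
    show "ideal {f \<in> carrier (poly_ring X). \<forall>s. hcomp s f \<in> ?J} (poly_ring X)"
      by (rule ideal_poly_ringI)
        (auto simp: part_add hcomp_mult intro!: ideal_0[OF J] ideal_add[OF J] ideal_sum[OF J]
          ideal_mult[OF J])
  qed (use S h in auto)
  then show ?thesis by (auto simp: graded_def)
qed

lemma homogeneous_ideal_graded:
  assumes "homogeneous_ideal X I"
  shows "ideal I (poly_ring X)" "graded I"
proof -
  obtain S where S: "S \<subseteq> carrier (poly_ring X)" "\<forall>f\<in>S. \<exists>i. homogeneous i f"
    "I = Idl\<^bsub>poly_ring X\<^esub> S"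
    using assms by (auto simp: homogeneous_ideal_def)
  have I: "ideal I (poly_ring X)" using S Idl_ideal by auto
  then show "ideal I (poly_ring X)" .
  have "hcomp s f \<in> I" if f: "f \<in> S" for f s
  proof -
    obtain i where "homogeneous i f" using f S by auto
    then show ?thesis
      using f S Idl_incl[OF S(1)] ideal_0[OF I] by (auto simp: hcomp_homogeneous)
  qed
  then show "graded I" using graded_Idl[OF S(1)] S(3) by auto
qed

lemma graded_colon:
  assumes "ideal J (poly_ring X)" "graded J" "homogeneous e f"
  shows "graded (colon X J f)"
  unfolding graded_def
proof (intro ballI allI)
  fix r s assume r: "r \<in> colon X J f"
  have "hcomp (s + e) (f * r) \<in> J"
    using r assms(2) by (auto simp: colon_def graded_def mult.commute)
  then show "hcomp s r \<in> colon X J f"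
    using r by (auto simp: colon_def hcomp_homogeneous_mult[OF assms(3)] mult.commute)
qed

lemma graded_adjoin:
  assumes J: "ideal J (poly_ring X)" and "graded J" "homogeneous e f"
  shows "graded (adjoin X J f)"
  unfolding graded_def
proof (intro ballI allI)
  fix a s assume "a \<in> adjoin X J f"
  then obtain g r where a: "a = g + r * f" "g \<in> J" "r \<in> carrier (poly_ring X)"
    by (auto simp: adjoin_def)
  have "hcomp s a = hcomp s g + (if e \<le> s then hcomp (s - e) r else 0) * f"
    unfolding a(1) part_add using hcomp_homogeneous_mult[OF assms(3), of s r]
    by (simp add: mult.commute)
  then show "hcomp s a \<in> adjoin X J f"
    using a assms(2) unfolding adjoin_def
    by (intro CollectI exI[of _ "hcomp s g"] exI[of _ "if e \<le> s then hcomp (s - e) r else 0"])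
      (auto simp: graded_def)
qed

text \<open>In a product of two elements outside the ideal, the product of their highest components
  outside the ideal is, modulo the ideal, a component of the product.\<close>

lemma graded_primeI:
  assumes J: "ideal J (poly_ring X)" and gr: "graded J" and "1 \<notin> J"
    and prime: "\<And>a b d e. a \<in> carrier (poly_ring X) \<Longrightarrow> b \<in> carrier (poly_ring X) \<Longrightarrow>
      homogeneous d a \<Longrightarrow> homogeneous e b \<Longrightarrow> a * b \<in> J \<Longrightarrow> a \<in> J \<or> b \<in> J"
  shows "primeideal J (poly_ring X)"
proof -
  have top: "\<exists>s. hcomp s a \<notin> J \<and> (\<forall>i>s. hcomp i a \<in> J)" if "a \<notin> J" for a
  proof -
    let ?T = "{s. hcomp s a \<notin> J}"
    have sub: "?T \<subseteq> {..grade_bound total_deg a}"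
      using part_above[of total_deg a] ideal_0[OF J] by (force simp: not_le[symmetric])
    have fin: "finite ?T" by (rule finite_subset[OF sub]) simp
    have "?T \<noteq> {}"
    proof
      assume "?T = {}"
      then have "(\<Sum>k\<le>grade_bound total_deg a. hcomp k a) \<in> J"
        by (intro ideal_sum[OF J]) auto
      then show False
        using that sum_parts[of total_deg a, OF order_refl] by simp
    qed
    then have "Max ?T \<in> ?T" using fin Max_in by blast
    moreover have "\<forall>i>Max ?T. i \<notin> ?T" using Max_ge[OF fin] leD by blast
    ultimately show ?thesis by blast
  qed
  have "a \<in> J \<or> b \<in> J"
    if a: "a \<in> carrier (poly_ring X)" and b: "b \<in> carrier (poly_ring X)" and ab: "a * b \<in> J" for a b
  proof (rule ccontr)
    assume n: "\<not> (a \<in> J \<or> b \<in> J)"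
    obtain s where s: "hcomp s a \<notin> J" "\<And>i. i > s \<Longrightarrow> hcomp i a \<in> J" using top n by blast
    obtain t where t: "hcomp t b \<notin> J" "\<And>i. i > t \<Longrightarrow> hcomp i b \<in> J" using top n by blast
    have "hcomp s a * hcomp t b = hcomp (s + t) (a * b)
        - (\<Sum>i\<in>{..s + t} - {s}. hcomp i a * hcomp (s + t - i) b)"
      unfolding hcomp_mult by (subst sum.remove[of _ s]) auto
    moreover have "(\<Sum>i\<in>{..s + t} - {s}. hcomp i a * hcomp (s + t - i) b) \<in> J"
    proof (rule ideal_sum[OF J])
      fix i assume "i \<in> {..s + t} - {s}"
      then consider "i > s" | "i < s" by fastforce
      then show "hcomp i a * hcomp (s + t - i) b \<in> J"
      proof cases
        case 1 then show ?thesis using b by (intro ideal_mult'[OF J] s) auto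
      next
        case 2 then show ?thesis using a by (intro ideal_mult[OF J] t) auto
      qed
    qed
    moreover have "hcomp (s + t) (a * b) \<in> J" using gr ab by (auto simp: graded_def)
    ultimately have "hcomp s a * hcomp t b \<in> J"
      using ideal_diff[OF J] by simp
    then show False
      using prime[of "hcomp s a" "hcomp t b" s t] s t a b by auto
  qed
  then show ?thesis
    unfolding primeideal_poly_ring_iff using J assms(3) by blast
qed

section \<open>Noetherianity\<close>

subsection \<open>Dickson's lemma\<close>

lemma nat_seq_mono_subseq:
  fixes f :: "nat \<Rightarrow> nat"
  obtains r :: "nat \<Rightarrow> nat" where "strict_mono r" "mono (f \<circ> r)"
proof -
  obtain r where r: "strict_mono r" "monoseq (f \<circ> r)"
    using seq_monosub[of f] by (auto simp: comp_def)
  show ?thesis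
  proof (cases "mono (f \<circ> r)")
    case True then show ?thesis using r that by blast
  next
    case False
    then have dec: "f (r j) \<le> f (r i)" if "i \<le> j" for i j
      using r(2) that by (auto simp: monoseq_def mono_def)
    define k where "k = (LEAST v. \<exists>i. v = f (r i))"
    obtain i where i: "k = f (r i)"
      using LeastI_ex[of "\<lambda>v. \<exists>i. v = f (r i)"] unfolding k_def by blast
    have le: "k \<le> f (r j)" for j
      unfolding k_def by (rule Least_le) blast
    have const: "f (r j) = k" if "j \<ge> i" for j
      using dec[OF that] le[of j] i by simp
    have "strict_mono (\<lambda>n. r (n + i))" "mono (f \<circ> (\<lambda>n. r (n + i)))"
      using r(1) by (auto simp: strict_mono_def mono_def const)
    then show ?thesis using that by blast
  qed
qed

lemma dickson_subseq:
  fixes m :: "nat \<Rightarrow> monom"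
  assumes "finite X"
  shows "\<exists>r::nat \<Rightarrow> nat. strict_mono r \<and> (\<forall>x\<in>X. mono (\<lambda>i. lookup (m (r i)) x))"
  using assms
proof (induction X)
  case empty
  show ?case by (rule exI[of _ id]) (auto simp: strict_mono_def)
next
  case (insert x X)
  then obtain r :: "nat \<Rightarrow> nat" where r: "strict_mono r" "\<forall>x\<in>X. mono (\<lambda>i. lookup (m (r i)) x)" by blast
  obtain r' :: "nat \<Rightarrow> nat" where r': "strict_mono r'" "mono ((\<lambda>i. lookup (m (r i)) x) \<circ> r')"
    by (rule nat_seq_mono_subseq)
  show ?case
    using r r' by (intro exI[of _ "r \<circ> r'"])
      (auto simp: strict_mono_def mono_def o_def strict_mono_less_eq)
qed

lemma dickson:
  fixes m :: "nat \<Rightarrow> monom"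
  assumes "finite X" "\<And>i. m i \<in> monoms X"
  obtains i j u where "i < j" "u \<in> monoms X" "m j = u + m i"
proof -
  obtain r :: "nat \<Rightarrow> nat" where r: "strict_mono r" "\<And>x. x \<in> X \<Longrightarrow> mono (\<lambda>i. lookup (m (r i)) x)"
    using dickson_subseq[OF assms(1)] by blast
  have le: "lookup (m (r 0)) x \<le> lookup (m (r 1)) x" for x
  proof (cases "x \<in> X")
    case True then show ?thesis using r(2)[of x] by (auto simp: mono_def)
  qed (use lookup_monoms[OF assms(2)] in auto)
  show ?thesis
  proof (rule that[of "r 0" "r 1" "m (r 1) - m (r 0)"])
    show "r 0 < r 1" using r(1) by (simp add: strict_mono_def)
    show "m (r 1) - m (r 0) \<in> monoms X"
      using assms(2)[of "r 1"] by (auto simp: monoms_def in_keys_iff lookup_minus)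
    show "m (r 1) = m (r 1) - m (r 0) + m (r 0)"
      using le by (intro poly_mapping_eqI) (simp add: lookup_add lookup_minus)
  qed
qed

subsection \<open>Ascending chains of ideals\<close>

locale monomial_ordered =
  fixes X :: "nat set" and ord :: "monom rel"
  assumes fin: "finite X" and ord: "monomial_order X ord"
begin

lemma well: "well_order_on (monoms X) ord"
  using ord by (simp add: monomial_order_def)

lemma wf_lt: "wf (ord - Id)"
  using well by (simp add: well_order_on_def)

lemma linear: "linear_order_on (monoms X) ord"
  using well by (simp add: well_order_on_def)

lemma refl_ord: "s \<in> monoms X \<Longrightarrow> (s, s) \<in> ord"
  using linear by (auto simp: linear_order_on_def partial_order_on_def preorder_on_def refl_on_def)

lemma trans_ord: "(s, t) \<in> ord \<Longrightarrow> (t, u) \<in> ord \<Longrightarrow> (s, u) \<in> ord"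
  using linear unfolding linear_order_on_def partial_order_on_def preorder_on_def
  by (blast dest: transD)

lemma total_ord: "s \<in> monoms X \<Longrightarrow> t \<in> monoms X \<Longrightarrow> (s, t) \<in> ord \<or> (t, s) \<in> ord"
  using linear refl_ord by (cases "s = t") (auto simp: linear_order_on_def total_on_def)

lemma ord_add: "(s, t) \<in> ord \<Longrightarrow> u \<in> monoms X \<Longrightarrow> (u + s, u + t) \<in> ord"
  using ord by (auto simp: monomial_order_def add.commute)

lemma lead_exists:
  assumes "K \<subseteq> monoms X" "finite K" "K \<noteq> {}"
  obtains t where "t \<in> K" "\<And>s. s \<in> K \<Longrightarrow> (s, t) \<in> ord"
proof -
  have "\<exists>t\<in>K. \<forall>s\<in>K. (s, t) \<in> ord"
    using assms(2,3,1)
  proof (induction K rule: finite_ne_induct)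
    case (singleton x) then show ?case by (auto intro: refl_ord)
  next
    case (insert x F)
    then obtain t where t: "t \<in> F" "\<forall>s\<in>F. (s, t) \<in> ord" by auto
    consider "(x, t) \<in> ord" | "(t, x) \<in> ord"
      using total_ord[of x t] insert.prems t(1) by blast
    then show ?case
    proof cases
      case 1 then show ?thesis using t by auto
    next
      case 2
      then show ?thesis using t trans_ord[of _ t x] refl_ord[of x] insert.prems by blast
    qed
  qed
  then show ?thesis using that by blast
qed

abbreviation lead :: "'k::field mpoly \<Rightarrow> monom" where
  "lead \<equiv> lead_monom ord"

lemma lead:
  assumes f: "f \<in> carrier (poly_ring X)" "f \<noteq> 0"
  shows "lead f \<in> keys f" "\<And>s. s \<in> keys f \<Longrightarrow> (s, lead f) \<in> ord"
proof -
  have anti: "s = t" if "(s, t) \<in> ord" "(t, s) \<in> ord" for s t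
    using linear that unfolding linear_order_on_def partial_order_on_def by (blast dest: antisymD)
  obtain t where t: "t \<in> keys f" "\<And>s. s \<in> keys f \<Longrightarrow> (s, t) \<in> ord"
    using lead_exists[of "keys f"] f by (auto simp: in_poly_ring)
  then have "lead f = t" unfolding lead_monom_def using anti by (intro the_equality) auto
  then show "lead f \<in> keys f" "\<And>s. s \<in> keys f \<Longrightarrow> (s, lead f) \<in> ord" using t by simp_all
qed

text \<open>Pick \<open>f\<^sub>i \<in> J\<^sub>i\<^sub>+\<^sub>1 - J\<^sub>i\<close> with least leading monomial. By Dickson's lemma one leading monomial
  divides a later one, and cancelling it contradicts minimality.\<close>

lemma no_ascending_chain:
  fixes J :: "nat \<Rightarrow> 'k::field mpoly set"
  assumes J: "\<And>i. ideal (J i) (poly_ring X)" and chain: "\<And>i. J i \<subset> J (Suc i)"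
  shows False
proof -
  have mono: "J i \<subseteq> J j" if "i \<le> j" for i j
    by (rule lift_Suc_mono_le[of J]) (use chain that in blast)+
  have "\<exists>f. f \<in> J (Suc i) - J i \<and> (\<forall>g. g \<in> J (Suc i) - J i \<longrightarrow> (lead g, lead f) \<notin> ord - Id)" for i
  proof -
    obtain f0 where f0: "f0 \<in> J (Suc i) - J i" using chain[of i] by blast
    have wf: "wf (inv_image (ord - Id) (lead :: 'k mpoly \<Rightarrow> monom))"
      by (rule wf_inv_image[OF wf_lt])
    show ?thesis
      using wf[unfolded wf_eq_minimal, rule_format, OF f0] unfolding in_inv_image by metis
  qed
  then have "\<exists>f. \<forall>i. f i \<in> J (Suc i) - J i \<and>
      (\<forall>g. g \<in> J (Suc i) - J i \<longrightarrow> (lead g, lead (f i)) \<notin> ord - Id)"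
    by (intro choice allI)
  then obtain f where f: "\<And>i. f i \<in> J (Suc i) - J i"
    and min: "\<And>i g. g \<in> J (Suc i) - J i \<Longrightarrow> (lead g, lead (f i)) \<notin> ord - Id" by blast
  have carr: "f i \<in> carrier (poly_ring X)" and nz: "f i \<noteq> 0" for i
    using f[of i] ideal_carr[OF J] ideal_0[OF J] by auto
  have lm: "lead (f i) \<in> keys (f i)" "s \<in> keys (f i) \<Longrightarrow> (s, lead (f i)) \<in> ord" for i s
    using lead[OF carr nz] by auto
  have "lead (f i) \<in> monoms X" for i
    using lm(1)[of i] carr[of i] by (auto simp: in_poly_ring)
  then obtain i j u where ij: "i < j" "u \<in> monoms X" and u: "lead (f j) = u + lead (f i)"
    using dickson[OF fin, of "\<lambda>i. lead (f i)"] by blast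
  define c where "c = lookup (f j) (lead (f j)) / lookup (f i) (lead (f i))"
  define g where "g = f j - single u c * f i"
  have mem: "single u c * f i \<in> J j"
    using f[of i] mono[of "Suc i" j] ij by (intro ideal_mult[OF J]) auto
  then have "g \<in> J (Suc j)"
    unfolding g_def using f[of j] mono[of j "Suc j"] by (intro ideal_diff[OF J]) auto
  moreover have "g \<notin> J j"
    using ideal_diff_iff[OF J, of "f j" g j] mem f[of j] by (simp add: g_def)
  ultimately have gJ: "g \<in> J (Suc j) - J j" by simp
  then have gc: "g \<in> carrier (poly_ring X)" and "g \<noteq> 0"
    using ideal_carr[OF J] ideal_0[OF J] by auto
  note lg = lead[OF gc \<open>g \<noteq> 0\<close>]
  have "lookup g (lead (f j)) = 0"
    using lm(1)[of i] lookup_single_mult[of u c "f i" "lead (f i)"]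
    by (simp add: g_def c_def lookup_minus u in_keys_iff)
  then have ne: "lead g \<noteq> lead (f j)" using lg(1) by (auto simp: in_keys_iff)
  have "(lead g, lead (f j)) \<in> ord"
  proof -
    have "lead g \<in> keys (f j) \<or> lead g \<in> keys (single u c * f i)"
      using lg(1) by (auto simp: g_def in_keys_iff lookup_minus)
    moreover have "(lead g, lead (f j)) \<in> ord" if k: "lead g \<in> keys (single u c * f i)"
    proof -
      obtain v where v: "v \<in> keys (f i)" "lead g = u + v"
        using k keys_mult[of "single u c" "f i"] by (auto split: if_splits)
      show ?thesis using ord_add[OF lm(2)[OF v(1)] ij(2)] u v(2) by simp
    qed
    ultimately show ?thesis using lm(2)[of "lead g" j] by blast
  qed
  then show False using min[OF gJ] ne by blast
qed

lemma wf_ideals: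
  "wf {(J' :: 'k::field mpoly set, J). J \<subset> J' \<and> ideal J (poly_ring X) \<and> ideal J' (poly_ring X)}"
  unfolding wf_iff_no_infinite_down_chain using no_ascending_chain by blast

lemma noetherian_induct [consumes 1, case_names step]:
  fixes J :: "'k::field mpoly set"
  assumes "ideal J (poly_ring X)"
    and "\<And>J. ideal J (poly_ring X) \<Longrightarrow>
      (\<And>J'. ideal J' (poly_ring X) \<Longrightarrow> J \<subset> J' \<Longrightarrow> Q J') \<Longrightarrow> Q J"
  shows "Q J"
  using assms(1)
proof (induction J rule: wf_induct_rule[OF wf_ideals])
  case (1 J)
  show ?case by (rule assms(2)[OF 1(2)]) (use 1 in blast)
qed

lemma exists_maximal:
  fixes \<J> :: "'k::field mpoly set set"
  assumes "J \<in> \<J>" "\<And>J. J \<in> \<J> \<Longrightarrow> ideal J (poly_ring X)"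
  obtains M where "M \<in> \<J>" "\<And>J. J \<in> \<J> \<Longrightarrow> \<not> M \<subset> J"
proof -
  have "\<exists>M\<in>\<J>. \<forall>J. M \<subset> J \<and> ideal M (poly_ring X) \<and> ideal J (poly_ring X) \<longrightarrow> J \<notin> \<J>"
    using wf_ideals[unfolded wf_eq_minimal, rule_format, OF assms(1)] by auto
  then obtain M where M: "M \<in> \<J>"
    "\<And>J. M \<subset> J \<Longrightarrow> ideal M (poly_ring X) \<Longrightarrow> ideal J (poly_ring X) \<Longrightarrow> J \<notin> \<J>"
    by blast
  show ?thesis
  proof (rule that[OF M(1)])
    fix J assume J: "J \<in> \<J>"
    show "\<not> M \<subset> J" using M(2)[OF _ assms(2)[OF M(1)] assms(2)[OF J]] J by blast
  qed
qed

end

subsection \<open>Homogeneous associated primes\<close>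

text \<open>A maximal element among the ideals \<open>(I : f)\<close> that avoid \<open>S\<close> is prime, because \<open>S\<close> is
  multiplicative. Since \<open>f\<close> and \<open>S\<close> are homogeneous, primality may be tested on homogeneous
  elements.\<close>

lemma (in monomial_ordered) homogeneous_associated_prime:
  fixes I :: "'k::field mpoly set"
  assumes I: "ideal I (poly_ring X)" "graded I"
    and S: "S \<subseteq> carrier (poly_ring X)" "1 \<in> S" "\<And>s t. s \<in> S \<Longrightarrow> t \<in> S \<Longrightarrow> s * t \<in> S"
      "\<And>s. s \<in> S \<Longrightarrow> \<exists>e. homogeneous e s"
    and disj: "S \<inter> I = {}"
  obtains P where "P \<in> associated_primes (poly_ring X) I" "graded P" "I \<subseteq> P" "S \<inter> P = {}"
proof -
  define \<J> where "\<J> = {colon X I f |f e. f \<in> carrier (poly_ring X) \<and> homogeneous e f \<and>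
    S \<inter> colon X I f = {}}"
  have "colon X I 1 = I" using ideal_carr[OF I(1)] by (auto simp: colon_def)
  then have "I \<in> \<J>" unfolding \<J>_def using disj by blast
  moreover have "ideal J (poly_ring X)" if "J \<in> \<J>" for J
    using that ideal_colon[OF I(1)] by (auto simp: \<J>_def)
  ultimately obtain P where P: "P \<in> \<J>" and max: "\<And>J. J \<in> \<J> \<Longrightarrow> \<not> P \<subset> J"
    using exists_maximal[of I \<J>] by blast
  obtain f e where f: "P = colon X I f" "f \<in> carrier (poly_ring X)" "homogeneous e f"
    and SP: "S \<inter> P = {}"
    using P by (auto simp: \<J>_def)
  have step: "colon X I (a * f) = P"
    if a: "a \<in> carrier (poly_ring X)" "homogeneous d a" and "S \<inter> colon X I (a * f) = {}" for a d
  proof -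
    have "colon X I (a * f) \<in> \<J>"
      unfolding \<J>_def using that f homogeneous_mult[OF a(2) f(3)] by blast
    moreover have "P \<subseteq> colon X I (a * f)"
      using a(1) ideal_mult[OF I(1)] by (auto simp: f(1) colon_def mult.left_commute[of _ a])
    ultimately show ?thesis using max by blast
  qed
  have idP: "ideal P (poly_ring X)" unfolding f(1) by (rule ideal_colon[OF I(1)])
  have grP: "graded P" unfolding f(1) by (rule graded_colon[OF I f(3)])
  have prime: "primeideal P (poly_ring X)"
  proof (rule graded_primeI[OF idP grP])
    show "1 \<notin> P" using SP S(2) by blast
    fix a b :: "'k mpoly" and d d'
    assume a: "a \<in> carrier (poly_ring X)" "homogeneous d a"
      and b: "b \<in> carrier (poly_ring X)" and ab: "a * b \<in> P"
    show "a \<in> P \<or> b \<in> P"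
    proof (cases "S \<inter> colon X I (a * f) = {}")
      case True
      have "b \<in> colon X I (a * f)"
        using ab b by (auto simp: f(1) colon_def algebra_simps)
      then show ?thesis using step[OF a True] by simp
    next
      case False
      then obtain s where s: "s \<in> S" "s * (a * f) \<in> I" by (auto simp: colon_def)
      obtain e' where e': "homogeneous e' s" using S(4) s by blast
      have "S \<inter> colon X I (s * f) = {}"
      proof (rule ccontr)
        assume "S \<inter> colon X I (s * f) \<noteq> {}"
        then obtain t where "t \<in> S" "t * (s * f) \<in> I" by (auto simp: colon_def)
        then have "t * s \<in> S \<inter> P"
          using s S(1,3) by (auto simp: f(1) colon_def mult.assoc)
        then show False using SP by blast
      qed
      then have "colon X I (s * f) = P" using step e' s S(1) by blast
      moreover have "a \<in> colon X I (s * f)"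
        using a s by (auto simp: colon_def algebra_simps)
      ultimately show ?thesis by simp
    qed
  qed
  have "P \<in> associated_primes (poly_ring X) I"
    unfolding associated_primes_def using prime f by (auto simp: colon_def)
  moreover have "I \<subseteq> P" unfolding f(1) by (rule colon_incl[OF I(1) f(2)])
  ultimately show ?thesis using that grP SP by blast
qed

section \<open>Dimension modulo a subspace\<close>

interpretation mp: vector_space "\<lambda>c (f :: 'k::field mpoly). const c * f"
  by unfold_locales (simp_all add: algebra_simps)

interpretation mpp: vector_space_pair "\<lambda>c (f :: 'k::field mpoly). const c * f" "\<lambda>c (f :: 'k mpoly). const c * f"
  by unfold_locales

abbreviation mp_linear :: "('k::field mpoly \<Rightarrow> 'k mpoly) \<Rightarrow> bool" where
  "mp_linear \<equiv> Vector_Spaces.linear (\<lambda>c f. const c * f) (\<lambda>c f. const c * f)"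

lemma mp_linearI:
  assumes "\<And>x y. f (x + y) = f x + f y" "\<And>c x. f (const c * x) = const c * f x"
  shows "mp_linear f"
  using assms mp.vector_space_axioms by (simp add: Vector_Spaces.linear_iff)

lemma mp_linear_mult: "mp_linear (\<lambda>x. r * x)" "mp_linear (\<lambda>x. x * r)" "mp_linear (\<lambda>x. x)"
  by (rule mp_linearI; simp add: algebra_simps)+

lemma mp_linearD:
  assumes "mp_linear f"
  shows "f (x + y) = f x + f y" "f (const c * x) = const c * f x" "f 0 = 0" "f (x - y) = f x - f y"
  using assms mpp.linear_add mpp.linear_scale mpp.linear_0 mpp.linear_diff by auto

lemma mp_linear_compose: "mp_linear f \<Longrightarrow> mp_linear g \<Longrightarrow> mp_linear (\<lambda>x. g (f x))"
  by (rule mp_linearI) (simp_all add: mp_linearD)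

lemma mp_subspaceI:
  "0 \<in> V \<Longrightarrow> (\<And>x y. x \<in> V \<Longrightarrow> y \<in> V \<Longrightarrow> x + y \<in> V) \<Longrightarrow> (\<And>c x. x \<in> V \<Longrightarrow> const c * x \<in> V)
    \<Longrightarrow> mp.subspace V"
  by (simp add: mp.subspace_def)

lemma ideal_subspace: "ideal J (poly_ring X) \<Longrightarrow> mp.subspace J"
  by (auto intro!: mp_subspaceI intro: ideal_0 ideal_add ideal_const_mult)

definition fin_dim :: "'k::field mpoly set \<Rightarrow> bool" where
  "fin_dim V \<longleftrightarrow> (\<exists>F. finite F \<and> V \<subseteq> mp.span F)"

lemma fin_dim_subset: "fin_dim V \<Longrightarrow> U \<subseteq> V \<Longrightarrow> fin_dim U"
  by (auto simp: fin_dim_def)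

lemma fin_dim_image:
  assumes "fin_dim V" "mp_linear f"
  shows "fin_dim (f ` V)"
proof -
  obtain F where F: "finite F" "V \<subseteq> mp.span F" using assms by (auto simp: fin_dim_def)
  have "f ` V \<subseteq> mp.span (f ` F)"
    using F(2) mpp.linear_span_image[OF assms(2), of F] by auto
  then show ?thesis using F(1) unfolding fin_dim_def by blast
qed

lemma fin_dim_finite: "fin_dim V \<Longrightarrow> B \<subseteq> V \<Longrightarrow> mp.independent B \<Longrightarrow> finite B"
  unfolding fin_dim_def using mp.independent_span_bound[of _ B] by auto

lemma dim_mono:
  assumes "fin_dim W" "V \<subseteq> W"
  shows "mp.dim V \<le> mp.dim W"
proof -
  obtain B where B: "B \<subseteq> W" "mp.independent B" "W \<subseteq> mp.span B" "card B = mp.dim W"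
    using mp.basis_exists by blast
  have "finite B" using fin_dim_finite[OF assms(1) B(1,2)] .
  then show ?thesis using mp.dim_le_card[of V B] B assms(2) by auto
qed

lemma rank_nullity:
  assumes V: "mp.subspace V" "fin_dim V" and g: "mp_linear g"
  shows "mp.dim V = mp.dim {v \<in> V. g v = 0} + mp.dim (g ` V)"
proof -
  let ?K = "{v \<in> V. g v = 0}"
  have K: "mp.subspace ?K"
    using V(1) mp_linearD[OF g] by (auto intro!: mp_subspaceI
      intro: mp.subspace_0 mp.subspace_add mp.subspace_scale)
  obtain A where A: "A \<subseteq> ?K" "mp.independent A" "?K \<subseteq> mp.span A" "card A = mp.dim ?K"
    using mp.basis_exists by blast
  have "A \<subseteq> V" using A(1) by auto
  then obtain B where B: "A \<subseteq> B" "B \<subseteq> V" "mp.independent B" "V \<subseteq> mp.span B"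
    using mp.maximal_independent_subset_extend[of A V] A(2) by blast
  have finB: "finite B" by (rule fin_dim_finite[OF V(2) B(2,3)])
  have dimV: "card B = mp.dim V" using mp.basis_card_eq_dim[OF B(2,4,3)] .
  have spanA: "mp.span A \<subseteq> ?K" using mp.span_minimal[OF A(1) K] .
  have spanBV: "mp.span B \<subseteq> V" using mp.span_minimal[OF B(2) V(1)] .
  have inj: "inj_on g (mp.span (B - A))"
  proof (subst mpp.linear_inj_on_iff_eq_0[OF g mp.subspace_span], intro ballI impI)
    fix x assume x: "x \<in> mp.span (B - A)" and gx: "g x = 0"
    have "x \<in> V" using x mp.span_mono[of "B - A" B] spanBV by auto
    then have xA: "x \<in> mp.span A" using gx A(3) by auto
    obtain h where h: "mp_linear h" "\<And>b. b \<in> B \<Longrightarrow> h b = (if b \<in> A then 0 else b)"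
      using mpp.linear_independent_extend[OF B(3), of "\<lambda>b. if b \<in> A then 0 else b"] by blast
    have "h x = 0"
      by (rule mpp.linear_eq_0_on_span[OF h(1) _ xA]) (use h(2) B(1) in auto)
    moreover have "h x = x"
      by (rule mpp.linear_eq_on[OF h(1) mp_linear_mult(3) x]) (use h(2) in auto)
    ultimately show "x = 0" by simp
  qed
  have ind: "mp.independent (g ` (B - A))"
    using mp.independent_mono[OF B(3), of "B - A"] mpp.linear_independent_injective_image[OF g _ inj]
    by auto
  have card: "card (g ` (B - A)) = card (B - A)"
    by (rule card_image[OF inj_on_subset[OF inj mp.span_superset]])
  have "g ` V \<subseteq> mp.span (g ` (B - A))"
  proof -
    have "g ` V \<subseteq> mp.span (g ` B)"
      using B(4) mpp.linear_span_image[OF g, of B] by auto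
    also have "\<dots> \<subseteq> mp.span (g ` (B - A))"
    proof (rule mp.span_minimal[OF _ mp.subspace_span], clarify)
      fix b assume "b \<in> B"
      then show "g b \<in> mp.span (g ` (B - A))"
        using A(1) mp.span_zero[of "g ` (B - A)"] by (cases "b \<in> A") (auto intro: mp.span_base)
    qed
    finally show ?thesis .
  qed
  moreover have "g ` (B - A) \<subseteq> g ` V" using B(2) by auto
  ultimately have "mp.dim (g ` V) = card (B - A)"
    using mp.basis_card_eq_dim[OF _ _ ind] card by metis
  moreover have "card B = card A + card (B - A)"
    using finB B(1) by (metis card_Un_disjoint Diff_disjoint Diff_partition finite_subset finite_Diff)
  ultimately show ?thesis using dimV A(4) by simp
qed

text \<open>The projection along a complement of \<open>J\<close> plays the part of the quotient map.\<close>

lemma linear_with_kernel: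
  assumes J: "mp.subspace J"
  obtains \<pi> where "mp_linear \<pi>" "\<And>x. \<pi> x = 0 \<longleftrightarrow> x \<in> J" "\<And>x. \<pi> x - x \<in> J"
proof -
  obtain A where A: "A \<subseteq> J" "mp.independent A" "J \<subseteq> mp.span A"
    using mp.basis_exists[of J] by metis
  obtain B where B: "A \<subseteq> B" "mp.independent B" "UNIV \<subseteq> mp.span B"
    using mp.maximal_independent_subset_extend[OF subset_UNIV A(2)] by metis
  obtain h where h: "mp_linear h" "\<And>b. b \<in> B \<Longrightarrow> h b = (if b \<in> A then 0 else b)"
    using mpp.linear_independent_extend[OF B(2), of "\<lambda>b. if b \<in> A then 0 else b"] by blast
  have zero: "h x = 0" if "x \<in> J" for x
    by (rule mpp.linear_eq_0_on_span[OF h(1) _ subsetD[OF A(3) that]]) (use h(2) B(1) in auto)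
  have diff: "h x - x \<in> J" for x
  proof -
    have "x \<in> mp.span B" using B(3) by auto
    then show ?thesis
    proof (induction rule: mp.span_induct_alt)
      case base
      then show ?case using mp.subspace_0[OF J] mp_linearD[OF h(1)] by simp
    next
      case (step c x y)
      have "h x - x \<in> J"
        using h(2)[OF step(1)] A(1) mp.subspace_0[OF J] mp.subspace_neg[OF J] by auto
      then have "const c * (h x - x) + (h y - y) \<in> J"
        using step(2) J by (intro mp.subspace_add mp.subspace_scale)
      moreover have "h (const c * x + y) - (const c * x + y) = const c * (h x - x) + (h y - y)"
        by (simp add: mp_linearD(1,2)[OF h(1)] right_diff_distrib)
      ultimately show ?case by (simp only:)
    qed
  qed
  have "x \<in> J" if "h x = 0" for x
    using diff[of x] that mp.subspace_neg[OF J, of "- x"] by simp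
  then show ?thesis using that[OF h(1) _ diff] zero by blast
qed

text \<open>The dimension of \<open>V/(V \<inter> J)\<close>, for finite-dimensional \<open>V\<close>. Working with subspaces of the
  polynomials replaces quotient spaces.\<close>

definition dim_mod :: "'k::field mpoly set \<Rightarrow> 'k mpoly set \<Rightarrow> nat" where
  "dim_mod J V = mp.dim V - mp.dim (V \<inter> J)"

lemma dim_mod_cong: "V \<inter> J = V \<inter> K \<Longrightarrow> dim_mod J V = dim_mod K V"
  by (simp add: dim_mod_def)

lemma dim_mod_image:
  assumes V: "mp.subspace V" "fin_dim V" and g: "mp_linear g"
    and ker: "\<And>v. v \<in> V \<Longrightarrow> g v = 0 \<longleftrightarrow> v \<in> J"
  shows "dim_mod J V = mp.dim (g ` V)"
proof -
  have "{v \<in> V. g v = 0} = V \<inter> J" using ker by auto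
  then show ?thesis
    using rank_nullity[OF V g] by (simp add: dim_mod_def)
qed

lemma linear_image_subspace: "mp_linear f \<Longrightarrow> mp.subspace V \<Longrightarrow> mp.subspace (f ` V)"
  by (rule mpp.linear_subspace_image)

text \<open>Additivity of the dimension on the exact sequence \<open>0 \<rightarrow> U/J\<^sub>1 \<rightarrow> V/J \<rightarrow> V/K \<rightarrow> 0\<close>, whose first map
  is induced by \<open>f\<close>.\<close>

lemma dim_mod_exact:
  assumes U: "mp.subspace U" "fin_dim U" and V: "mp.subspace V" "fin_dim V"
    and J: "mp.subspace J" and K: "mp.subspace K" and JK: "J \<subseteq> K"
    and f: "mp_linear f" "\<And>u. u \<in> U \<Longrightarrow> f u \<in> V"
    and ker: "\<And>u. u \<in> U \<Longrightarrow> f u \<in> J \<longleftrightarrow> u \<in> J1"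
    and im: "\<And>v. v \<in> V \<Longrightarrow> v \<in> K \<longleftrightarrow> (\<exists>u\<in>U. v - f u \<in> J)"
  shows "dim_mod J V = dim_mod K V + dim_mod J1 U"
proof -
  obtain p where p: "mp_linear p" "\<And>x. p x = 0 \<longleftrightarrow> x \<in> J" "\<And>x. p x - x \<in> J"
    using linear_with_kernel[OF J] by blast
  obtain q where q: "mp_linear q" "\<And>x. q x = 0 \<longleftrightarrow> x \<in> K"
    using linear_with_kernel[OF K] by blast
  have qp: "q (p v) = q v" for v
  proof -
    have "q (p v - v) = 0" using p(3) JK q(2) by auto
    then show ?thesis by (simp add: mp_linearD[OF q(1)])
  qed
  have peq: "p v = p w \<longleftrightarrow> v - w \<in> J" for v w
    using p(2)[of "v - w"] by (simp add: mp_linearD[OF p(1)])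
  have "dim_mod J V = mp.dim (p ` V)"
    by (rule dim_mod_image[OF V p(1)]) (use p in auto)
  also have "\<dots> = mp.dim {w \<in> p ` V. q w = 0} + mp.dim (q ` p ` V)"
    using V p(1) q(1) by (intro rank_nullity fin_dim_image linear_image_subspace)
  also have "q ` p ` V = q ` V" using qp by (auto simp: image_image)
  also have "mp.dim (q ` V) = dim_mod K V"
    by (rule dim_mod_image[OF V q(1), symmetric]) (use q in auto)
  also have "{w \<in> p ` V. q w = 0} = (\<lambda>u. p (f u)) ` U"
  proof (intro equalityI subsetI)
    fix w assume "w \<in> {w \<in> p ` V. q w = 0}"
    then obtain v where v: "v \<in> V" "w = p v" "q v = 0" using qp by auto
    then obtain u where "u \<in> U" "v - f u \<in> J" using im q(2) by auto
    then show "w \<in> (\<lambda>u. p (f u)) ` U" using v peq by auto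
  next
    fix w assume "w \<in> (\<lambda>u. p (f u)) ` U"
    then obtain u where u: "u \<in> U" "w = p (f u)" by auto
    moreover have "f u \<in> K"
      using im[OF f(2)[OF u(1)]] u(1) mp.subspace_0[OF J] by (metis diff_self)
    then have "q w = 0" using q(2)[of "f u"] qp[of "f u"] u(2) by simp
    ultimately show "w \<in> {w \<in> p ` V. q w = 0}" using f(2) by auto
  qed
  also have "mp.dim ((\<lambda>u. p (f u)) ` U) = dim_mod J1 U"
    by (rule dim_mod_image[OF U mp_linear_compose[OF f(1) p(1)], symmetric]) (use p ker in auto)
  finally show ?thesis by simp
qed

lemma dim_mod_basis:
  assumes V: "mp.subspace V" "fin_dim V" and J: "mp.subspace J"
  obtains B where "finite B" "B \<subseteq> V" "card B = dim_mod J V"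
    "\<And>v. v \<in> V \<Longrightarrow> \<exists>x\<in>mp.span B. v - x \<in> J"
    "\<And>b x. b \<in> B \<Longrightarrow> x \<in> mp.span (B - {b}) \<Longrightarrow> b - x \<notin> J"
proof -
  obtain p where p: "mp_linear p" "\<And>x. p x = 0 \<longleftrightarrow> x \<in> J" "\<And>x. p x - x \<in> J"
    using linear_with_kernel[OF J] by blast
  have peq: "p v = p w \<longleftrightarrow> v - w \<in> J" for v w
    using p(2)[of "v - w"] by (simp add: mp_linearD[OF p(1)])
  obtain C where C: "C \<subseteq> p ` V" "mp.independent C" "p ` V \<subseteq> mp.span C" "card C = mp.dim (p ` V)"
    using mp.basis_exists by blast
  then obtain B where B: "B \<subseteq> V" "inj_on p B" "C = p ` B" by (meson subset_image_inj)
  have "finite C" by (rule fin_dim_finite[OF fin_dim_image[OF V(2) p(1)] C(1,2)])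
  then have finB: "finite B" using B finite_imageD by blast
  have sp: "p ` mp.span A = mp.span (p ` A)" for A
    using mpp.linear_span_image[OF p(1)] by simp
  show ?thesis
  proof (rule that[OF finB B(1)])
    show "card B = dim_mod J V"
      using C(4) card_image[OF B(2)] B(3) dim_mod_image[OF V p(1), of J] p(2) by simp
    fix v assume "v \<in> V"
    then have "p v \<in> p ` mp.span B" using C(3) B(3) sp[of B] by auto
    then show "\<exists>x\<in>mp.span B. v - x \<in> J" using peq by auto
  next
    fix b x assume b: "b \<in> B" and x: "x \<in> mp.span (B - {b})"
    show "b - x \<notin> J"
    proof
      assume "b - x \<in> J"
      then have "p b \<in> mp.span (p ` (B - {b}))" using x peq sp by blast
      also have "p ` (B - {b}) = C - {p b}" using B(2,3) b by (auto simp: inj_on_def)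
      finally show False using C(2) b B(3) by (auto simp: mp.dependent_def)
    qed
  qed
qed

lemma dim_mod_le_card:
  assumes V: "mp.subspace V" "fin_dim V" and J: "mp.subspace J" and F: "finite F"
    and sp: "\<And>v. v \<in> V \<Longrightarrow> \<exists>x\<in>mp.span F. v - x \<in> J"
  shows "dim_mod J V \<le> card F"
proof -
  obtain p where p: "mp_linear p" "\<And>x. p x = 0 \<longleftrightarrow> x \<in> J" "\<And>x. p x - x \<in> J"
    using linear_with_kernel[OF J] by blast
  have peq: "p v = p w \<longleftrightarrow> v - w \<in> J" for v w
    using p(2)[of "v - w"] by (simp add: mp_linearD[OF p(1)])
  have "p ` V \<subseteq> p ` mp.span F" using sp peq by fast
  also have "\<dots> = mp.span (p ` F)" using mpp.linear_span_image[OF p(1)] by simp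
  finally have "mp.dim (p ` V) \<le> card (p ` F)"
    using F by (intro mp.dim_le_card) auto
  also have "\<dots> \<le> card F" using F by (rule card_image_le)
  also have "mp.dim (p ` V) = dim_mod J V"
    by (rule dim_mod_image[OF V p(1), symmetric]) (use p in auto)
  finally show ?thesis .
qed

lemma dim_mod_inj:
  assumes U: "mp.subspace U" "fin_dim U" and V: "mp.subspace V" "fin_dim V"
    and J: "mp.subspace J" and f: "mp_linear f"
    and cong: "\<And>u. u \<in> U \<Longrightarrow> \<exists>v\<in>V. f u - v \<in> J"
    and ker: "\<And>u. u \<in> U \<Longrightarrow> f u \<in> J \<Longrightarrow> u \<in> J1"
  shows "dim_mod J1 U \<le> dim_mod J V"
proof -
  obtain p where p: "mp_linear p" "\<And>x. p x = 0 \<longleftrightarrow> x \<in> J" "\<And>x. p x - x \<in> J"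
    using linear_with_kernel[OF J] by blast
  have peq: "p v = p w \<longleftrightarrow> v - w \<in> J" for v w
    using p(2)[of "v - w"] by (simp add: mp_linearD[OF p(1)])
  have "mp.dim (U \<inter> {u. f u \<in> J}) \<le> mp.dim (U \<inter> J1)"
    using fin_dim_subset[OF U(2), of "U \<inter> J1"] ker by (intro dim_mono) auto
  then have "dim_mod J1 U \<le> dim_mod {u. f u \<in> J} U"
    by (simp add: dim_mod_def)
  also have "\<dots> = mp.dim ((\<lambda>u. p (f u)) ` U)"
    by (rule dim_mod_image[OF U mp_linear_compose[OF f p(1)]]) (use p in auto)
  also have "\<dots> \<le> mp.dim (p ` V)"
  proof (rule dim_mono[OF fin_dim_image[OF V(2) p(1)]])
    show "(\<lambda>u. p (f u)) ` U \<subseteq> p ` V"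
    proof
      fix w assume "w \<in> (\<lambda>u. p (f u)) ` U"
      then obtain u where "u \<in> U" "w = p (f u)" by auto
      then show "w \<in> p ` V" using cong[of u] peq by auto
    qed
  qed
  also have "\<dots> = dim_mod J V"
    by (rule dim_mod_image[OF V p(1), symmetric]) (use p in auto)
  finally show ?thesis .
qed

lemma dim_mod_mono:
  assumes "mp.subspace U" "mp.subspace V" "fin_dim V" "mp.subspace J" "U \<subseteq> V" "U \<inter> J \<subseteq> J1"
  shows "dim_mod J1 U \<le> dim_mod J V"
proof (rule dim_mod_inj[where f = "\<lambda>x. x"])
  fix u assume "u \<in> U"
  then show "\<exists>v\<in>V. u - v \<in> J"
    using assms mp.subspace_0[OF assms(4)] by (intro bexI[of _ u]) auto
qed (use assms fin_dim_subset mp_linear_mult in auto)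

text \<open>Each of the multiples of \<open>W\<close> contributes at most the dimension of \<open>W\<close> modulo \<open>J\<close>.\<close>

lemma dim_mod_cover:
  fixes u :: "'i \<Rightarrow> 'k::field mpoly"
  assumes V: "mp.subspace V" "fin_dim V" and W: "mp.subspace W" "fin_dim W"
    and J: "mp.subspace J" and F: "finite F"
    and mult: "\<And>i x. i \<in> F \<Longrightarrow> x \<in> J \<Longrightarrow> u i * x \<in> J"
    and cover: "\<And>v. v \<in> V \<Longrightarrow> \<exists>w. (\<forall>i\<in>F. w i \<in> W) \<and> v - (\<Sum>i\<in>F. u i * w i) \<in> J"
  shows "dim_mod J V \<le> card F * dim_mod J W"
proof -
  obtain B where B: "finite B" "B \<subseteq> W" "card B = dim_mod J W"
    "\<And>v. v \<in> W \<Longrightarrow> \<exists>x\<in>mp.span B. v - x \<in> J"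
    using dim_mod_basis[OF W J] by metis
  let ?F = "(\<lambda>(i, b). u i * b) ` (F \<times> B)"
  have "dim_mod J V \<le> card ?F"
  proof (rule dim_mod_le_card[OF V J])
    fix v assume "v \<in> V"
    then obtain w where w: "\<And>i. i \<in> F \<Longrightarrow> w i \<in> W" "v - (\<Sum>i\<in>F. u i * w i) \<in> J"
      using cover by blast
    have "\<forall>i\<in>F. \<exists>x\<in>mp.span B. w i - x \<in> J" using w B(4) by blast
    then obtain x where x: "\<And>i. i \<in> F \<Longrightarrow> x i \<in> mp.span B" "\<And>i. i \<in> F \<Longrightarrow> w i - x i \<in> J"
      by metis
    have "u i * x i \<in> mp.span ?F" if i: "i \<in> F" for i
    proof -
      have "u i * x i \<in> (\<lambda>y. u i * y) ` mp.span B" using x(1)[OF i] by blast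
      also have "\<dots> = mp.span ((\<lambda>y. u i * y) ` B)"
        by (rule mpp.linear_span_image[OF mp_linear_mult(1), symmetric])
      also have "\<dots> \<subseteq> mp.span ?F" using i by (intro mp.span_mono) auto
      finally show ?thesis .
    qed
    then have "(\<Sum>i\<in>F. u i * x i) \<in> mp.span ?F" by (rule mp.span_sum)
    moreover have "v - (\<Sum>i\<in>F. u i * x i) \<in> J"
    proof -
      have "(\<Sum>i\<in>F. u i * (w i - x i)) \<in> J"
        using x(2) mult by (intro mp.subspace_sum[OF J]) auto
      then have "(v - (\<Sum>i\<in>F. u i * w i)) + (\<Sum>i\<in>F. u i * (w i - x i)) \<in> J"
        using mp.subspace_add[OF J w(2)] by blast
      then show ?thesis by (simp add: sum_subtractf algebra_simps)
    qed
    ultimately show "\<exists>x\<in>mp.span ?F. v - x \<in> J" by blast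
  qed (use F B(1) in auto)
  also have "\<dots> \<le> card (F \<times> B)" using F B(1) by (intro card_image_le) auto
  finally show ?thesis using B(3) by (simp add: card_cartesian_product)
qed

section \<open>Hilbert functions\<close>

definition Deg :: "nat set \<Rightarrow> nat \<Rightarrow> 'k::field mpoly set" where
  "Deg X s = {f \<in> carrier (poly_ring X). homogeneous s f}"

definition Upto :: "nat set \<Rightarrow> nat \<Rightarrow> 'k::field mpoly set" where
  "Upto X s = {f \<in> carrier (poly_ring X). \<forall>m\<in>keys f. total_deg m \<le> s}"

text \<open>The dimensions of \<open>R/J\<close> in degree \<open>s\<close> and up to degree \<open>s\<close>. The second one measures the growth
  of \<open>R/J\<close> also when \<open>J\<close> is not homogeneous, which is needed for arbitrary chains of primes.\<close>

definition hf :: "nat set \<Rightarrow> 'k::field mpoly set \<Rightarrow> nat \<Rightarrow> nat" where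
  "hf X J s = dim_mod J (Deg X s)"

definition hfa :: "nat set \<Rightarrow> 'k::field mpoly set \<Rightarrow> nat \<Rightarrow> nat" where
  "hfa X J s = dim_mod J (Upto X s)"

lemma keys_const_mult: "keys (const c * f) \<subseteq> keys f"
  by (auto simp: in_keys_iff lookup_const_mult)

lemma subspace_Deg: "mp.subspace (Deg X s)"
  by (auto simp: Deg_def intro!: mp_subspaceI homogeneous_add homogeneous_const_mult)

lemma Upto_add: "f \<in> Upto X s \<Longrightarrow> g \<in> Upto X s \<Longrightarrow> f + g \<in> Upto X s"
  using keys_add[of f g] by (auto simp: Upto_def)

lemma Upto_0 [simp]: "0 \<in> Upto X s"
  by (simp add: Upto_def)

lemma subspace_Upto: "mp.subspace (Upto X s)"
proof (rule mp_subspaceI)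
  fix c f assume "f \<in> Upto X s"
  then show "const c * f \<in> Upto X s"
    using keys_const_mult[of c f] by (auto simp: Upto_def)
qed (auto intro: Upto_add)

lemma Upto_mult: "f \<in> Upto X s \<Longrightarrow> g \<in> Upto X t \<Longrightarrow> f * g \<in> Upto X (s + t)"
  using keys_mult[of f g] by (fastforce simp: Upto_def total_deg_add)

lemma Upto_mono: "s \<le> t \<Longrightarrow> Upto X s \<subseteq> Upto X t"
  by (fastforce simp: Upto_def)

lemma Upto_mono_vars: "Y \<subseteq> X \<Longrightarrow> Upto Y s \<subseteq> Upto X s"
  using poly_ring_mono[of Y X] by (auto simp: Upto_def)

lemma Upto_1 [simp]: "1 \<in> Upto X s"
  by (auto simp: Upto_def)

lemma Upto_power: "f \<in> Upto X e \<Longrightarrow> f ^ n \<in> Upto X (n * e)"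
proof (induction n)
  case (Suc n)
  then show ?case using Upto_mult[of f X e "f ^ n" "n * e"] by simp
qed simp

lemma Upto_exists: "f \<in> carrier (poly_ring X) \<Longrightarrow> \<exists>s. f \<in> Upto X s"
  using grade_boundD[of _ f total_deg] by (auto simp: Upto_def)

lemma Deg_Upto: "Deg X s \<subseteq> Upto X s"
  by (auto simp: Upto_def Deg_def homogeneous_def)

lemma Deg_mult: "f \<in> Deg X s \<Longrightarrow> g \<in> Deg X t \<Longrightarrow> f * g \<in> Deg X (s + t)"
  by (auto simp: Deg_def intro: homogeneous_mult)

lemma hcomp_Deg: "f \<in> carrier (poly_ring X) \<Longrightarrow> hcomp s f \<in> Deg X s"
  by (auto simp: Deg_def)

lemma Upto_sum_hcomp: "f \<in> Upto X s \<Longrightarrow> f = (\<Sum>i\<le>s. hcomp i f)"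
  by (rule sum_parts, rule grade_bound_leI) (auto simp: Upto_def)

lemma Upto_carrier: "f \<in> Upto X s \<Longrightarrow> f \<in> carrier (poly_ring X)"
  and Deg_carrier: "f \<in> Deg X s \<Longrightarrow> f \<in> carrier (poly_ring X)"
  and Deg_homogeneous: "f \<in> Deg X s \<Longrightarrow> homogeneous s f"
  by (auto simp: Upto_def Deg_def)

lemma finite_monoms:
  assumes "finite X"
  shows "finite {m \<in> monoms X. total_deg m \<le> s}"
proof -
  have "lookup ` {m \<in> monoms X. total_deg m \<le> s}
      \<subseteq> {f. \<forall>x. (x \<in> X \<longrightarrow> f x \<in> {..s}) \<and> (x \<notin> X \<longrightarrow> f x = 0)}"
  proof (clarsimp, intro conjI impI)
    fix m x assume m: "m \<in> monoms X" "total_deg m \<le> s"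
    show "lookup m x = 0" if "x \<notin> X" using lookup_monoms[OF m(1) that] .
    have "lookup m x \<le> (\<Sum>j\<in>X. lookup m j)" if "x \<in> X"
      using assms that by (rule member_le_sum[rotated 2]) auto
    then show "lookup m x \<le> s" if "x \<in> X"
      using that m total_deg_eq[of m X] assms by (auto simp: monoms_def)
  qed
  then have "finite (lookup ` {m \<in> monoms X. total_deg m \<le> s})"
    using finite_set_of_finite_funs[OF assms, of "{..s}" 0] by (rule finite_subset) simp
  then show ?thesis
    by (rule finite_imageD) (simp add: inj_on_def lookup_inject)
qed

lemma Upto_span:
  assumes "f \<in> Upto X s"
  shows "f \<in> mp.span ((\<lambda>m. single m 1) ` {m \<in> monoms X. total_deg m \<le> s})"
proof -
  have "f = (\<Sum>m\<in>keys f. const (lookup f m) * single m 1)"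
    by (subst poly_mapping_sum_single[of f]) (simp add: const_def mult_single)
  moreover have "(\<Sum>m\<in>keys f. const (lookup f m) * single m 1)
      \<in> mp.span ((\<lambda>m. single m 1) ` {m \<in> monoms X. total_deg m \<le> s})"
    using assms by (intro mp.span_sum mp.span_scale mp.span_base imageI)
      (auto simp: Upto_def in_poly_ring)
  ultimately show ?thesis by simp
qed

lemma fin_dim_Upto: "finite X \<Longrightarrow> fin_dim (Upto X s)"
  unfolding fin_dim_def using finite_monoms[of X s] Upto_span by blast

lemma fin_dim_Deg: "finite X \<Longrightarrow> fin_dim (Deg X s)"
  by (rule fin_dim_subset[OF fin_dim_Upto Deg_Upto])

subsection \<open>Comparison with the dimension in the quotient ring\<close>

lemma subfield_const: "subfield (range const) (poly_ring X :: 'k::field mpoly ring)"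
proof -
  interpret R: cring "poly_ring X :: 'k mpoly ring" by (rule cring_poly_ring)
  have inv: "\<ominus>\<^bsub>poly_ring X\<^esub> f = - f" if "f \<in> carrier (poly_ring X)" for f :: "'k mpoly"
    using that by (intro R.minus_equality) auto
  have inv_const: "const (inverse c) * const c = (1 :: 'k mpoly)" if "c \<noteq> 0" for c
    using that by (simp flip: const_simps(4))
  have nz: "const c = (0 :: 'k mpoly) \<longleftrightarrow> c = 0" for c
    by (metis const_simps(1) const_def lookup_single_eq lookup_zero)
  have "subring (range const) (poly_ring X :: 'k mpoly ring)"
  proof (rule R.subringI)
    show "\<one>\<^bsub>poly_ring X\<^esub> \<in> range (const :: 'k \<Rightarrow> _)"
      by (rule image_eqI[of _ _ 1]) simp_all
  qed (auto simp: inv const_uminus[symmetric] const_simps(3,4)[symmetric]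
      simp del: const_uminus const_simps)
  then have sub: "subcring (range const) (poly_ring X :: 'k mpoly ring)"
    by (rule R.subcringI')
  show ?thesis
  proof (rule R.subfieldI[OF sub])
    show "Units (poly_ring X\<lparr>carrier := range const\<rparr>) = range const - {\<zero>\<^bsub>poly_ring X :: 'k mpoly ring\<^esub>}"
      unfolding Units_def using inv_const nz
      by (auto simp: mult.commute)
  qed
qed

lemma dim_zero_ring:
  assumes "ring A" "carrier A = {\<zero>\<^bsub>A\<^esub>}"
  shows "ring.dim A K {\<zero>\<^bsub>A\<^esub>} = 0"
proof -
  interpret ring A by fact
  have "E = {\<zero>\<^bsub>A\<^esub>} \<and> n = 0" if "dimension n K E" for n E
    using that by (induction rule: dimension.induct) (auto simp: assms(2))
  then show ?thesis unfolding dim_def by (intro the_equality) auto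
qed

text \<open>The dimension over a subfield of a ring is defined by adjoining one independent element after
  the other. It is evaluated here on representatives of a basis of \<open>V\<close> modulo \<open>I\<close>.\<close>

lemma dim_quotient:
  fixes I :: "'k::field mpoly set"
  assumes I: "ideal I (poly_ring X)" and V: "mp.subspace V" "fin_dim V" "V \<subseteq> carrier (poly_ring X)"
  shows "ring.dim (poly_ring X Quot I) ((\<lambda>c. I +>\<^bsub>poly_ring X\<^esub> const c) ` UNIV)
      ((\<lambda>f. I +>\<^bsub>poly_ring X\<^esub> f) ` V) = dim_mod I V"
proof -
  let ?R = "poly_ring X :: 'k mpoly ring"
  let ?q = "\<lambda>f. I +>\<^bsub>?R\<^esub> f"
  let ?K = "(\<lambda>c. ?q (const c)) ` UNIV"
  interpret R: cring ?R by (rule cring_poly_ring)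
  interpret I: ideal I ?R by fact
  interpret Q: ring "?R Quot I" by (rule I.quotient_is_ring)
  interpret h: ring_hom_ring ?R "?R Quot I" ?q by (rule I.rcos_ring_hom_ring)
  have eq: "?q f = ?q g \<longleftrightarrow> f - g \<in> I" if "f \<in> carrier ?R" "g \<in> carrier ?R" for f g
  proof -
    have "\<ominus>\<^bsub>?R\<^esub> g = - g" using that by (intro R.minus_equality) auto
    then show ?thesis
      using R.quotient_eq_iff_same_a_r_cos[OF I that] by (simp add: a_minus_def)
  qed
  have zero: "\<zero>\<^bsub>?R Quot I\<^esub> = ?q 0" using h.hom_zero by simp
  obtain B where B: "finite B" "B \<subseteq> V" "card B = dim_mod I V"
    "\<And>v. v \<in> V \<Longrightarrow> \<exists>x\<in>mp.span B. v - x \<in> I"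
    "\<And>b x. b \<in> B \<Longrightarrow> x \<in> mp.span (B - {b}) \<Longrightarrow> b - x \<notin> I"
    using dim_mod_basis[OF V(1,2) ideal_subspace[OF I]] by metis
  have span_carr: "mp.span A \<subseteq> carrier ?R" if "A \<subseteq> B" for A
  proof (rule mp.span_minimal)
    show "A \<subseteq> carrier ?R" using that B(2) V(3) by auto
    show "mp.subspace (carrier ?R)" by (rule ideal_subspace[OF ideal_carrier])
  qed
  have dim: "Q.dimension (card A) ?K (?q ` mp.span A)" if "A \<subseteq> B" for A
    using finite_subset[OF that B(1)] that
  proof (induction A)
    case empty
    show ?case using Q.zero_dim[of ?K] by (simp add: zero)
  next
    case (insert b A)
    have b: "b \<in> carrier ?R" using insert.prems B(2) V(3) by auto
    have A: "mp.span A \<subseteq> carrier ?R" using span_carr insert.prems by auto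
    have "?q b \<notin> ?q ` mp.span A"
    proof
      assume "?q b \<in> ?q ` mp.span A"
      then obtain x where x: "x \<in> mp.span A" "?q b = ?q x" by auto
      then have "b - x \<in> I" using eq b A by auto
      moreover have "x \<in> mp.span (B - {b})"
        using x(1) mp.span_mono[of A "B - {b}"] insert by auto
      ultimately show False using B(5) insert.prems by auto
    qed
    then have "Q.dimension (Suc (card A)) ?K (Q.line_extension ?K (?q b) (?q ` mp.span A))"
      using insert b by (intro Q.Suc_dim) auto
    also have "Q.line_extension ?K (?q b) (?q ` mp.span A) = ?q ` mp.span (insert b A)"
    proof -
      have lin: "?q (const c) \<otimes>\<^bsub>?R Quot I\<^esub> ?q b \<oplus>\<^bsub>?R Quot I\<^esub> ?q x = ?q (const c * b + x)"
        if "x \<in> mp.span A" for c x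
        using h.hom_add[of "const c * b" x] h.hom_mult[of "const c" b] b A that
        by (simp add: poly_ring_mult subsetD)
      have "u \<in> Q.line_extension ?K (?q b) (?q ` mp.span A) \<longleftrightarrow> u \<in> ?q ` mp.span (insert b A)" for u
      proof -
        have "u \<in> Q.line_extension ?K (?q b) (?q ` mp.span A)
          \<longleftrightarrow> (\<exists>c. \<exists>x\<in>mp.span A. u = ?q (const c * b + x))"
          using lin by (auto simp: Q.line_extension_mem_iff)
        also have "\<dots> \<longleftrightarrow> u \<in> ?q ` mp.span (insert b A)"
        proof (safe)
          fix c x assume "x \<in> mp.span A"
          then have "const c * b + x \<in> mp.span (insert b A)"
            by (auto simp: mp.span_insert intro!: exI[of _ c])
          then show "?q (const c * b + x) \<in> ?q ` mp.span (insert b A)" by blast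
        next
          fix y assume "y \<in> mp.span (insert b A)"
          then obtain c where "y - const c * b \<in> mp.span A" by (auto simp: mp.span_insert)
          then show "\<exists>c. \<exists>x\<in>mp.span A. ?q y = ?q (const c * b + x)"
            by (intro exI[of _ c] bexI[of _ "y - const c * b"]) auto
        qed
        finally show ?thesis .
      qed
      then show ?thesis by blast
    qed
    finally show ?case using insert by simp
  qed
  have "?q ` mp.span B = ?q ` V"
  proof
    show "?q ` mp.span B \<subseteq> ?q ` V" using mp.span_minimal[OF B(2) V(1)] by auto
    show "?q ` V \<subseteq> ?q ` mp.span B"
    proof
      fix u assume "u \<in> ?q ` V"
      then obtain v where v: "v \<in> V" "u = ?q v" by auto
      then obtain x where x: "x \<in> mp.span B" "v - x \<in> I" using B(4) by blast
      then have "u = ?q x" using eq[of v x] v V(3) span_carr[of B] by auto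
      then show "u \<in> ?q ` mp.span B" using x by blast
    qed
  qed
  then have dimV: "Q.dimension (dim_mod I V) ?K (?q ` V)" using dim[of B] B(3) by simp
  show ?thesis
  proof (cases "1 \<in> I")
    case False
    have "\<one>\<^bsub>?R Quot I\<^esub> \<noteq> \<zero>\<^bsub>?R Quot I\<^esub>"
      using eq[of 1 0] False h.hom_one zero by auto
    then have "subfield (?q ` range const) (?R Quot I)"
      by (rule h.img_is_subfield(2)[OF subfield_const])
    then have "subfield ?K (?R Quot I)" by (simp add: image_image)
    then show ?thesis using Q.dimI[OF _ dimV] by (simp add: over_def)
  next
    case True
    then have J: "I = carrier ?R" using ideal_proper_iff[OF I] by auto
    have c: "carrier (?R Quot I) = {\<zero>\<^bsub>?R Quot I\<^esub>}"
    proof -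
      have q0: "?q f = ?q 0" if "f \<in> carrier ?R" for f using eq[of f 0] that J by auto
      have "carrier (?R Quot I) = {?q f |f. f \<in> carrier ?R}"
        unfolding FactRing_def A_RCOSETS_def' by auto
      also have "\<dots> = {?q 0}" using q0 poly_ring_zero[of X] by blast
      finally show ?thesis unfolding zero .
    qed
    have "?q ` V \<subseteq> {\<zero>\<^bsub>?R Quot I\<^esub>}" using V(3) c h.hom_closed by blast
    moreover have "0 \<in> V" using mp.subspace_0[OF V(1)] .
    ultimately have "?q ` V = {\<zero>\<^bsub>?R Quot I\<^esub>}" by auto
    moreover have "dim_mod I V = 0"
      using V(3) J by (simp add: dim_mod_def Int_absorb2)
    ultimately show ?thesis using dim_zero_ring[OF Q.ring_axioms c] by simp
  qed
qed

lemma hilbert_function_eq: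
  assumes "finite X" "ideal I (poly_ring X)"
  shows "hilbert_function X I s = hf X I s"
  unfolding hilbert_function_def hf_def
  using dim_quotient[OF assms(2) subspace_Deg fin_dim_Deg[OF assms(1)], of s] Deg_carrier
  by (auto simp: Deg_def)

subsection \<open>Exact sequences\<close>

text \<open>Multiplication by \<open>f\<close> gives the exact sequence \<open>0 \<rightarrow> (R/(J : f))(-e) \<rightarrow> R/J \<rightarrow> R/(J + (f)) \<rightarrow> 0\<close>.\<close>

lemma hf_exact:
  fixes J :: "'k::field mpoly set"
  assumes X: "finite X" and J: "ideal J (poly_ring X)" "graded J"
    and f: "f \<in> carrier (poly_ring X)" "homogeneous e f"
  shows "hf X J s = hf X (adjoin X J f) s + (if e \<le> s then hf X (colon X J f) (s - e) else 0)"
proof (cases "e \<le> s")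
  case True
  have "dim_mod J (Deg X s) = dim_mod (adjoin X J f) (Deg X s) + dim_mod (colon X J f) (Deg X (s - e))"
  proof (rule dim_mod_exact[where f = "\<lambda>u. u * f"])
    show "mp_linear (\<lambda>u. u * f)" by (rule mp_linear_mult)
    show "mp.subspace J" "mp.subspace (adjoin X J f)"
      using ideal_subspace J(1) ideal_adjoin[OF J(1) f(1)] by auto
    show "u * f \<in> Deg X s" if "u \<in> Deg X (s - e)" for u
      using Deg_mult[OF that, of f e] f True by (auto simp: Deg_def)
    show "u * f \<in> J \<longleftrightarrow> u \<in> colon X J f" if "u \<in> Deg X (s - e)" for u
      using that by (auto simp: colon_def Deg_def)
    fix v :: "'k mpoly" assume v: "v \<in> Deg X s"
    show "v \<in> adjoin X J f \<longleftrightarrow> (\<exists>u\<in>Deg X (s - e). v - u * f \<in> J)"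
    proof
      assume "v \<in> adjoin X J f"
      then obtain g r where gr: "v = g + r * f" "g \<in> J" "r \<in> carrier (poly_ring X)"
        by (auto simp: adjoin_def)
      have "v = hcomp s (g + r * f)"
        using gr(1) hcomp_homogeneous[OF Deg_homogeneous[OF v], of s] by simp
      also have "\<dots> = hcomp s g + hcomp (s - e) r * f"
        using True hcomp_homogeneous_mult[OF f(2), of s r] by (simp add: part_add mult.commute)
      finally show "\<exists>u\<in>Deg X (s - e). v - u * f \<in> J"
        using gradedD[OF J(2) gr(2)] hcomp_Deg[OF gr(3)] by (intro bexI[of _ "hcomp (s - e) r"]) auto
    next
      assume "\<exists>u\<in>Deg X (s - e). v - u * f \<in> J"
      then obtain u where "u \<in> Deg X (s - e)" "v - u * f \<in> J" by blast
      then show "v \<in> adjoin X J f"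
        unfolding adjoin_def by (intro CollectI exI[of _ "v - u * f"] exI[of _ u]) (auto simp: Deg_def)
    qed
  qed (use X subspace_Deg fin_dim_Deg in \<open>auto intro: subsetD[OF adjoin_incl]\<close>)
  then show ?thesis using True by (simp add: hf_def)
next
  case False
  have "Deg X s \<inter> J = Deg X s \<inter> adjoin X J f"
  proof
    show "Deg X s \<inter> adjoin X J f \<subseteq> Deg X s \<inter> J"
    proof
      fix v assume v: "v \<in> Deg X s \<inter> adjoin X J f"
      then obtain g r where gr: "v = g + r * f" "g \<in> J" by (auto simp: adjoin_def)
      have "v = hcomp s (g + r * f)"
        using v gr(1) hcomp_homogeneous[OF Deg_homogeneous, of v X s s] by simp
      also have "\<dots> = hcomp s g"
        using False hcomp_homogeneous_mult[OF f(2), of s r] by (simp add: part_add mult.commute)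
      finally have "v \<in> J" using gradedD[OF J(2) gr(2)] by simp
      then show "v \<in> Deg X s \<inter> J" using v by simp
    qed
  qed (auto intro: subsetD[OF adjoin_incl])
  then have "dim_mod J (Deg X s) = dim_mod (adjoin X J f) (Deg X s)" by (rule dim_mod_cong)
  then show ?thesis using False by (simp add: hf_def)
qed

lemma subspace_plus:
  "mp.subspace S \<Longrightarrow> mp.subspace T \<Longrightarrow> mp.subspace {x + y |x y. x \<in> S \<and> y \<in> T}"
  by (rule mp.subspace_sums)

lemma hfa_Suc:
  fixes J :: "'k::field mpoly set"
  assumes X: "finite X" and J: "ideal J (poly_ring X)" "graded J"
  shows "hfa X J (Suc s) = hfa X J s + hf X J (Suc s)"
proof -
  define K where "K = {g + u |g u. g \<in> J \<and> u \<in> Upto X s}"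
  have K: "mp.subspace K"
    unfolding K_def by (rule subspace_plus[OF ideal_subspace[OF J(1)] subspace_Upto])
  have JK: "J \<subseteq> K" using Upto_0 unfolding K_def by force
  have UK: "Upto X s \<subseteq> K" using ideal_0[OF J(1)] unfolding K_def by force
  have "dim_mod J (Upto X (Suc s)) = dim_mod K (Upto X (Suc s)) + dim_mod J (Upto X s)"
  proof (rule dim_mod_exact[where f = "\<lambda>u. u"])
    fix v :: "'k mpoly"
    show "v \<in> K \<longleftrightarrow> (\<exists>u\<in>Upto X s. v - u \<in> J)"
      unfolding K_def by force
  qed (use X J K JK subspace_Upto fin_dim_Upto ideal_subspace mp_linear_mult in
      \<open>auto intro: subsetD[OF Upto_mono[of s "Suc s"]]\<close>)
  moreover have "dim_mod K (Upto X (Suc s)) = dim_mod J (Deg X (Suc s))"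
  proof (rule antisym)
    show "dim_mod K (Upto X (Suc s)) \<le> dim_mod J (Deg X (Suc s))"
    proof (rule dim_mod_inj[where f = "hcomp (Suc s)"])
      show "mp_linear (hcomp (Suc s))" by (rule mp_linearI) (simp_all add: part_add part_const_mult)
      fix u :: "'k mpoly" assume u: "u \<in> Upto X (Suc s)"
      show "\<exists>v\<in>Deg X (Suc s). hcomp (Suc s) u - v \<in> J"
        using hcomp_Deg[OF Upto_carrier[OF u]] ideal_0[OF J(1)]
        by (intro bexI[of _ "hcomp (Suc s) u"]) auto
      assume "hcomp (Suc s) u \<in> J"
      moreover have "u - hcomp (Suc s) u \<in> Upto X s"
        unfolding Upto_def
      proof (intro CollectI conjI ballI)
        show "u - hcomp (Suc s) u \<in> carrier (poly_ring X)" using Upto_carrier[OF u] by auto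
        fix m assume "m \<in> keys (u - hcomp (Suc s) u)"
        then have "m \<in> keys u" "total_deg m \<noteq> Suc s"
          by (auto simp: in_keys_iff lookup_minus lookup_part when_def split: if_splits)
        then show "total_deg m \<le> s" using u by (force simp: Upto_def)
      qed
      ultimately show "u \<in> K"
        unfolding K_def by (intro CollectI exI[of _ "hcomp (Suc s) u"] exI[of _ "u - hcomp (Suc s) u"]) auto
    qed (use X J ideal_subspace subspace_Upto subspace_Deg fin_dim_Upto fin_dim_Deg in auto)
    show "dim_mod J (Deg X (Suc s)) \<le> dim_mod K (Upto X (Suc s))"
    proof (rule dim_mod_mono)
      show "Deg X (Suc s) \<inter> K \<subseteq> J"
      proof
        fix u assume u: "u \<in> Deg X (Suc s) \<inter> K"
        then obtain g w where gw: "u = g + w" "g \<in> J" "w \<in> Upto X s" by (auto simp: K_def)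
        have "u = hcomp (Suc s) u" using u Deg_homogeneous hcomp_homogeneous by fastforce
        also have "\<dots> = hcomp (Suc s) g + hcomp (Suc s) w" by (simp add: gw(1) part_add)
        also have "hcomp (Suc s) w = 0"
          using gw(3) by (intro part_eq_0) (auto simp: Upto_def)
        finally show "u \<in> J" using gradedD[OF J(2) gw(2), of "Suc s"] by simp
      qed
    qed (use X K Deg_Upto subspace_Upto subspace_Deg fin_dim_Upto in auto)
  qed
  ultimately show ?thesis by (simp add: hfa_def hf_def)
qed

lemma hfa_0:
  fixes J :: "'k::field mpoly set"
  shows "hfa X J 0 = hf X J 0"
proof -
  have "Upto X 0 = (Deg X 0 :: 'k mpoly set)" by (auto simp: Upto_def Deg_def homogeneous_def)
  then show ?thesis by (simp add: hfa_def hf_def)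
qed

lemma hfa_sum:
  assumes "finite X" "ideal J (poly_ring X)" "graded J"
  shows "hfa X J s = (\<Sum>i\<le>s. hf X J i)"
  by (induction s) (simp_all add: hfa_0 hfa_Suc[OF assms])

lemma hfa_antimono:
  assumes "finite X" "ideal J (poly_ring X)" "J \<subseteq> J'"
  shows "hfa X J' s \<le> hfa X J s"
  unfolding hfa_def
  by (rule dim_mod_mono) (use assms subspace_Upto fin_dim_Upto ideal_subspace in auto)

lemma hfa_mono:
  assumes "finite X" "ideal J (poly_ring X)" "s \<le> t"
  shows "hfa X J s \<le> hfa X J t"
  unfolding hfa_def
  by (rule dim_mod_mono)
    (use assms subspace_Upto fin_dim_Upto ideal_subspace in
      \<open>auto intro: subsetD[OF Upto_mono[OF assms(3)]]\<close>)

lemma hfa_exact: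
  assumes X: "finite X" and J: "ideal J (poly_ring X)" "graded J"
    and a: "a \<in> carrier (poly_ring X)" "homogeneous e a"
  shows "hfa X J s = hfa X (adjoin X J a) s + (if e \<le> s then hfa X (colon X J a) (s - e) else 0)"
proof (induction s)
  case 0 then show ?case using hf_exact[OF X J a, of 0] by (simp add: hfa_0)
next
  case (Suc s)
  note id1 = ideal_colon[OF J(1), of a] graded_colon[OF J a(2)]
  note id2 = ideal_adjoin[OF J(1) a(1)] graded_adjoin[OF J a(2)]
  consider "e \<le> s" | "e = Suc s" | "e > Suc s" by linarith
  then show ?case
    using Suc hf_exact[OF X J a, of "Suc s"]
    by cases (simp_all add: hfa_Suc[OF X J] hfa_Suc[OF X id1] hfa_Suc[OF X id2] hfa_0 Suc_diff_le)
qed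

lemma hfa_pos:
  assumes "finite X" "ideal J (poly_ring X)" "1 \<notin> J"
  shows "1 \<le> hfa X J s"
proof (rule ccontr)
  assume "\<not> 1 \<le> hfa X J s"
  then have 0: "dim_mod J (Upto X s) = 0" by (simp add: hfa_def)
  obtain B where B: "finite B" "card B = dim_mod J (Upto X s)"
    "\<And>v. v \<in> Upto X s \<Longrightarrow> \<exists>x\<in>mp.span B. v - x \<in> J"
    using dim_mod_basis[OF subspace_Upto fin_dim_Upto[OF assms(1)] ideal_subspace[OF assms(2)]]
    by metis
  then have "B = {}" using 0 by simp
  then show False using B(3)[of 1] assms(3) by auto
qed

lemma hf_0_imp:
  fixes J :: "'k::field mpoly set"
  assumes "finite X" "ideal J (poly_ring X)" "hf X J s = 0"
  shows "Deg X s \<subseteq> J"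
proof
  fix v :: "'k mpoly" assume v: "v \<in> Deg X s"
  obtain B where B: "finite B" "card B = dim_mod J (Deg X s)"
    "\<And>v. v \<in> Deg X s \<Longrightarrow> \<exists>x\<in>mp.span B. v - x \<in> J"
    using dim_mod_basis[OF subspace_Deg fin_dim_Deg[OF assms(1)] ideal_subspace[OF assms(2)]]
    by metis
  then have "B = {}" using assms(3) by (simp add: hf_def)
  then show "v \<in> J" using B(3)[OF v] by auto
qed

text \<open>Multiplication by \<open>f\<close> embeds \<open>R/P\<close> into the kernel of \<open>R/P \<rightarrow> R/Q\<close>.\<close>

lemma hfa_prime_step:
  fixes P Q :: "'k::field mpoly set"
  assumes X: "finite X" and P: "primeideal P (poly_ring X)" and Q: "ideal Q (poly_ring X)"
    and PQ: "P \<subseteq> Q" and f: "f \<in> Upto X e" "f \<in> Q" "f \<notin> P"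
  shows "hfa X Q s + (if e \<le> s then hfa X P (s - e) else 0) \<le> hfa X P s"
proof (cases "e \<le> s")
  case True
  have idP: "ideal P (poly_ring X)" using P by (rule primeideal.axioms(1))
  define K where "K = {g + u |g u. g \<in> P \<and> u \<in> (\<lambda>u. u * f) ` Upto X (s - e)}"
  have K: "mp.subspace K"
    unfolding K_def by (intro subspace_plus ideal_subspace[OF idP] linear_image_subspace
        subspace_Upto mp_linear_mult)
  have fc: "f \<in> carrier (poly_ring X)" using f(1) by (rule Upto_carrier)
  have KQ: "K \<subseteq> Q"
    unfolding K_def using PQ f(2) by (auto intro!: ideal_add[OF Q] ideal_mult[OF Q] Upto_carrier)
  have "dim_mod P (Upto X s) = dim_mod K (Upto X s) + dim_mod P (Upto X (s - e))"
  proof (rule dim_mod_exact[where f = "\<lambda>u. u * f"])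
    show "P \<subseteq> K"
    proof
      fix x assume "x \<in> P"
      then show "x \<in> K"
        unfolding K_def by (intro CollectI exI[of _ x] exI[of _ 0]) (auto intro!: image_eqI[of _ _ 0])
    qed
    show "u * f \<in> P \<longleftrightarrow> u \<in> P" if "u \<in> Upto X (s - e)" for u
      using P f(3) fc Upto_carrier[OF that] ideal_mult'[OF idP fc]
      by (auto simp: primeideal_poly_ring_iff)
    show "u * f \<in> Upto X s" if "u \<in> Upto X (s - e)" for u
      using Upto_mult[OF that f(1)] True by simp
    fix v :: "'k mpoly"
    show "v \<in> K \<longleftrightarrow> (\<exists>u\<in>Upto X (s - e). v - u * f \<in> P)"
      unfolding K_def by force
  qed (use X K subspace_Upto fin_dim_Upto ideal_subspace[OF idP] mp_linear_mult in auto)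
  moreover have "dim_mod Q (Upto X s) \<le> dim_mod K (Upto X s)"
    by (rule dim_mod_mono) (use X K KQ subspace_Upto fin_dim_Upto in auto)
  ultimately show ?thesis using True by (simp add: hfa_def)
next
  case False
  then show ?thesis
    using hfa_antimono[OF X primeideal.axioms(1)[OF P] PQ] by simp
qed

section \<open>Hilbert series and Krull dimension\<close>

subsection \<open>Primes of a quotient ring\<close>

text \<open>Primes of the quotient ring are the images of the primes that contain \<open>J\<close>.\<close>

lemma krull_dim_quotient:
  fixes J :: "'k::field mpoly set"
  assumes J: "ideal J (poly_ring X)"
  shows "krull_dim (poly_ring X Quot J)
    = Sup {enat n |n. \<exists>P. prime_chain (poly_ring X) n P \<and> J \<subseteq> P 0}"
proof -
  let ?R = "poly_ring X :: 'k mpoly ring"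
  let ?q = "\<lambda>f. J +>\<^bsub>?R\<^esub> f"
  interpret R: cring ?R by (rule cring_poly_ring)
  interpret J: ideal J ?R by fact
  interpret Q: cring "?R Quot J" by (rule J.quotient_is_cring[OF R.is_cring])
  interpret h: ring_hom_ring ?R "?R Quot J" ?q by (rule J.rcos_ring_hom_ring)
  have eq: "?q f = ?q g \<longleftrightarrow> f - g \<in> J" if "f \<in> carrier ?R" "g \<in> carrier ?R" for f g
  proof -
    have "\<ominus>\<^bsub>?R\<^esub> g = - g" using that by (intro R.minus_equality) auto
    then show ?thesis
      using R.quotient_eq_iff_same_a_r_cos[OF J that] by (simp add: a_minus_def)
  qed
  have carr: "carrier (?R Quot J) = ?q ` carrier ?R"
    unfolding FactRing_def A_RCOSETS_def' by auto
  have "(\<exists>Q. prime_chain (?R Quot J) n Q) \<longleftrightarrow> (\<exists>P. prime_chain ?R n P \<and> J \<subseteq> P 0)" for n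
  proof
    assume "\<exists>Q. prime_chain (?R Quot J) n Q"
    then obtain Q where prime: "\<And>i. i \<le> n \<Longrightarrow> primeideal (Q i) (?R Quot J)"
      and sub: "\<And>i. i < n \<Longrightarrow> Q i \<subset> Q (Suc i)" by (auto simp: prime_chain_def)
    define P where "P i = {f \<in> carrier ?R. ?q f \<in> Q i}" for i
    have "primeideal (P i) ?R" if "i \<le> n" for i
      unfolding P_def by (rule h.primeideal_vimage[OF R.is_cring prime[OF that]])
    moreover have "P i \<subset> P (Suc i)" if i: "i < n" for i
    proof -
      obtain u where u: "u \<in> Q (Suc i)" "u \<notin> Q i" using sub[OF i] by blast
      have "u \<in> carrier (?R Quot J)"
        using ideal.Icarr[OF primeideal.axioms(1)[OF prime[of "Suc i"]] u(1)] i by simp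
      then obtain f where "f \<in> carrier ?R" "u = ?q f" using carr by auto
      then show ?thesis using u sub[OF i] unfolding P_def by blast
    qed
    moreover have "J \<subseteq> P 0"
    proof
      fix f assume f: "f \<in> J"
      have "?q f = \<zero>\<^bsub>?R Quot J\<^esub>"
        using eq[of f 0] f ideal_carr[OF J f] h.hom_zero by simp
      then show "f \<in> P 0"
        using ideal_carr[OF J f] additive_subgroup.zero_closed[OF ideal.axioms(1)]
          primeideal.axioms(1)[OF prime[of 0]] by (auto simp: P_def)
    qed
    ultimately show "\<exists>P. prime_chain ?R n P \<and> J \<subseteq> P 0" by (auto simp: prime_chain_def)
  next
    assume "\<exists>P. prime_chain ?R n P \<and> J \<subseteq> P 0"
    then obtain P where prime: "\<And>i. i \<le> n \<Longrightarrow> primeideal (P i) ?R"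
      and sub: "\<And>i. i < n \<Longrightarrow> P i \<subset> P (Suc i)" and J0: "J \<subseteq> P 0"
      by (auto simp: prime_chain_def)
    have JP: "J \<subseteq> P i" if "i \<le> n" for i
      using that by (induction i) (use J0 sub in \<open>auto simp: Suc_le_eq\<close>)
    define Q where "Q i = ?q ` P i" for i
    have id: "ideal (P i) ?R" if "i \<le> n" for i using prime[OF that] by (rule primeideal.axioms(1))
    have mem: "?q f \<in> Q i \<longleftrightarrow> f \<in> P i" if i: "i \<le> n" and f: "f \<in> carrier ?R" for i f
    proof
      assume "?q f \<in> Q i"
      then obtain g where g: "g \<in> P i" "?q f = ?q g" by (auto simp: Q_def)
      then have "f - g \<in> P i" using eq[OF f ideal_carr[OF id[OF i] g(1)]] JP[OF i] by auto
      then show "f \<in> P i" using ideal_diff_iff[OF id[OF i]] g(1) by blast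
    qed (auto simp: Q_def)
    have "primeideal (Q i) (?R Quot J)" if i: "i \<le> n" for i
    proof (rule primeidealI)
      show "ideal (Q i) (?R Quot J)"
        unfolding Q_def using id[OF i] by (rule R.ring_ideal_imp_quot_ideal[OF J])
      show "cring (?R Quot J)" by (rule Q.is_cring)
      show "carrier (?R Quot J) \<noteq> Q i"
      proof
        assume "carrier (?R Quot J) = Q i"
        then have "?q 1 \<in> Q i" using carr by blast
        then show False using mem[OF i, of 1] prime[OF i] by (auto simp: primeideal_poly_ring_iff)
      qed
      fix a b assume ab: "a \<in> carrier (?R Quot J)" "b \<in> carrier (?R Quot J)"
        "a \<otimes>\<^bsub>?R Quot J\<^esub> b \<in> Q i"
      then obtain f g where fg: "f \<in> carrier ?R" "g \<in> carrier ?R" "a = ?q f" "b = ?q g"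
        using carr by auto
      then have "?q (f * g) \<in> Q i" using ab(3) h.hom_mult[of f g] by simp
      then have "f * g \<in> P i" using mem[OF i, of "f * g"] fg by auto
      then show "a \<in> Q i \<or> b \<in> Q i"
        using prime[OF i] fg mem[OF i] by (auto simp: primeideal_poly_ring_iff)
    qed
    moreover have "Q i \<subset> Q (Suc i)" if i: "i < n" for i
    proof -
      obtain f where f: "f \<in> P (Suc i)" "f \<notin> P i" using sub[OF i] by blast
      have "f \<in> carrier ?R" using ideal_carr[OF id f(1)] i by simp
      then have "?q f \<in> Q (Suc i)" "?q f \<notin> Q i" using mem f i by auto
      then show ?thesis using sub[OF i] by (auto simp: Q_def)
    qed
    ultimately have "prime_chain (?R Quot J) n Q" by (simp add: prime_chain_def)
    then show "\<exists>Q. prime_chain (?R Quot J) n Q" by blast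
  qed
  then show ?thesis unfolding krull_dim_def by simp
qed

subsection \<open>Growth\<close>

lemma power_le_imp_exponent_le:
  fixes c K :: real
  assumes "c > 0" and le: "\<And>s::nat. c * (real s + 1) ^ a \<le> K * (real s + 1) ^ b"
  shows "a \<le> b"
proof (rule ccontr)
  assume "\<not> a \<le> b"
  then obtain e where e: "a = b + Suc e" using less_imp_Suc_add[of b a] by auto
  obtain s :: nat where s: "real s > K / c" using reals_Archimedean2 by blast
  have "(real s + 1) ^ b * (c * (real s + 1) ^ Suc e) \<le> (real s + 1) ^ b * K"
    using le[of s] by (simp add: e power_add algebra_simps)
  then have "c * (real s + 1) ^ Suc e \<le> K" by (rule mult_left_le_imp_le) simp
  moreover have "real s + 1 \<le> (real s + 1) ^ Suc e"
    using self_le_power[of "real s + 1" "Suc e"] by simp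
  then have "c * (real s + 1) \<le> c * (real s + 1) ^ Suc e"
    using assms(1) by (intro mult_left_mono) auto
  ultimately have "c * (real s + 1) \<le> K" by linarith
  moreover have "K < c * real s" using s assms(1) by (simp add: field_simps)
  ultimately show False using assms(1) by (simp add: algebra_simps)
qed

lemma power_diff_le:
  fixes x e :: real
  assumes "0 \<le> e" "e \<le> x"
  shows "x ^ Suc k - (x - e) ^ Suc k \<le> real (Suc k) * e * x ^ k"
proof (induction k)
  case (Suc k)
  have "x ^ Suc (Suc k) - (x - e) ^ Suc (Suc k)
      = x * (x ^ Suc k - (x - e) ^ Suc k) + e * (x - e) ^ Suc k"
    by (simp add: algebra_simps)
  also have "\<dots> \<le> x * (real (Suc k) * e * x ^ k) + e * x ^ Suc k"
    using assms Suc.IH by (intro add_mono mult_left_mono power_mono) auto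
  finally show ?case by (simp add: algebra_simps)
qed simp

text \<open>The hypothesis bounds \<open>a s\<close> below by the sum of \<open>b\<close> over \<open>s, s - e, s - 2 e, \<dots>\<close>; the constant
  is such that the induction over \<open>s\<close> goes through.\<close>

lemma growth_step:
  fixes a b :: "nat \<Rightarrow> real" and c :: real
  assumes c: "c > 0" and e: "e \<ge> 1"
    and ab: "\<And>s. b s + (if e \<le> s then a (s - e) else 0) \<le> a s"
    and b: "\<And>s. c * (real s + 1) ^ k \<le> b s"
  shows "c / (real (Suc k) * real e) * (real s + 1) ^ Suc k \<le> a s"
proof (induction s rule: less_induct)
  case (less s)
  define c' where "c' = c / (real (Suc k) * real e)"
  have c': "c' * (real (Suc k) * real e) = c" "c' > 0" using c e by (simp_all add: c'_def)
  show ?case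
  proof (cases "e \<le> s")
    case True
    have "c' * (real s + 1) ^ Suc k - c' * (real s + 1 - real e) ^ Suc k
        \<le> c' * (real (Suc k) * real e * (real s + 1) ^ k)"
      unfolding right_diff_distrib[symmetric]
      using c' True by (intro mult_left_mono power_diff_le) auto
    also have "\<dots> = c * (real s + 1) ^ k" using c'(1) by (metis mult.assoc)
    also have "\<dots> \<le> b s" by (rule b)
    finally have "c' * (real s + 1) ^ Suc k \<le> b s + c' * (real s + 1 - real e) ^ Suc k" by simp
    also have "c' * (real s + 1 - real e) ^ Suc k = c' * (real (s - e) + 1) ^ Suc k"
      using True by (simp add: algebra_simps of_nat_diff)
    also have "\<dots> \<le> a (s - e)"
      using less[of "s - e"] True e by (simp add: c'_def)
    finally show ?thesis using ab[of s] True unfolding c'_def by simp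
  next
    case False
    then have "(real s + 1) ^ Suc k \<le> real e * (real s + 1) ^ k"
      unfolding power_Suc by (intro mult_right_mono) auto
    also have "\<dots> \<le> real (Suc k) * real e * (real s + 1) ^ k"
      by (simp add: algebra_simps)
    finally have "c' * (real s + 1) ^ Suc k \<le> c' * (real (Suc k) * real e * (real s + 1) ^ k)"
      using c' by (intro mult_left_mono) auto
    also have "\<dots> = c * (real s + 1) ^ k" using c'(1) by (metis mult.assoc)
    finally show ?thesis using b[of s] ab[of s] False unfolding c'_def by simp
  qed
qed

definition growth_le :: "nat set \<Rightarrow> 'k::field mpoly set \<Rightarrow> nat \<Rightarrow> bool" where
  "growth_le X J d \<longleftrightarrow> (\<exists>K. \<forall>s. real (hfa X J s) \<le> K * (real s + 1) ^ d)"

definition growth_ge :: "nat set \<Rightarrow> 'k::field mpoly set \<Rightarrow> nat \<Rightarrow> bool" where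
  "growth_ge X J d \<longleftrightarrow> (\<exists>c>0. \<forall>s. c * (real s + 1) ^ d \<le> real (hfa X J s))"

lemma growth_ge_le: "growth_ge X J a \<Longrightarrow> growth_le X J b \<Longrightarrow> a \<le> b"
  unfolding growth_ge_def growth_le_def by (meson order_trans power_le_imp_exponent_le)

lemma growth_le_antimono:
  assumes "finite X" "ideal J (poly_ring X)" "J \<subseteq> J'" "growth_le X J d"
  shows "growth_le X J' d"
  using assms(4) hfa_antimono[OF assms(1-3)] unfolding growth_le_def
  by (meson of_nat_le_iff order_trans)

lemma power_mono_exponent: "a \<le> b \<Longrightarrow> (real s + 1) ^ a \<le> (real s + 1) ^ b"
  by (rule power_increasing) auto

lemma growth_le_mono:
  assumes "growth_le X J a" "a \<le> b"
  shows "growth_le X J b"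
proof -
  obtain K where K: "\<And>s. real (hfa X J s) \<le> K * (real s + 1) ^ a"
    using assms(1) by (auto simp: growth_le_def)
  have "real (hfa X J s) \<le> \<bar>K\<bar> * (real s + 1) ^ b" for s
  proof -
    have "K * (real s + 1) ^ a \<le> \<bar>K\<bar> * (real s + 1) ^ b"
      by (intro mult_mono power_mono_exponent assms(2)) auto
    then show ?thesis using K[of s] by linarith
  qed
  then show ?thesis by (auto simp: growth_le_def)
qed

lemma growth_le_split:
  assumes X: "finite X" and J: "ideal J (poly_ring X)" "graded J"
    and a: "a \<in> carrier (poly_ring X)" "homogeneous e a"
    and d: "growth_le X (adjoin X J a) d" "growth_le X (colon X J a) d"
  shows "growth_le X J d"
proof -
  obtain K1 where K1: "\<And>s. real (hfa X (adjoin X J a) s) \<le> K1 * (real s + 1) ^ d"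
    using d by (auto simp: growth_le_def)
  obtain K2 where K2: "\<And>s. real (hfa X (colon X J a) s) \<le> K2 * (real s + 1) ^ d"
    using d by (auto simp: growth_le_def)
  have "real (hfa X J s) \<le> (K1 + K2) * (real s + 1) ^ d" for s
  proof -
    have "hfa X J s \<le> hfa X (adjoin X J a) s + hfa X (colon X J a) s"
      using hfa_exact[OF X J a, of s] hfa_mono[OF X ideal_colon[OF J(1)], of "s - e" s a] by auto
    then have "real (hfa X J s) \<le> real (hfa X (adjoin X J a) s) + real (hfa X (colon X J a) s)"
      by linarith
    then show ?thesis using K1[of s] K2[of s] by (simp add: algebra_simps)
  qed
  then show ?thesis unfolding growth_le_def by blast
qed

subsection \<open>The upper bound for the Krull dimension\<close>

text \<open>Each step \<open>P \<subset> Q\<close> in a chain of primes raises the order of growth by at least one, because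
  multiplication by an element of \<open>Q - P\<close> embeds \<open>R/P\<close> into the kernel of \<open>R/P \<rightarrow> R/Q\<close>.\<close>

lemma growth_chain:
  fixes P :: "nat \<Rightarrow> 'k::field mpoly set"
  assumes X: "finite X" and P: "prime_chain (poly_ring X) n P" and k: "k \<le> n"
  shows "growth_ge X (P (n - k)) k"
  using k
proof (induction k)
  case 0
  have "primeideal (P n) (poly_ring X)" using P by (auto simp: prime_chain_def)
  then have "1 \<le> hfa X (P n) s" for s
    by (intro hfa_pos[OF X]) (auto simp: primeideal_poly_ring_iff)
  then show ?case unfolding growth_ge_def by (intro exI[of _ 1]) (auto simp: Suc_le_eq)
next
  case (Suc k)
  define i where "i = n - Suc k"
  have i: "i < n" "n - k = Suc i" using Suc.prems by (auto simp: i_def)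
  have pr: "primeideal (P i) (poly_ring X)" "primeideal (P (Suc i)) (poly_ring X)"
    and sub: "P i \<subset> P (Suc i)" using P i by (auto simp: prime_chain_def)
  obtain f where f: "f \<in> P (Suc i)" "f \<notin> P i" using sub by blast
  have id: "ideal (P (Suc i)) (poly_ring X)" using pr(2) by (rule primeideal.axioms(1))
  obtain e0 where "f \<in> Upto X e0" using Upto_exists[OF ideal_carr[OF id f(1)]] by blast
  then have fe: "f \<in> Upto X (Suc e0)" using Upto_mono[of e0 "Suc e0" X] by auto
  obtain c where c: "c > 0" "\<And>s. c * (real s + 1) ^ k \<le> real (hfa X (P (Suc i)) s)"
    using Suc i by (auto simp: growth_ge_def)
  have step: "hfa X (P (Suc i)) s + (if Suc e0 \<le> s then hfa X (P i) (s - Suc e0) else 0)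
      \<le> hfa X (P i) s" for s
    using hfa_prime_step[OF X pr(1) id _ fe f] sub by blast
  have "c / (real (Suc k) * real (Suc e0)) * (real s + 1) ^ Suc k \<le> real (hfa X (P i) s)" for s
  proof (rule growth_step[where b = "\<lambda>s. real (hfa X (P (Suc i)) s)" and a = "\<lambda>s. real (hfa X (P i) s)"])
    fix s
    show "real (hfa X (P (Suc i)) s) + (if Suc e0 \<le> s then real (hfa X (P i) (s - Suc e0)) else 0)
      \<le> real (hfa X (P i) s)"
      using step[of s] by (auto split: if_splits)
  qed (use c in auto)
  moreover have "c / (real (Suc k) * real (Suc e0)) > 0" using c by simp
  ultimately show ?case unfolding growth_ge_def i_def[symmetric] by blast
qed

lemma chain_length_le_growth:
  assumes X: "finite X" and J: "ideal J (poly_ring X)" and P: "prime_chain (poly_ring X) n P"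
    and JP: "J \<subseteq> P 0" and d: "growth_le X J d"
  shows "n \<le> d"
proof -
  have "growth_ge X (P 0) n" using growth_chain[OF X P order_refl] by simp
  moreover have "growth_le X (P 0) d" by (rule growth_le_antimono[OF X J JP d])
  ultimately show ?thesis by (rule growth_ge_le)
qed

subsection \<open>Hilbert series\<close>

definition hs :: "nat set \<Rightarrow> 'k::field mpoly set \<Rightarrow> int fps" where
  "hs X J = Abs_fps (\<lambda>i. int (hf X J i))"

lemma hilbert_series_eq: "finite X \<Longrightarrow> ideal I (poly_ring X) \<Longrightarrow> hilbert_series X I = hs X I"
  by (simp add: hilbert_series_def hs_def hilbert_function_eq)

lemma hs_exact:
  assumes "finite X" "ideal J (poly_ring X)" "graded J" "f \<in> carrier (poly_ring X)" "homogeneous e f"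
  shows "hs X J = hs X (adjoin X J f) + fps_X ^ e * hs X (colon X J f)"
  by (rule fps_ext)
    (auto simp: hs_def fps_X_power_mult_nth hf_exact[OF assms])

text \<open>The order of growth of \<open>R/J\<close> and the order of the pole of its Hilbert series agree; they are
  kept together because all three properties are established by the same induction.\<close>

definition has_dim :: "nat set \<Rightarrow> 'k::field mpoly set \<Rightarrow> nat \<Rightarrow> bool" where
  "has_dim X J d \<longleftrightarrow> growth_le X J d \<and> growth_ge X J d \<and>
    (\<exists>h. hs X J * (1 - fps_X) ^ d = fps_of_poly h \<and> 0 < poly h 1)"

lemma fps_of_poly_1_minus_X: "fps_of_poly [:1, -1:] = (1 - fps_X :: int fps)"
  by (simp add: fps_of_poly_pCons)

lemma prime_chain_Cons:
  assumes "prime_chain A n P" "primeideal Q A" "Q \<subset> P 0"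
  shows "prime_chain A (Suc n) (\<lambda>i. if i = 0 then Q else P (i - 1))"
  unfolding prime_chain_def
proof (intro conjI allI impI)
  fix i
  show "primeideal (if i = 0 then Q else P (i - 1)) A" if "i \<le> Suc n"
    using assms that by (cases i) (auto simp: prime_chain_def)
  show "(if i = 0 then Q else P (i - 1)) \<subset> (if Suc i = 0 then Q else P (Suc i - 1))" if "i < Suc n"
    using assms that by (cases i) (simp_all add: prime_chain_def)
qed

lemma const_in_span: "const c \<in> mp.span {1}"
  using mp.span_scale[OF mp.span_base[of 1 "{1}"], of c] by simp

lemma has_dim_maximal:
  fixes J :: "'k::field mpoly set"
  assumes X: "finite X" and J: "ideal J (poly_ring X)" "1 \<notin> J"
    and vars: "\<And>x. x \<in> X \<Longrightarrow> var x \<in> J"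
  shows "has_dim X J 0"
proof -
  have deg_pos: "Deg X s \<subseteq> J" if s: "s > 0" for s
  proof
    fix f :: "'k mpoly" assume f: "f \<in> Deg X s"
    have "single m c \<in> J" if m: "m \<in> keys f" for m and c :: 'k
    proof -
      have mX: "m \<in> monoms X" and "total_deg m = s"
        using f m by (auto simp: Deg_def in_poly_ring homogeneous_def)
      then have "m \<noteq> 0" using s by auto
      then obtain j where j: "j \<in> keys m" by (metis keys_eq_empty ex_in_conv)
      then have "m = single j 1 + (m - single j 1)"
        by (intro poly_mapping_eqI) (auto simp: lookup_add lookup_minus lookup_single when_def in_keys_iff)
      then have eq: "single m c = single (m - single j 1) c * var j"
        unfolding var_def mult_single by (simp add: add.commute)
      have "m - single j 1 \<in> monoms X"
        using mX by (auto simp: monoms_def in_keys_iff lookup_minus)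
      then show ?thesis
        unfolding eq using vars[of j] mX j by (intro ideal_mult[OF J(1)]) (auto simp: monoms_def)
    qed
    then have "(\<Sum>m\<in>keys f. single m (lookup f m)) \<in> J" by (intro ideal_sum[OF J(1)])
    then show "f \<in> J" using poly_mapping_sum_single[of f] by simp
  qed
  then have hf_pos: "hf X J s = 0" if "s > 0" for s
    using deg_pos[OF that] by (simp add: hf_def dim_mod_def Int_absorb2)
  have "hf X J 0 \<le> 1"
  proof -
    have "dim_mod J (Deg X 0) \<le> card {1 :: 'k mpoly}"
    proof (rule dim_mod_le_card[OF subspace_Deg fin_dim_Deg[OF X] ideal_subspace[OF J(1)]])
      fix v :: "'k mpoly" assume "v \<in> Deg X 0"
      then have "v = const (lookup v 0)" by (intro homogeneous_0_const Deg_homogeneous)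
      moreover have "const (lookup v 0) \<in> mp.span {1}" by (rule const_in_span)
      ultimately have "v \<in> mp.span {1}" by metis
      then show "\<exists>x\<in>mp.span {1}. v - x \<in> J" using ideal_0[OF J(1)] by force
    qed simp
    then show ?thesis by (simp add: hf_def)
  qed
  moreover have "1 \<le> hf X J 0" using hfa_pos[OF X J] by (simp flip: hfa_0)
  ultimately have hf0: "hf X J 0 = 1" by simp
  have hfa_le: "hfa X J s \<le> 1" for s
  proof -
    have "dim_mod J (Upto X s) \<le> card {1 :: 'k mpoly}"
    proof (rule dim_mod_le_card[OF subspace_Upto fin_dim_Upto[OF X] ideal_subspace[OF J(1)]])
      fix v :: "'k mpoly" assume v: "v \<in> Upto X s"
      have "hcomp 0 v = const (lookup (hcomp 0 v) 0)" by (intro homogeneous_0_const) auto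
      moreover have "const (lookup (hcomp 0 v) 0) \<in> mp.span {1}" by (rule const_in_span)
      ultimately have 1: "hcomp 0 v \<in> mp.span {1}" by metis
      have "(\<Sum>i\<in>{..s} - {0}. hcomp i v) \<in> J"
      proof (rule ideal_sum[OF J(1)])
        fix i assume "i \<in> {..s} - {0}"
        then show "hcomp i v \<in> J"
          using deg_pos[of i] hcomp_Deg[OF Upto_carrier[OF v], of i] by auto
      qed
      moreover have "v = hcomp 0 v + (\<Sum>i\<in>{..s} - {0}. hcomp i v)"
        using Upto_sum_hcomp[OF v] by (simp add: sum.remove[of "{..s}" 0])
      ultimately have "v - hcomp 0 v \<in> J" by (metis add_diff_cancel_left')
      then show "\<exists>x\<in>mp.span {1}. v - x \<in> J" using 1 by blast
    qed simp
    then show ?thesis by (simp add: hfa_def)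
  qed
  have "hs X J = 1"
    by (rule fps_ext) (use hf0 hf_pos in \<open>auto simp: hs_def\<close>)
  then have "hs X J * (1 - fps_X) ^ 0 = fps_of_poly 1 \<and> 0 < poly (1 :: int poly) 1" by simp
  moreover have "growth_le X J 0"
    unfolding growth_le_def by (intro exI[of _ 1]) (use hfa_le in auto)
  moreover have "growth_ge X J 0"
    unfolding growth_ge_def by (intro exI[of _ 1]) (use hfa_pos[OF X J] in \<open>auto simp: Suc_le_eq\<close>)
  ultimately show ?thesis unfolding has_dim_def by blast
qed

lemma colon_prime:
  assumes "primeideal J (poly_ring X)" "f \<in> carrier (poly_ring X)" "f \<notin> J"
  shows "colon X J f = J"
proof -
  have "ideal J (poly_ring X)" using assms(1) by (rule primeideal.axioms(1))
  then have "J \<subseteq> colon X J f" using assms(2) by (rule colon_incl)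
  moreover have "colon X J f \<subseteq> J"
    using assms by (auto simp: colon_def primeideal_poly_ring_iff)
  ultimately show ?thesis by blast
qed

text \<open>Since \<open>x\<close> is regular on \<open>R/J\<close>, the Hilbert series of \<open>R/J\<close> multiplied by \<open>1 - t\<close> is that of
  \<open>R/(J + (x))\<close>: the Hilbert function is summed and the growth is raised by one.\<close>

lemma has_dim_prime:
  assumes X: "finite X" and J: "primeideal J (poly_ring X)" "graded J"
    and x: "x \<in> X" "var x \<notin> J" and d: "has_dim X (adjoin X J (var x)) d"
  shows "has_dim X J (Suc d)"
proof -
  let ?J' = "adjoin X J (var x)"
  have idJ: "ideal J (poly_ring X)" using J(1) by (rule primeideal.axioms(1))
  have vx: "var x \<in> carrier (poly_ring X)" using x by auto
  have colon: "colon X J (var x) = J" by (rule colon_prime[OF J(1) vx x(2)])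
  have idJ': "ideal ?J' (poly_ring X)" and grJ': "graded ?J'"
    using ideal_adjoin[OF idJ vx] graded_adjoin[OF idJ J(2) homogeneous_var] by auto
  have step: "hf X J s = hf X ?J' s + (if 1 \<le> s then hf X J (s - 1) else 0)" for s
    using hf_exact[OF X idJ J(2) vx homogeneous_var] colon by simp
  have hf: "hf X J s = hfa X ?J' s" for s
  proof (induction s)
    case 0 then show ?case using step[of 0] by (simp add: hfa_0)
  next
    case (Suc s) then show ?case using step[of "Suc s"] by (simp add: hfa_Suc[OF X idJ' grJ'])
  qed
  obtain c K h where c: "c > 0" "\<And>s. c * (real s + 1) ^ d \<le> real (hfa X ?J' s)"
    and K: "\<And>s. real (hfa X ?J' s) \<le> K * (real s + 1) ^ d"
    and h: "hs X ?J' * (1 - fps_X) ^ d = fps_of_poly h" "0 < poly h 1"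
    using d unfolding has_dim_def growth_le_def growth_ge_def by blast
  have "growth_le X J (Suc d)"
    unfolding growth_le_def
  proof (intro exI allI)
    fix s
    have "real (hfa X J s) = (\<Sum>i\<le>s. real (hfa X ?J' i))"
      by (simp add: hfa_sum[OF X idJ J(2)] hf)
    also have "\<dots> \<le> (\<Sum>i\<le>s. real (hfa X ?J' s))"
      using hfa_mono[OF X idJ'] by (intro sum_mono) auto
    also have "\<dots> = (real s + 1) * real (hfa X ?J' s)" by simp
    also have "\<dots> \<le> (real s + 1) * (K * (real s + 1) ^ d)"
      by (intro mult_left_mono K) simp
    finally show "real (hfa X J s) \<le> K * (real s + 1) ^ Suc d" by (simp add: algebra_simps)
  qed
  moreover have "growth_ge X J (Suc d)"
  proof -
    have "c / (real (Suc d) * real 1) * (real s + 1) ^ Suc d \<le> real (hfa X J s)" for s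
    proof (rule growth_step[where b = "\<lambda>s. real (hfa X ?J' s)" and a = "\<lambda>s. real (hfa X J s)"])
      fix s
      have "var x \<in> Upto X 1"
        using vx Deg_Upto[of X 1] homogeneous_var[of x] unfolding Deg_def by blast
      then have "hfa X ?J' s + (if 1 \<le> s then hfa X J (s - 1) else 0) \<le> hfa X J s"
        by (rule hfa_prime_step[OF X J(1) idJ' adjoin_incl]) (use adjoin_mem[OF idJ] x in auto)
      then show "real (hfa X ?J' s) + (if 1 \<le> s then real (hfa X J (s - 1)) else 0) \<le> real (hfa X J s)"
        by (auto split: if_splits)
    qed (use c in auto)
    moreover have "c / (real (Suc d) * real 1) > 0" using c by simp
    ultimately show ?thesis unfolding growth_ge_def by blast
  qed
  moreover have "hs X J * (1 - fps_X) ^ Suc d = fps_of_poly h"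
  proof -
    have "hs X J = hs X ?J' + fps_X ^ 1 * hs X J"
      using hs_exact[OF X idJ J(2) vx homogeneous_var] colon by simp
    then have "hs X J * (1 - fps_X) = hs X ?J'" by (simp add: algebra_simps)
    then show ?thesis using h(1) by (simp add: mult.assoc[symmetric])
  qed
  ultimately show ?thesis using h(2) unfolding has_dim_def by blast
qed

text \<open>The Hilbert series of the two larger ideals add up, with a shift by \<open>e\<close>. Positivity of the
  numerators at \<open>1\<close> excludes cancellation of the pole of higher order.\<close>

lemma has_dim_split:
  assumes X: "finite X" and J: "ideal J (poly_ring X)" "graded J" "1 \<notin> J"
    and a: "a \<in> carrier (poly_ring X)" "homogeneous e a"
    and d1: "has_dim X (colon X J a) d1" and d2: "has_dim X (adjoin X J a) d2"
  shows "has_dim X J (max d1 d2)"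
proof -
  let ?J1 = "colon X J a" and ?J2 = "adjoin X J a" and ?D = "max d1 d2"
  note hfa = hfa_exact[OF X J(1,2) a]
  obtain c1 h1 where c1: "c1 > 0" "\<And>s. c1 * (real s + 1) ^ d1 \<le> real (hfa X ?J1 s)"
    and h1: "hs X ?J1 * (1 - fps_X) ^ d1 = fps_of_poly h1" "0 < poly h1 1"
    using d1 unfolding has_dim_def growth_le_def growth_ge_def by blast
  obtain c2 h2 where c2: "c2 > 0" "\<And>s. c2 * (real s + 1) ^ d2 \<le> real (hfa X ?J2 s)"
    and h2: "hs X ?J2 * (1 - fps_X) ^ d2 = fps_of_poly h2" "0 < poly h2 1"
    using d2 unfolding has_dim_def growth_le_def growth_ge_def by blast
  have "growth_le X J ?D"
  proof (rule growth_le_split[OF X J(1,2) a])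
    show "growth_le X ?J2 ?D" using d2 growth_le_mono[of X ?J2 d2 ?D] by (simp add: has_dim_def)
    show "growth_le X ?J1 ?D" using d1 growth_le_mono[of X ?J1 d1 ?D] by (simp add: has_dim_def)
  qed
  moreover have "growth_ge X J ?D"
  proof (cases "d1 \<le> d2")
    case True
    have "c2 * (real s + 1) ^ ?D \<le> real (hfa X J s)" for s
      using c2(2)[of s] hfa[of s] True by (simp add: max_def split: if_splits)
    then show ?thesis unfolding growth_ge_def using c2(1) by blast
  next
    case False
    then have D: "?D = d1" by simp
    \<comment> \<open>Below degree \<open>e\<close> only the constants of \<open>R/J\<close> are available, hence the minimum with \<open>1\<close>.\<close>
    define c where "c = min c1 1 / (real e + 1) ^ d1"
    have "c * (real s + 1) ^ d1 \<le> real (hfa X J s)" for s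
    proof (cases "e \<le> s")
      case True
      have "real s + 1 \<le> (real e + 1) * (real (s - e) + 1)"
      proof -
        obtain t where "s = e + t" using True le_Suc_ex by blast
        then show ?thesis by (simp add: algebra_simps)
      qed
      then have "(real s + 1) ^ d1 \<le> (real e + 1) ^ d1 * (real (s - e) + 1) ^ d1"
        by (subst power_mult_distrib[symmetric], intro power_mono) auto
      then have "c * (real s + 1) ^ d1 \<le> c * ((real e + 1) ^ d1 * (real (s - e) + 1) ^ d1)"
        using c1(1) by (intro mult_left_mono) (auto simp: c_def)
      also have "\<dots> = min c1 1 * (real (s - e) + 1) ^ d1" by (simp add: c_def)
      also have "\<dots> \<le> c1 * (real (s - e) + 1) ^ d1" by (intro mult_right_mono) auto
      also have "\<dots> \<le> real (hfa X ?J1 (s - e))" by (rule c1(2))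
      finally show ?thesis using hfa[of s] True by simp
    next
      case False
      then have "(real s + 1) ^ d1 \<le> (real e + 1) ^ d1" by (intro power_mono) auto
      then have "c * (real s + 1) ^ d1 \<le> c * (real e + 1) ^ d1"
        using c1(1) by (intro mult_left_mono) (auto simp: c_def)
      also have "\<dots> = min c1 1" by (simp add: c_def)
      also have "\<dots> \<le> 1" by simp
      also have "\<dots> \<le> real (hfa X J s)" using hfa_pos[OF X J(1,3), of s] by simp
      finally show ?thesis .
    qed
    moreover have "c > 0" using c1(1) by (simp add: c_def)
    ultimately show ?thesis unfolding growth_ge_def D by blast
  qed
  moreover have "\<exists>h. hs X J * (1 - fps_X) ^ ?D = fps_of_poly h \<and> 0 < poly h 1"
  proof -
    define h where "h = [:0, 1:] ^ e * [:1, -1:] ^ (?D - d1) * h1 + [:1, -1:] ^ (?D - d2) * h2"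
    have pow: "(1 - fps_X :: int fps) ^ ?D = (1 - fps_X) ^ (?D - i) * (1 - fps_X) ^ i" if "i \<le> ?D" for i
      using that by (simp flip: power_add)
    have X: "fps_of_poly [:0, 1:] = (fps_X :: int fps)" by (simp add: fps_of_poly_pCons)
    have "hs X J * (1 - fps_X) ^ ?D = fps_X ^ e * (hs X ?J1 * (1 - fps_X) ^ ?D) + hs X ?J2 * (1 - fps_X) ^ ?D"
      unfolding hs_exact[OF assms(1) J(1,2) a] by (simp add: algebra_simps)
    also have "hs X ?J1 * (1 - fps_X) ^ ?D = (1 - fps_X) ^ (?D - d1) * fps_of_poly h1"
      using pow[of d1] by (simp flip: h1(1))
    also have "hs X ?J2 * (1 - fps_X) ^ ?D = (1 - fps_X) ^ (?D - d2) * fps_of_poly h2"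
      using pow[of d2] by (simp flip: h2(1))
    finally have "hs X J * (1 - fps_X) ^ ?D = fps_of_poly h"
      by (simp only: h_def fps_of_poly_add fps_of_poly_mult fps_of_poly_power X fps_of_poly_1_minus_X mult.assoc)
    moreover have "0 < poly h 1"
      using h1(2) h2(2) by (cases "d1 \<le> d2"; cases "d1 = d2") (auto simp: h_def max_def power_0_left)
    ultimately show ?thesis by blast
  qed
  ultimately show ?thesis unfolding has_dim_def by blast
qed

lemma adjoin_var_proper:
  assumes J: "ideal J (poly_ring X)" "graded J" "1 \<notin> J" and f: "homogeneous e f" "e > 0"
  shows "1 \<notin> adjoin X J f"
proof
  assume "1 \<in> adjoin X J f"
  then obtain g r where gr: "1 = g + r * f" "g \<in> J" by (auto simp: adjoin_def)
  have "1 = hcomp 0 (g + r * f)" using hcomp_homogeneous[OF homogeneous_1, of 0] gr(1) by simp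
  also have "\<dots> = hcomp 0 g"
    using hcomp_homogeneous_mult[OF f(1), of 0 r] f(2) by (simp add: part_add mult.commute)
  finally show False using gradedD[OF J(2) gr(2), of 0] J(3) by simp
qed

lemma not_graded_primeE:
  fixes J :: "'k::field mpoly set"
  assumes J: "ideal J (poly_ring X)" "graded J" "1 \<notin> J" and "\<not> primeideal J (poly_ring X)"
  obtains a b d where "a \<in> carrier (poly_ring X)" "homogeneous d a"
    "a \<notin> J" "J \<subset> colon X J a" "J \<subset> adjoin X J a" "1 \<notin> colon X J a" "1 \<notin> adjoin X J a"
proof -
  obtain a b d e where ab: "a \<in> carrier (poly_ring X)" "b \<in> carrier (poly_ring X)"
    "homogeneous d a" "homogeneous e b" "a * b \<in> J" "a \<notin> J" "b \<notin> J"
    using graded_primeI[OF J] assms(4) by blast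
  have "b \<in> colon X J a" using ab by (simp add: colon_def mult.commute)
  moreover have "J \<subseteq> colon X J a" by (rule colon_incl[OF J(1) ab(1)])
  ultimately have 1: "J \<subset> colon X J a" using ab(7) by blast
  have 2: "J \<subset> adjoin X J a" using adjoin_mem[OF J(1)] adjoin_incl ab(6) by blast
  have 3: "1 \<notin> colon X J a" using ab(6) by (simp add: colon_def)
  have "1 \<notin> adjoin X J a"
  proof
    assume "1 \<in> adjoin X J a"
    then obtain g r where gr: "1 = g + r * a" "g \<in> J" "r \<in> carrier (poly_ring X)"
      by (auto simp: adjoin_def)
    have "b * g + r * (a * b) = b * (g + r * a)" by (simp add: algebra_simps)
    also have "\<dots> = b" by (simp flip: gr(1))
    finally have "b * g + r * (a * b) = b" .
    moreover have "b * g + r * (a * b) \<in> J"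
      by (rule ideal_add[OF J(1)]) (use gr ab in \<open>auto intro: ideal_mult[OF J(1)]\<close>)
    ultimately show False using ab(7) by simp
  qed
  then show ?thesis using that[OF ab(1,3,6) 1 2 3] by blast
qed

context monomial_ordered
begin

text \<open>Noetherian induction. A homogeneous prime is either the ideal of all variables or misses a
  variable \<open>x\<close> and is compared with \<open>J + (x)\<close>. If \<open>J\<close> is not prime, then \<open>a b \<in> J\<close> for forms
  \<open>a, b \<notin> J\<close>, and both \<open>J : a\<close> and \<open>J + (a)\<close> are larger. A chain of primes of the right length is
  carried along.\<close>

lemma has_dim_exists:
  fixes J :: "'k::field mpoly set"
  assumes "ideal J (poly_ring X)" "graded J" "1 \<notin> J"
  shows "\<exists>d P. has_dim X J d \<and> prime_chain (poly_ring X) d P \<and> J \<subseteq> P 0"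
  using assms
proof (induction J rule: noetherian_induct)
  case (step J)
  show ?case
  proof (cases "primeideal J (poly_ring X)")
    case prime: True
    show ?thesis
    proof (cases "\<forall>x\<in>X. var x \<in> J")
      case True
      then have "has_dim X J 0" using has_dim_maximal[OF fin step(1)] step by blast
      moreover have "prime_chain (poly_ring X) 0 (\<lambda>_. J)" using prime by (simp add: prime_chain_def)
      ultimately show ?thesis by blast
    next
      case False
      then obtain x where x: "x \<in> X" "var x \<notin> J" by blast
      let ?J' = "adjoin X J (var x)"
      have vx: "var x \<in> carrier (poly_ring X)" using x by auto
      have sub: "J \<subset> ?J'" using adjoin_incl[of J X] adjoin_mem[OF step(1)] x by blast
      have id: "ideal ?J' (poly_ring X)" by (rule ideal_adjoin[OF step(1) vx])
      have gr: "graded ?J'" by (rule graded_adjoin[OF step(1) step(3) homogeneous_var])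
      have "1 \<notin> ?J'" by (rule adjoin_var_proper[OF step(1,3,4) homogeneous_var]) simp
      then obtain d P where dP: "has_dim X ?J' d" "prime_chain (poly_ring X) d P" "?J' \<subseteq> P 0"
        using step(2)[OF id sub gr] by blast
      have "has_dim X J (Suc d)" by (rule has_dim_prime[OF fin prime step(3) x dP(1)])
      moreover have "J \<subset> P 0" using sub dP(3) by blast
      then have "prime_chain (poly_ring X) (Suc d) (\<lambda>i. if i = 0 then J else P (i - 1))"
        by (rule prime_chain_Cons[OF dP(2) prime])
      ultimately show ?thesis by (intro exI[of _ "Suc d"] exI[of _ "\<lambda>i. if i = 0 then J else P (i - 1)"]) simp
    qed
  next
    case False
    then obtain a e where a: "a \<in> carrier (poly_ring X)" "homogeneous e a"
      and sub: "J \<subset> colon X J a" "J \<subset> adjoin X J a" and ne: "1 \<notin> colon X J a" "1 \<notin> adjoin X J a"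
      using not_graded_primeE[OF step(1,3,4)] by metis
    obtain d1 P1 where 1: "has_dim X (colon X J a) d1" "prime_chain (poly_ring X) d1 P1" "colon X J a \<subseteq> P1 0"
      using step(2)[OF ideal_colon[OF step(1)] sub(1) graded_colon[OF step(1,3) a(2)] ne(1)] by blast
    obtain d2 P2 where 2: "has_dim X (adjoin X J a) d2" "prime_chain (poly_ring X) d2 P2" "adjoin X J a \<subseteq> P2 0"
      using step(2)[OF ideal_adjoin[OF step(1) a(1)] sub(2) graded_adjoin[OF step(1,3) a(2)] ne(2)] by blast
    have "has_dim X J (max d1 d2)" by (rule has_dim_split[OF fin step(1,3,4) a 1(1) 2(1)])
    moreover have "J \<subseteq> P1 0" "J \<subseteq> P2 0" using 1(3) 2(3) sub by blast+
    ultimately show ?thesis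
      using 1(2) 2(2) by (cases "d1 \<le> d2") (auto simp: max_def)
  qed
qed

text \<open>The chain of primes found together with the Hilbert series has the greatest length, because
  the growth bounds the length of every chain.\<close>

theorem krull_dim_eq:
  fixes J :: "'k::field mpoly set"
  assumes "ideal J (poly_ring X)" "graded J" "1 \<notin> J"
  obtains d where "has_dim X J d" "krull_dim (poly_ring X Quot J) = enat d"
proof -
  obtain d P where d: "has_dim X J d" and P: "prime_chain (poly_ring X) d P" "J \<subseteq> P 0"
    using has_dim_exists[OF assms] by blast
  have "krull_dim (poly_ring X Quot J) = enat d"
    unfolding krull_dim_quotient[OF assms(1)]
  proof (rule antisym)
    show "Sup {enat n |n. \<exists>P. prime_chain (poly_ring X) n P \<and> J \<subseteq> P 0} \<le> enat d"
      using d chain_length_le_growth[OF fin assms(1)] by (intro Sup_least) (auto simp: has_dim_def)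
    show "enat d \<le> Sup {enat n |n. \<exists>P. prime_chain (poly_ring X) n P \<and> J \<subseteq> P 0}"
      using P by (intro Sup_upper) blast
  qed
  then show ?thesis using that d by blast
qed

end

section \<open>Initial \<open>y\<close>-forms\<close>

text \<open>These are the ideals extended from the polynomial ring without \<open>y\<close>, see \<open>extended_Idl\<close>, in a
  form that does not mention generators.\<close>

definition extended :: "nat set \<Rightarrow> nat \<Rightarrow> 'k::field mpoly set \<Rightarrow> bool" where
  "extended X y C \<longleftrightarrow> ideal C (poly_ring X) \<and> (\<forall>f\<in>C. \<forall>k. y_coeff y k f \<in> C)"

lemma extended_Idl:
  fixes S :: "'k::field mpoly set"
  assumes S: "S \<subseteq> carrier (poly_ring (X - {y}))"
  shows "extended X y (Idl\<^bsub>poly_ring X\<^esub> S)"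
proof -
  let ?C = "Idl\<^bsub>poly_ring X\<^esub> S"
  have S': "S \<subseteq> carrier (poly_ring X)" using S poly_ring_mono[of "X - {y}" X] by blast
  have C: "ideal ?C (poly_ring X)" using S' by (rule Idl_ideal)
  have "?C \<subseteq> {f \<in> carrier (poly_ring X). \<forall>k. y_coeff y k f \<in> ?C}"
  proof (rule Idl_least)
    show "ideal {f \<in> carrier (poly_ring X). \<forall>k. y_coeff y k f \<in> ?C} (poly_ring X)"
      by (rule ideal_poly_ringI)
        (auto simp: y_coeff_add y_coeff_mult intro!: ideal_0[OF C] ideal_add[OF C] ideal_sum[OF C]
          ideal_mult[OF C])
    show "S \<subseteq> {f \<in> carrier (poly_ring X). \<forall>k. y_coeff y k f \<in> ?C}"
    proof
      fix f assume f: "f \<in> S"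
      then have "f \<in> carrier (poly_ring (X - {y}))" "f \<in> ?C" using S Idl_incl[OF S'] by auto
      then show "f \<in> {f \<in> carrier (poly_ring X). \<forall>k. y_coeff y k f \<in> ?C}"
        using ideal_0[OF C] f S' by (auto simp: y_coeff_free)
    qed
  qed
  then show ?thesis using C by (auto simp: extended_def)
qed

lemma extendedI_mem:
  assumes C: "ideal C (poly_ring X)" and y: "y \<in> X" and "\<And>k. y_coeff y k f \<in> C"
  shows "f \<in> C"
proof -
  have "(\<Sum>i\<le>y_degree y f. y_coeff y i f * var y ^ i) \<in> C"
    using assms by (intro ideal_sum[OF C] ideal_mult'[OF C]) auto
  then show ?thesis using y_expansion[of f y] by simp
qed

lemma y_coeff_0_remainder:
  fixes f :: "'k::field mpoly"
  assumes f: "f \<in> carrier (poly_ring X)" and y: "y \<in> X"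
  shows "\<exists>r\<in>carrier (poly_ring X). f = y_coeff y 0 f + r * var y"
proof -
  have "f = (\<Sum>i\<le>Suc (y_degree y f). y_coeff y i f * var y ^ i)"
    by (rule y_expansion_le) (auto intro: y_coeff_above)
  also have "\<dots> = y_coeff y 0 f + (\<Sum>i\<le>y_degree y f. y_coeff y (Suc i) f * var y ^ i) * var y"
    by (simp add: sum.atMost_Suc_shift sum_distrib_left mult_ac del: sum.atMost_Suc)
  finally show ?thesis using f y by (intro bexI[of _ "\<Sum>i\<le>y_degree y f. y_coeff y (Suc i) f * var y ^ i"]) auto
qed

context
  fixes X y and C :: "'k::field mpoly set"
  assumes C: "extended X y C" and y: "y \<in> X"
begin

lemma extended_ideal: "ideal C (poly_ring X)"
  and extended_coeff: "f \<in> C \<Longrightarrow> y_coeff y k f \<in> C"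
  using C by (auto simp: extended_def)

lemma extended_colon_var: "colon X C (var y) = C"
proof
  show "colon X C (var y) \<subseteq> C"
  proof
    fix f assume f: "f \<in> colon X C (var y)"
    have "y_coeff y k f \<in> C" for k
      using extended_coeff[of "f * var y" "Suc k"] f y_coeff_mult_var[of y "Suc k" f 1]
      by (simp add: colon_def)
    then show "f \<in> C" by (rule extendedI_mem[OF extended_ideal y])
  qed
  show "C \<subseteq> colon X C (var y)" using y by (intro colon_incl[OF extended_ideal]) auto
qed

lemma extended_adjoin_var:
  "f \<in> adjoin X C (var y) \<longleftrightarrow> f \<in> carrier (poly_ring X) \<and> y_coeff y 0 f \<in> C"
proof
  assume "f \<in> adjoin X C (var y)"
  then obtain g r where gr: "f = g + r * var y" "g \<in> C" "r \<in> carrier (poly_ring X)"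
    by (auto simp: adjoin_def)
  have "y_coeff y 0 f = y_coeff y 0 g"
    using y_coeff_mult_var[of y 0 r 1] by (simp add: gr(1) y_coeff_add)
  then show "f \<in> carrier (poly_ring X) \<and> y_coeff y 0 f \<in> C"
    using gr ideal_carr[OF extended_ideal] extended_coeff y by auto
next
  assume f: "f \<in> carrier (poly_ring X) \<and> y_coeff y 0 f \<in> C"
  then obtain r where "r \<in> carrier (poly_ring X)" "f = y_coeff y 0 f + r * var y"
    using y_coeff_0_remainder y by blast
  then show "f \<in> adjoin X C (var y)" using f unfolding adjoin_def by blast
qed

lemma extended_cancel_var_power:
  "f \<in> carrier (poly_ring X) \<Longrightarrow> f * var y ^ k \<in> C \<Longrightarrow> f \<in> C"
proof (induction k)
  case (Suc k)
  have "f * var y ^ k \<in> colon X C (var y)"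
    using Suc.prems y by (auto simp: colon_def mult.assoc mult.commute[of "var y ^ k"])
  then show ?case using Suc extended_colon_var by simp
qed simp

end

subsection \<open>The initial ideal with respect to \<open>y\<close>\<close>

context
  fixes X y and I :: "'k::field mpoly set"
  assumes I: "ideal I (poly_ring X)" and y: "y \<in> X"
begin

lemma y_lead_coeff_carrier: "f \<in> carrier (poly_ring X) \<Longrightarrow> y_lead_coeff y f \<in> carrier (poly_ring (X - {y}))"
  unfolding y_lead_coeff_def by auto

lemma initial_y_form_carrier:
  "f \<in> carrier (poly_ring X) \<Longrightarrow> initial_y_form y f \<in> carrier (poly_ring X)"
  unfolding initial_y_form_def y_lead_coeff_def using y by auto

lemma initial_y_ideal_ideal: "ideal (initial_y_ideal X y I) (poly_ring X)"
  unfolding initial_y_ideal_def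
  using initial_y_form_carrier ideal_carr[OF I] by (intro Idl_ideal) auto

lemma initial_y_ideal_mem:
  assumes f: "f \<in> I" and top: "\<And>i. i > k \<Longrightarrow> y_coeff y i f = 0"
  shows "y_coeff y k f * var y ^ k \<in> initial_y_ideal X y I"
proof (cases "y_coeff y k f = 0")
  case True
  then show ?thesis using ideal_0[OF initial_y_ideal_ideal] by simp
next
  case False
  have "y_degree y f \<le> k" using top by (rule y_degree_leI)
  moreover have "\<not> y_degree y f < k" using False y_coeff_above by blast
  ultimately have "initial_y_form y f = y_coeff y k f * var y ^ k"
    by (simp add: initial_y_form_def y_lead_coeff_def)
  moreover have "initial_y_form y ` I \<subseteq> initial_y_ideal X y I"
    unfolding initial_y_ideal_def
    using initial_y_form_carrier ideal_carr[OF I] by (intro Idl_incl) auto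
  ultimately show ?thesis using f by force
qed

text \<open>Sums and multiples can be lifted from initial forms to elements of \<open>I\<close>, one power of \<open>y\<close> at a
  time.\<close>

lemma initial_y_ideal_lift:
  assumes "g \<in> initial_y_ideal X y I"
  shows "\<exists>f\<in>I. (\<forall>i>k. y_coeff y i f = 0) \<and> y_coeff y k f = y_coeff y k g"
proof -
  define Z where "Z = {g \<in> carrier (poly_ring X).
    \<forall>k. \<exists>f\<in>I. (\<forall>i>k. y_coeff y i f = 0) \<and> y_coeff y k f = y_coeff y k g}"
  have "ideal Z (poly_ring X)"
  proof (rule ideal_poly_ringI)
    show "0 \<in> Z" unfolding Z_def using ideal_0[OF I] by (auto intro!: bexI[of _ 0])
    fix g h assume gh: "g \<in> Z" "h \<in> Z"
    have "\<exists>f\<in>I. (\<forall>i>k. y_coeff y i f = 0) \<and> y_coeff y k f = y_coeff y k (g + h)" for k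
    proof -
      obtain f1 f2 where "f1 \<in> I" "f2 \<in> I" "\<forall>i>k. y_coeff y i f1 = 0" "\<forall>i>k. y_coeff y i f2 = 0"
        "y_coeff y k f1 = y_coeff y k g" "y_coeff y k f2 = y_coeff y k h"
        using gh unfolding Z_def by blast
      then show ?thesis
        using ideal_add[OF I] by (intro bexI[of _ "f1 + f2"]) (auto simp: y_coeff_add)
    qed
    then show "g + h \<in> Z" using gh by (auto simp: Z_def)
  next
    fix r g :: "'k mpoly" assume r: "r \<in> carrier (poly_ring X)" and g: "g \<in> Z"
    have "\<exists>f\<in>I. (\<forall>i>k. y_coeff y i f = 0) \<and> y_coeff y k f = y_coeff y k (r * g)" for k
    proof -
      have "\<forall>k. \<exists>f\<in>I. (\<forall>i>k. y_coeff y i f = 0) \<and> y_coeff y k f = y_coeff y k g"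
        using g by (simp add: Z_def)
      then obtain F where F: "\<And>k. F k \<in> I" "\<And>i k. i > k \<Longrightarrow> y_coeff y i (F k) = 0"
        "\<And>k. y_coeff y k (F k) = y_coeff y k g" by metis
      define f where "f = (\<Sum>i\<le>k. y_coeff y i r * (var y ^ i * F (k - i)))"
      have "f \<in> I"
        unfolding f_def using r y F(1) by (intro ideal_sum[OF I] ideal_mult[OF I]) auto
      have coeff: "y_coeff y j f = (\<Sum>i\<le>k. y_coeff y i r * y_coeff y (j - i) (F (k - i)))"
        if "j \<ge> k" for j
      proof -
        have "y_coeff y j (y_coeff y i r * (var y ^ i * F (k - i)))
            = y_coeff y i r * y_coeff y (j - i) (F (k - i))" if "i \<le> k" for i
        proof -
          have "y_coeff y i r \<in> carrier (poly_ring (X - {y}))" using r by auto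
          then have "y_coeff y j (y_coeff y i r * (var y ^ i * F (k - i)))
            = y_coeff y i r * y_coeff y j (F (k - i) * var y ^ i)"
            by (simp add: y_coeff_free_mult mult.commute)
          then show ?thesis using that \<open>j \<ge> k\<close> by (simp add: y_coeff_mult_var)
        qed
        then show ?thesis unfolding f_def y_coeff_sum by (intro sum.cong) auto
      qed
      have "y_coeff y j f = 0" if "j > k" for j
        using coeff[of j] that by (auto intro!: sum.neutral simp: F(2))
      moreover have "y_coeff y k f = y_coeff y k (r * g)"
        using coeff[of k] by (simp add: F(3) y_coeff_mult)
      ultimately show ?thesis using \<open>f \<in> I\<close> by blast
    qed
    then show "r * g \<in> Z" using r g by (auto simp: Z_def)
  qed (auto simp: Z_def)
  moreover have "initial_y_form y ` I \<subseteq> Z"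
  proof
    fix g assume "g \<in> initial_y_form y ` I"
    then obtain f where f: "f \<in> I" "g = initial_y_form y f" by auto
    let ?d = "y_degree y f"
    have fc: "f \<in> carrier (poly_ring X)" using ideal_carr[OF I f(1)] .
    have co: "y_coeff y k g = (if k = ?d then y_coeff y ?d f else 0)" for k
      using y_coeff_free[OF y_coeff_in_poly_ring[OF fc], of y "k - ?d" ?d]
      by (auto simp: f(2) initial_y_form_def y_lead_coeff_def y_coeff_mult_var)
    have "\<exists>f\<in>I. (\<forall>i>k. y_coeff y i f = 0) \<and> y_coeff y k f = y_coeff y k g" for k
    proof (cases "k = ?d")
      case True
      then show ?thesis using f(1) co y_coeff_above by (intro bexI[of _ f]) auto
    next
      case False
      then show ?thesis using ideal_0[OF I] co by (intro bexI[of _ 0]) auto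
    qed
    then show "g \<in> Z" using initial_y_form_carrier[OF fc] f(2) by (auto simp: Z_def)
  qed
  ultimately have "initial_y_ideal X y I \<subseteq> Z"
    unfolding initial_y_ideal_def by (rule Idl_least)
  then show ?thesis using assms by (auto simp: Z_def)
qed

lemma y_coeff_hcomp_cong:
  "y_coeff y k f = y_coeff y k g \<Longrightarrow> y_coeff y k (hcomp s f) = y_coeff y k (hcomp s g)"
proof (intro poly_mapping_eqI)
  fix m assume eq: "y_coeff y k f = y_coeff y k g"
  then have "lookup f (m + single y k) = lookup g (m + single y k)" if "lookup m y = 0"
    using that lookup_y_coeff[of y k f m] lookup_y_coeff[of y k g m] by simp
  then show "lookup (y_coeff y k (hcomp s f)) m = lookup (y_coeff y k (hcomp s g)) m"
    by (auto simp: lookup_y_coeff lookup_part when_def)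
qed

lemma y_coeff_hcomp_0: "y_coeff y k f = 0 \<Longrightarrow> y_coeff y k (hcomp s f) = 0"
  using y_coeff_hcomp_cong[of k f 0 s] by simp

lemma graded_initial_y_ideal:
  assumes gr: "graded I"
  shows "graded (initial_y_ideal X y I)"
  unfolding initial_y_ideal_def
proof (rule graded_Idl)
  show "initial_y_form y ` I \<subseteq> carrier (poly_ring X)"
    using initial_y_form_carrier ideal_carr[OF I] by auto
  fix g s assume "g \<in> initial_y_form y ` I"
  then obtain f where f: "f \<in> I" "g = initial_y_form y f" by auto
  let ?d = "y_degree y f"
  have g: "g = var y ^ ?d * y_coeff y ?d f"
    by (simp add: f(2) initial_y_form_def y_lead_coeff_def mult.commute)
  have "homogeneous ?d (var y ^ ?d :: 'k mpoly)"
    using homogeneous_power[OF homogeneous_var[of y], of ?d] by simp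
  then have "hcomp s g = (if ?d \<le> s then var y ^ ?d * hcomp (s - ?d) (y_coeff y ?d f) else 0)"
    unfolding g by (rule hcomp_homogeneous_mult)
  moreover have "y_coeff y ?d (hcomp s f) * var y ^ ?d \<in> initial_y_ideal X y I"
    using gradedD[OF gr f(1)] by (intro initial_y_ideal_mem) (auto intro: y_coeff_hcomp_0 y_coeff_above)
  ultimately have "hcomp s g \<in> initial_y_ideal X y I"
    using ideal_0[OF initial_y_ideal_ideal] y_coeff_hcomp[of "s - ?d" y ?d f]
    by (auto simp: mult.commute)
  then show "hcomp s g \<in> Idl\<^bsub>poly_ring X\<^esub> (initial_y_form y ` I)"
    by (simp add: initial_y_ideal_def)
qed

text \<open>Filter by the degree in \<open>y\<close>: in each step of the filtration the coefficients of the highest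
  power of \<open>y\<close> are the same for \<open>I\<close> and for its initial ideal.\<close>

lemma hf_initial_y_ideal:
  assumes X: "finite X" and gr: "graded I"
  shows "hf X (initial_y_ideal X y I) s = hf X I s"
proof -
  let ?in = "initial_y_ideal X y I"
  define V where "V k = {f \<in> Deg X s :: 'k mpoly set. \<forall>i\<ge>k. y_coeff y i f = 0}" for k
  have VD: "V k \<subseteq> Deg X s" for k by (auto simp: V_def)
  have subV: "mp.subspace (V k)" for k
  proof (rule mp_subspaceI)
    show "0 \<in> V k" using mp.subspace_0[OF subspace_Deg] by (auto simp: V_def)
    show "f + g \<in> V k" if "f \<in> V k" "g \<in> V k" for f g
      using that mp.subspace_add[OF subspace_Deg] by (auto simp: V_def y_coeff_add)
    show "const c * f \<in> V k" if "f \<in> V k" for c f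
      using that mp.subspace_scale[OF subspace_Deg] by (auto simp: V_def y_coeff_const_mult)
  qed
  have finV: "fin_dim (V k)" for k by (rule fin_dim_subset[OF fin_dim_Deg[OF X] VD])
  have VSuc: "V k \<subseteq> V (Suc k)" for k by (auto simp: V_def)
  define P where "P J k = {g + u |g u. g \<in> J \<and> u \<in> V k}" for J k
  have subP: "mp.subspace (P J k)" if "mp.subspace J" for J k
    unfolding P_def by (rule subspace_plus[OF that subV])
  have step: "dim_mod J (V (Suc k)) = dim_mod (P J k) (V (Suc k)) + dim_mod J (V k)"
    if J: "mp.subspace J" for J k
  proof (rule dim_mod_exact[where f = "\<lambda>u. u"])
    show "J \<subseteq> P J k" unfolding P_def using mp.subspace_0[OF subV] by force
    show "v \<in> P J k \<longleftrightarrow> (\<exists>u\<in>V k. v - u \<in> J)" for v unfolding P_def by force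
  qed (use subV finV J subP VSuc[of k] mp_linear_mult in auto)
  have top: "y_coeff y k f * var y ^ k \<in> Deg X s" "f - y_coeff y k f * var y ^ k \<in> V k"
    if f: "f \<in> V (Suc k)" for f k
  proof -
    have fD: "f \<in> Deg X s" using f VD by auto
    show 1: "y_coeff y k f * var y ^ k \<in> Deg X s"
      unfolding y_coeff_mult_power using fD by (auto simp: Deg_def homogeneous_def keys_part)
    have "y_coeff y i (y_coeff y k f * var y ^ k) = (if i = k then y_coeff y k f else 0)" for i
      using y_coeff_free[OF y_coeff_in_poly_ring[OF Deg_carrier[OF fD]], of y "i - k" k]
      by (auto simp: y_coeff_mult_var)
    then have "y_coeff y i (f - y_coeff y k f * var y ^ k) = 0" if "i \<ge> k" for i
      using f that by (cases "i = k") (auto simp: y_coeff_diff V_def)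
    then show "f - y_coeff y k f * var y ^ k \<in> V k"
      using mp.subspace_diff[OF subspace_Deg fD 1] by (simp add: V_def)
  qed
  \<comment> \<open>Both sides consist of the \<open>v\<close> whose coefficient of \<open>y\<^sup>k\<close> occurs as a leading coefficient in \<open>I\<close>.\<close>
  have same: "V (Suc k) \<inter> P I k = V (Suc k) \<inter> P ?in k" for k
  proof (intro equalityI subsetI IntI)
    fix v assume v: "v \<in> V (Suc k) \<inter> P I k"
    then show "v \<in> V (Suc k)" by simp
    obtain f w where fw: "v = f + w" "f \<in> I" "w \<in> V k" using v by (auto simp: P_def)
    have "v - w \<in> V (Suc k)"
      using v fw(3) VSuc[of k] by (intro mp.subspace_diff[OF subV]) auto
    then have f: "f \<in> V (Suc k)" using fw(1) by simp
    then have "y_coeff y k f * var y ^ k \<in> ?in"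
      using fw(2) by (intro initial_y_ideal_mem) (auto simp: V_def)
    moreover have "w + (f - y_coeff y k f * var y ^ k) \<in> V k"
      using mp.subspace_add[OF subV fw(3) top(2)[OF f]] .
    moreover have "v = y_coeff y k f * var y ^ k + (w + (f - y_coeff y k f * var y ^ k))"
      by (simp add: fw(1))
    ultimately show "v \<in> P ?in k" unfolding P_def by blast
  next
    fix v assume v: "v \<in> V (Suc k) \<inter> P ?in k"
    then show "v \<in> V (Suc k)" by simp
    obtain g w where gw: "v = g + w" "g \<in> ?in" "w \<in> V k" using v by (auto simp: P_def)
    have "v - w \<in> V (Suc k)"
      using v gw(3) VSuc[of k] by (intro mp.subspace_diff[OF subV]) auto
    then have g: "g \<in> V (Suc k)" using gw(1) by simp
    obtain f where f: "f \<in> I" "\<And>i. i > k \<Longrightarrow> y_coeff y i f = 0" "y_coeff y k f = y_coeff y k g"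
      using initial_y_ideal_lift[OF gw(2)] by blast
    let ?f = "hcomp s f"
    have fI: "?f \<in> I" using gradedD[OF gr f(1)] .
    have gs: "hcomp s g = g" using g by (auto simp: V_def Deg_def hcomp_homogeneous)
    have "y_coeff y k ?f = y_coeff y k g" using y_coeff_hcomp_cong[OF f(3)] gs by metis
    moreover have "y_coeff y i ?f = 0" if "i > k" for i using y_coeff_hcomp_0 f(2)[OF that] by blast
    ultimately have "y_coeff y i (g - ?f) = 0" if "i \<ge> k" for i
      using g that by (cases "i = k") (auto simp: y_coeff_diff V_def)
    moreover have "g - ?f \<in> Deg X s"
      using g ideal_carr[OF I f(1)] hcomp_Deg by (intro mp.subspace_diff[OF subspace_Deg]) (auto simp: V_def)
    ultimately have "g - ?f \<in> V k" by (simp add: V_def)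
    then have "w + (g - ?f) \<in> V k" using mp.subspace_add[OF subV gw(3)] by blast
    moreover have "v = ?f + (w + (g - ?f))" by (simp add: gw(1))
    ultimately show "v \<in> P I k" unfolding P_def using fI by blast
  qed
  have eq: "dim_mod ?in (V k) = dim_mod I (V k)" for k
  proof (induction k)
    case 0
    have "V 0 = {0}"
    proof -
      have "f = 0" if "f \<in> V 0" for f using that y_coeff_eq_0_iff[of y f] by (auto simp: V_def)
      then show ?thesis using mp.subspace_0[OF subV] by blast
    qed
    then have "V 0 \<inter> ?in = V 0 \<inter> I"
      using ideal_0[OF I] ideal_0[OF initial_y_ideal_ideal] by auto
    then show ?case by (rule dim_mod_cong)
  next
    case (Suc k)
    have "dim_mod (P ?in k) (V (Suc k)) = dim_mod (P I k) (V (Suc k))"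
      by (rule dim_mod_cong) (use same in auto)
    then show ?case
      using Suc step[OF ideal_subspace[OF I]] step[OF ideal_subspace[OF initial_y_ideal_ideal]] by simp
  qed
  have "V (Suc s) = Deg X s"
  proof -
    have "y_coeff y i f = 0" if f: "f \<in> Deg X s" and i: "i \<ge> Suc s" for f i
    proof (rule y_coeff_above, unfold y_degree_eq, rule le_less_trans[OF grade_bound_leI])
      fix m assume "m \<in> keys f"
      then have "total_deg m = s" using f by (auto simp: Deg_def homogeneous_def)
      then show "lookup m y \<le> s"
        using member_le_sum[of y "keys m" "lookup m"]
        by (cases "y \<in> keys m") (auto simp: total_deg_def in_keys_iff)
    qed (use i in simp)
    then show ?thesis using VD by (auto simp: V_def)
  qed
  then show ?thesis using eq[of "Suc s"] by (simp add: hf_def)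
qed

end

section \<open>Geometric vertex decompositions\<close>

lemma set_add_PIdl:
  assumes "f \<in> carrier (poly_ring X)"
  shows "J <+>\<^bsub>poly_ring X\<^esub> PIdl\<^bsub>poly_ring X\<^esub> f = adjoin X J f"
  unfolding set_add_def' cgenideal_def adjoin_def by auto

locale gvd =
  fixes X y ord and G I :: "'k::field mpoly set"
  assumes gvd: "geometric_vertex_decomposition X y ord G I"
begin

abbreviation "C \<equiv> C_ideal X y G"
abbreviation "N \<equiv> N_ideal X y G"
abbreviation "inI \<equiv> initial_y_ideal X y I"

lemma I: "ideal I (poly_ring X)" and y: "y \<in> X" and ord: "monomial_order X ord"
  and G: "G \<subseteq> I"
  using gvd by (auto simp: geometric_vertex_decomposition_def groebner_basis_def)

lemma var_carr: "var y \<in> carrier (poly_ring X)"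
  using y by auto

lemma G_carr: "g \<in> G \<Longrightarrow> g \<in> carrier (poly_ring X)"
  using G ideal_carr[OF I] by auto

lemma lead_coeffs_carr: "y_lead_coeff y ` G \<subseteq> carrier (poly_ring (X - {y}))"
  using G_carr y_lead_coeff_carrier[OF I y] by auto

lemma extended_C: "extended X y C" and extended_N: "extended X y N"
  unfolding C_ideal_def N_ideal_def using lead_coeffs_carr by (intro extended_Idl; auto)+

lemmas ideal_C = extended_ideal[OF extended_C y] and ideal_N = extended_ideal[OF extended_N y]

lemma N_le_C: "N \<subseteq> C"
  unfolding N_ideal_def
proof (rule Idl_least[OF ideal_C])
  have "y_lead_coeff y ` G \<subseteq> carrier (poly_ring X)"
    using lead_coeffs_carr poly_ring_mono[of "X - {y}" X] by blast
  then have "y_lead_coeff y ` G \<subseteq> C" unfolding C_ideal_def by (rule Idl_incl)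
  then show "y_lead_coeff y ` {g \<in> G. y_degree y g = 0} \<subseteq> C" by auto
qed

lemma N_le_I: "N \<subseteq> I"
  unfolding N_ideal_def
proof (rule Idl_least[OF I], clarify)
  fix g assume "g \<in> G" "y_degree y g = 0"
  then show "y_lead_coeff y g \<in> I"
    using y_expansion[of g y] G by (auto simp: y_lead_coeff_def)
qed

lemma inI_eq: "inI = C \<inter> adjoin X N (var y)"
  using gvd by (simp add: geometric_vertex_decomposition_def set_add_PIdl[OF var_carr])

lemma var_mult_inI:
  assumes "q \<in> C"
  shows "q * var y \<in> inI"
  unfolding inI_eq
  using ideal_mult'[OF ideal_C var_carr assms] ideal_0[OF ideal_N] ideal_carr[OF ideal_C assms]
  by (force simp: adjoin_def)

lemma colon_inI: "colon X inI (var y) = C"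
proof
  show "colon X inI (var y) \<subseteq> C"
    using extended_colon_var[OF extended_C y] by (auto simp: inI_eq colon_def)
  show "C \<subseteq> colon X inI (var y)"
    using var_mult_inI ideal_carr[OF ideal_C] by (auto simp: colon_def)
qed

lemma adjoin_inI: "adjoin X inI (var y) = adjoin X N (var y)"
proof
  have "inI \<subseteq> adjoin X N (var y)" unfolding inI_eq by simp
  then show "adjoin X inI (var y) \<subseteq> adjoin X N (var y)"
    by (intro adjoin_least ideal_adjoin[OF ideal_N var_carr] adjoin_mem[OF ideal_N])
  have "N \<subseteq> inI" unfolding inI_eq using N_le_C adjoin_incl by blast
  then show "adjoin X N (var y) \<subseteq> adjoin X inI (var y)" by (rule adjoin_mono)
qed

text \<open>The element \<open>q y\<close> belongs to \<open>C \<inter> (N + (y))\<close>, hence to the initial ideal, and can be lifted to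
  \<open>I\<close>.\<close>

lemma C_lift:
  assumes q: "q \<in> C" "q \<in> carrier (poly_ring (X - {y}))"
  shows "\<exists>r\<in>carrier (poly_ring (X - {y})). q * var y - r \<in> I"
proof -
  obtain f where f: "f \<in> I" "\<And>i. i > 1 \<Longrightarrow> y_coeff y i f = 0" "y_coeff y 1 f = y_coeff y 1 (q * var y)"
    using initial_y_ideal_lift[OF I y var_mult_inI[OF q(1)], of 1] by blast
  have "y_coeff y 1 f = q"
    using f(3) y_coeff_mult_var[of y 1 q 1] y_coeff_free[OF q(2), of 0] by simp
  moreover have "f = (\<Sum>i\<le>1. y_coeff y i f * var y ^ i)"
    by (rule y_expansion_le) (use f(2) in auto)
  ultimately have "q * var y - (- y_coeff y 0 f) = f"
    by (simp add: add.commute)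
  moreover have "- y_coeff y 0 f \<in> carrier (poly_ring (X - {y}))"
    using ideal_carr[OF I f(1)] by auto
  ultimately show ?thesis using f(1) by (intro bexI[of _ "- y_coeff y 0 f"]) simp_all
qed

lemma graded_ideals:
  assumes "graded I"
  shows "graded inI" "graded C" "graded N"
proof -
  show gin: "graded inI" by (rule graded_initial_y_ideal[OF I y assms])
  then show "graded C"
    using graded_colon[OF initial_y_ideal_ideal[OF I y] gin homogeneous_var[of y]] colon_inI by simp
  have gN: "graded (adjoin X N (var y))"
    using graded_adjoin[OF initial_y_ideal_ideal[OF I y] gin homogeneous_var[of y]] adjoin_inI by simp
  have comp: "hcomp s g \<in> N" if g: "g \<in> N" "g \<in> carrier (poly_ring (X - {y}))" for s g
  proof -
    have "hcomp s g \<in> adjoin X N (var y)"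
      using gradedD[OF gN] adjoin_incl g(1) by blast
    then have "y_coeff y 0 (hcomp s g) \<in> N" using extended_adjoin_var[OF extended_N y] by blast
    moreover have "y_coeff y 0 (hcomp s g) = hcomp s g"
      using y_coeff_free[of "hcomp s g" X y 0] g(2) by auto
    ultimately show ?thesis by simp
  qed
  show "graded N"
    unfolding graded_def
  proof (intro ballI allI)
    fix f s assume f: "f \<in> N"
    have fc: "f \<in> carrier (poly_ring X)" using ideal_carr[OF ideal_N f] .
    have "y_coeff y k (hcomp s f) \<in> N" for k
    proof (cases "k \<le> s")
      case True
      then have "y_coeff y k (hcomp s f) = hcomp (s - k) (y_coeff y k f)"
        using y_coeff_hcomp[of "s - k" y k f] by simp
      then show ?thesis using comp[OF extended_coeff[OF extended_N y f]] fc by auto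
    next
      case False
      then have "y_coeff y k (hcomp s f) = 0"
        by (intro poly_mapping_eqI) (auto simp: lookup_y_coeff lookup_part total_deg_add when_def)
      then show ?thesis using ideal_0[OF ideal_N] by simp
    qed
    then show "hcomp s f \<in> N" by (rule extendedI_mem[OF ideal_N y])
  qed
qed

text \<open>The exact sequence \<open>0 \<rightarrow> R/C(-1) \<rightarrow> R/in\<^sub>y(I) \<rightarrow> R/(N + (y)) \<rightarrow> 0\<close> and the fact that \<open>y\<close> is regular
  on \<open>R/N\<close> give the relation between the three Hilbert series.\<close>

lemma hs_N:
  assumes X: "finite X" and gr: "graded I"
  shows "hs X (adjoin X N (var y)) = (1 - fps_X) * hs X N"
  using hs_exact[OF X ideal_N graded_ideals(3)[OF gr] var_carr homogeneous_var]
    extended_colon_var[OF extended_N y] by (simp add: algebra_simps)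

lemma hs_decomposition:
  assumes X: "finite X" and gr: "graded I"
  shows "hs X I = hs X (adjoin X N (var y)) + fps_X * hs X C"
proof -
  have "hs X I = hs X inI"
    by (rule fps_ext) (simp add: hs_def hf_initial_y_ideal[OF I y X gr])
  also have "\<dots> = hs X (adjoin X N (var y)) + fps_X * hs X C"
    using hs_exact[OF X initial_y_ideal_ideal[OF I y] graded_ideals(1)[OF gr] var_carr homogeneous_var]
    by (simp add: colon_inI adjoin_inI)
  finally show ?thesis .
qed

end

section \<open>Geometrically vertex decomposable ideals are radical\<close>

lemma radical_iff:
  "radical (poly_ring X) J = {f \<in> carrier (poly_ring X). \<exists>n. f ^ n \<in> J}"
  by (simp add: radical_def)

lemma radicalI:
  assumes "ideal J (poly_ring X)"
    and "\<And>f n. f \<in> carrier (poly_ring X) \<Longrightarrow> f ^ n \<in> J \<Longrightarrow> f \<in> J"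
  shows "radical (poly_ring X) J = J"
proof -
  have "f ^ 1 \<in> J" if "f \<in> J" for f using that by simp
  then show ?thesis unfolding radical_iff using assms ideal_carr[OF assms(1)] by blast
qed

lemma radicalD:
  "radical (poly_ring X) J = J \<Longrightarrow> f \<in> carrier (poly_ring X) \<Longrightarrow> f ^ n \<in> J \<Longrightarrow> f \<in> J"
  unfolding radical_iff by blast

lemma power_diff_ideal:
  assumes J: "ideal J (poly_ring X)" and f: "f \<in> carrier (poly_ring X)"
    and g: "g \<in> carrier (poly_ring X)" and d: "f - g \<in> J"
  shows "f ^ n - g ^ n \<in> J"
proof (induction n)
  case 0 then show ?case using ideal_0[OF J] by simp
next
  case (Suc n)
  have "f * (f ^ n - g ^ n) + g ^ n * (f - g) \<in> J"
    using Suc d f g by (intro ideal_add[OF J] ideal_mult[OF J]) auto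
  then show ?case by (simp add: algebra_simps)
qed

lemma y_coeff_power_top:
  fixes f :: "'k::field mpoly"
  assumes "\<And>i. i > d \<Longrightarrow> y_coeff y i f = 0"
  shows "y_coeff y (d * n) (f ^ n) = y_coeff y d f ^ n \<and> (\<forall>i>d * n. y_coeff y i (f ^ n) = 0)"
proof (induction n)
  case 0
  have "y_coeff y i (1 :: 'k mpoly) = (if i = 0 then 1 else 0)" for i
    using y_coeff_var_power[of y i 0] by simp
  then show ?case by auto
next
  case (Suc n)
  have co: "y_coeff y k (f ^ Suc n) = (if k = d * Suc n then y_coeff y d f * y_coeff y (d * n) (f ^ n) else 0)"
    if k: "k \<ge> d * Suc n" for k
  proof -
    have "y_coeff y k (f ^ Suc n) = (\<Sum>i\<le>k. y_coeff y i f * y_coeff y (k - i) (f ^ n))"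
      by (simp add: y_coeff_mult)
    also have "\<dots> = (\<Sum>i\<le>k. if i = d then y_coeff y d f * y_coeff y (k - d) (f ^ n) else 0)"
    proof (intro sum.cong refl)
      fix i
      consider "i = d" | "i > d" | "i < d" by linarith
      then show "y_coeff y i f * y_coeff y (k - i) (f ^ n)
          = (if i = d then y_coeff y d f * y_coeff y (k - d) (f ^ n) else 0)"
      proof cases
        case 3
        then have "k - i > d * n" using k by simp
        then show ?thesis using Suc 3 by simp
      qed (use assms in auto)
    qed
    also have "\<dots> = y_coeff y d f * y_coeff y (k - d) (f ^ n)"
      using k by (simp add: sum.delta')
    also have "\<dots> = (if k = d * Suc n then y_coeff y d f * y_coeff y (d * n) (f ^ n) else 0)"
    proof (cases "k = d * Suc n")
      case False
      then have "k - d > d * n" using k by simp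
      then show ?thesis using Suc False by simp
    qed auto
    finally show ?thesis .
  qed
  then show ?case using Suc by auto
qed

text \<open>Radicality can be checked on leading coefficients: if some power of \<open>f\<close> lies in \<open>J\<close>, subtract
  an element of \<open>J\<close> with the same leading coefficient and proceed by induction on the \<open>y\<close>-degree.\<close>

lemma radical_by_leading_coeff:
  fixes J :: "'k::field mpoly set"
  assumes J: "ideal J (poly_ring X)"
    and lead: "\<And>d f. f \<in> carrier (poly_ring X) \<Longrightarrow> f ^ n \<in> J \<Longrightarrow> (\<And>i. i > d \<Longrightarrow> y_coeff y i f = 0) \<Longrightarrow>
      \<exists>g\<in>J. (\<forall>i>d. y_coeff y i g = 0) \<and> y_coeff y d g = y_coeff y d f"
    and f: "f \<in> carrier (poly_ring X)" "f ^ n \<in> J"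
  shows "f \<in> J"
proof -
  have "f \<in> J" if "\<And>i. i \<ge> d \<Longrightarrow> y_coeff y i f = 0" "f \<in> carrier (poly_ring X)" "f ^ n \<in> J" for d f
    using that
  proof (induction d arbitrary: f)
    case 0
    then have "f = 0" using y_coeff_eq_0_iff[of y f] by simp
    then show ?case using ideal_0[OF J] by simp
  next
    case (Suc d)
    obtain g where g: "g \<in> J" "\<And>i. i > d \<Longrightarrow> y_coeff y i g = 0" "y_coeff y d g = y_coeff y d f"
      using lead[OF Suc.prems(2,3), of d] Suc.prems(1) by (auto simp: Suc_le_eq)
    have gc: "g \<in> carrier (poly_ring X)" using ideal_carr[OF J g(1)] .
    have "f - g \<in> J"
    proof (rule Suc.IH)
      fix i assume "d \<le> i"
      then show "y_coeff y i (f - g) = 0"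
        using g(2)[of i] g(3) Suc.prems(1)[of i] by (cases "i = d") (auto simp: y_coeff_diff)
    next
      show c: "f - g \<in> carrier (poly_ring X)" using Suc.prems(2) gc by auto
      have "f - (f - g) \<in> J" using g(1) by simp
      then have "f ^ n - (f - g) ^ n \<in> J" by (rule power_diff_ideal[OF J Suc.prems(2) c])
      then show "(f - g) ^ n \<in> J" using ideal_diff_iff[OF J] Suc.prems(3) ideal_uminus_iff[OF J]
        by (metis ideal_diff[OF J] diff_diff_eq2 add_diff_cancel_left')
    qed
    then show ?case using ideal_diff_iff[OF J] g(1) by blast
  qed
  moreover have "y_coeff y i f = 0" if "i \<ge> Suc (y_degree y f)" for i
    using that by (intro y_coeff_above) simp
  ultimately show ?thesis using f by blast
qed

lemma radical_extended:
  assumes C: "extended X y C" and y: "y \<in> X"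
    and rad: "radical (poly_ring (X - {y})) (contract (X - {y}) C) = contract (X - {y}) C"
  shows "radical (poly_ring X) C = C"
proof (rule radicalI[OF extended_ideal[OF C y]])
  fix f n assume f: "f \<in> carrier (poly_ring X)" "f ^ n \<in> C"
  show "f \<in> C"
  proof (rule radical_by_leading_coeff[OF extended_ideal[OF C y] _ f])
    fix d h assume h: "h \<in> carrier (poly_ring X)" "h ^ n \<in> C" "\<And>i. i > d \<Longrightarrow> y_coeff y i h = 0"
    let ?a = "y_coeff y d h"
    have a: "?a \<in> carrier (poly_ring (X - {y}))" using h(1) by auto
    have "?a ^ n \<in> C"
      using y_coeff_power_top[of d y h n, OF h(3)] extended_coeff[OF C y h(2), of "d * n"] by simp
    then have "?a ^ n \<in> contract (X - {y}) C" using a by (auto simp: contract_def)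
    then have "?a \<in> C" using radicalD[OF rad a] by (auto simp: contract_def)
    then have "?a * var y ^ d \<in> C" using y by (intro ideal_mult'[OF extended_ideal[OF C y]]) auto
    moreover have "y_coeff y i (?a * var y ^ d) = (if i = d then ?a else 0)" for i
      using y_coeff_free[OF a, of "i - d"] by (auto simp: y_coeff_mult_var)
    ultimately show "\<exists>g\<in>C. (\<forall>i>d. y_coeff y i g = 0) \<and> y_coeff y d g = ?a"
      by (intro bexI[of _ "?a * var y ^ d"]) auto
  qed
qed

text \<open>The quotients by \<open>N + (y)\<close> and by the contraction of \<open>N\<close> are the same ring.\<close>

lemma radical_adjoin_var:
  assumes N: "extended X y N" and y: "y \<in> X" and rad: "radical (poly_ring X) N = N"
  shows "radical (poly_ring X) (adjoin X N (var y)) = adjoin X N (var y)"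
proof (rule radicalI)
  show "ideal (adjoin X N (var y)) (poly_ring X)"
    using y by (intro ideal_adjoin extended_ideal[OF N y]) auto
  fix f n assume f: "f \<in> carrier (poly_ring X)" "f ^ n \<in> adjoin X N (var y)"
  have pow: "y_coeff y 0 (f ^ n) = y_coeff y 0 f ^ n" for n
  proof (induction n)
    case 0 then show ?case using y_coeff_var_power[of y 0 0] by simp
  qed (simp add: y_coeff_mult)
  have "y_coeff y 0 (f ^ n) \<in> N" using f(2) by (simp add: extended_adjoin_var[OF N y])
  then have "y_coeff y 0 f ^ n \<in> N" by (simp only: pow)
  with radicalD[OF rad] have "y_coeff y 0 f \<in> N" using f(1) by blast
  then show "f \<in> adjoin X N (var y)" using f(1) by (simp add: extended_adjoin_var[OF N y])
qed

lemma radical_generated_by_variables: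
  assumes "finite S" "S \<subseteq> X"
  shows "radical (poly_ring X) (Idl\<^bsub>poly_ring X\<^esub> (var ` S) :: 'k::field mpoly set) = Idl\<^bsub>poly_ring X\<^esub> (var ` S)"
  using assms
proof (induction S)
  case empty
  have id: "ideal {0 :: 'k mpoly} (poly_ring X)" by (rule ideal_poly_ringI) auto
  have "Idl\<^bsub>poly_ring X\<^esub> (var ` {}) = {0 :: 'k mpoly}"
    using Idl_least[OF id, of "{}"] ideal_0[OF Idl_ideal[of "{}" X]] by auto
  then show ?case using radicalI[OF id] by simp
next
  case (insert y S)
  let ?N = "Idl\<^bsub>poly_ring X\<^esub> (var ` S) :: 'k mpoly set"
  have y: "y \<in> X" using insert by auto
  have "var ` S \<subseteq> carrier (poly_ring (X - {y}) :: 'k mpoly ring)"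
    using insert by (auto intro!: poly_ring_var)
  then have N: "extended X y ?N" by (rule extended_Idl)
  have vars: "var ` insert y S \<subseteq> (carrier (poly_ring X) :: 'k mpoly set)"
    using insert.prems by (auto intro!: poly_ring_var)
  have "Idl\<^bsub>poly_ring X\<^esub> (var ` insert y S) = adjoin X ?N (var y)"
  proof
    have "var ` S \<subseteq> ?N" using vars by (intro Idl_incl) auto
    then show "Idl\<^bsub>poly_ring X\<^esub> (var ` insert y S) \<subseteq> adjoin X ?N (var y)"
      using y adjoin_mem[OF extended_ideal[OF N y]] adjoin_incl
      by (intro Idl_least ideal_adjoin extended_ideal[OF N y]) blast+
    show "adjoin X ?N (var y) \<subseteq> Idl\<^bsub>poly_ring X\<^esub> (var ` insert y S)"
    proof (rule adjoin_least[OF Idl_ideal[OF vars]])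
      show "?N \<subseteq> Idl\<^bsub>poly_ring X\<^esub> (var ` insert y S)"
        using Idl_incl[OF vars] by (intro Idl_least Idl_ideal[OF vars]) auto
      show "var y \<in> (Idl\<^bsub>poly_ring X\<^esub> (var ` insert y S) :: 'k mpoly set)"
        using Idl_incl[OF vars] by auto
    qed
  qed
  then show ?case using radical_adjoin_var[OF N y] insert by simp
qed

lemma radical_unit_or_variables:
  assumes "finite X" "unit_or_generated_by_variables X I"
  shows "radical (poly_ring X) I = I"
proof -
  consider "I = carrier (poly_ring X)" | S where "S \<subseteq> X" "I = Idl\<^bsub>poly_ring X\<^esub> (var ` S)"
    using assms(2) unfolding unit_or_generated_by_variables_def by blast
  then show ?thesis
  proof cases
    case 1
    then show ?thesis by (intro radicalI) (simp_all add: ideal_carrier)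
  next
    case 2
    then show ?thesis
      using radical_generated_by_variables[of S X] finite_subset[OF _ assms(1)] by simp
  qed
qed

context gvd
begin

text \<open>The initial ideal is radical as an intersection of radical ideals. Radicality then passes to
  \<open>I\<close> by comparison of leading coefficients.\<close>

lemma radical_of_C_N:
  assumes radC: "radical (poly_ring X) C = C" and radN: "radical (poly_ring X) N = N"
  shows "radical (poly_ring X) I = I"
proof (rule radicalI[OF I])
  have radA: "radical (poly_ring X) (adjoin X N (var y)) = adjoin X N (var y)"
    by (rule radical_adjoin_var[OF extended_N y radN])
  have rad_in: "f \<in> inI" if "f \<in> carrier (poly_ring X)" "f ^ n \<in> inI" for f n
    using that radicalD[OF radC] radicalD[OF radA] unfolding inI_eq by blast
  fix f n assume f: "f \<in> carrier (poly_ring X)" "f ^ n \<in> I"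
  show "f \<in> I"
  proof (rule radical_by_leading_coeff[OF I _ f, where y = y])
    fix d h assume h: "h \<in> carrier (poly_ring X)" "h ^ n \<in> I" "\<And>i. i > d \<Longrightarrow> y_coeff y i h = 0"
    let ?a = "y_coeff y d h"
    have top: "y_coeff y (d * n) (h ^ n) = ?a ^ n" "\<And>i. i > d * n \<Longrightarrow> y_coeff y i (h ^ n) = 0"
      using y_coeff_power_top[of d y h n, OF h(3)] by auto
    have "y_coeff y (d * n) (h ^ n) * var y ^ (d * n) \<in> inI"
      by (rule initial_y_ideal_mem[OF I y h(2) top(2)])
    then have "(?a * var y ^ d) ^ n \<in> inI"
      by (simp add: top(1) power_mult power_mult_distrib)
    moreover have c: "?a * var y ^ d \<in> carrier (poly_ring X)" using h(1) var_carr by auto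
    ultimately have "?a * var y ^ d \<in> inI" by (rule rad_in[rotated])
    moreover have "y_coeff y d (?a * var y ^ d) = ?a"
      using y_coeff_free[OF y_coeff_in_poly_ring[OF h(1)], of y 0 d] by (simp add: y_coeff_mult_var)
    ultimately show "\<exists>g\<in>I. (\<forall>i>d. y_coeff y i g = 0) \<and> y_coeff y d g = ?a"
      using initial_y_ideal_lift[OF I y, of "?a * var y ^ d" d] by simp
  qed
qed

lemma degenerate_cases:
  assumes radN: "radical (poly_ring X) N = N" and "degenerate X y G"
  shows "C = N \<or> C = carrier (poly_ring X)"
proof -
  have "f \<in> radical (poly_ring X) C" if "f \<in> C" for f
    unfolding radical_iff using that ideal_carr[OF ideal_C that] by (auto intro!: exI[of _ 1])
  then have "C \<subseteq> N" if "radical (poly_ring X) C = radical (poly_ring X) N"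
    using that radN by auto
  then show ?thesis using assms(2) N_le_C by (auto simp: degenerate_def)
qed

end

lemma radical_geometrically_vertex_decomposable:
  assumes "geometrically_vertex_decomposable X I" "finite X"
  shows "radical (poly_ring X) I = I"
  using assms
proof (induction rule: geometrically_vertex_decomposable.induct)
  case (base X I)
  then show ?case using radical_unit_or_variables by blast
next
  case (decomp X I y ord G)
  interpret gvd X y ord G I by unfold_locales (rule decomp)
  show ?case
    using decomp radical_extended[OF extended_C y] radical_extended[OF extended_N y]
    by (intro radical_of_C_N) auto
qed

lemma radical_weakly_geometrically_vertex_decomposable:
  assumes "weakly_geometrically_vertex_decomposable X I" "finite X"
  shows "radical (poly_ring X) I = I"
  using assms
proof (induction rule: weakly_geometrically_vertex_decomposable.induct)
  case (base X I)
  then show ?case using radical_unit_or_variables by blast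
next
  case (degenerate X I y ord G)
  interpret gvd X y ord G I by unfold_locales (rule degenerate)
  have N: "radical (poly_ring X) N = N"
    using degenerate by (intro radical_extended[OF extended_N y]) auto
  have "radical (poly_ring X) (carrier (poly_ring X)) = (carrier (poly_ring X) :: 'a mpoly set)"
    by (rule radicalI[OF ideal_carrier]) auto
  then show ?case using degenerate_cases[OF N] degenerate(3) N by (intro radical_of_C_N) auto
next
  case (nondegenerate X I y ord G)
  interpret gvd X y ord G I by unfold_locales (rule nondegenerate)
  show ?case
    using nondegenerate radical_geometrically_vertex_decomposable[OF nondegenerate(4)]
    by (intro radical_of_C_N radical_extended[OF extended_C y]) auto
qed

section \<open>Multiplicities\<close>

lemma pole_unique:
  fixes F :: "int fps"
  assumes "F * (1 - fps_X) ^ a = fps_of_poly g" "poly g 1 \<noteq> 0"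
    and "F * (1 - fps_X) ^ b = fps_of_poly h" "poly h 1 \<noteq> 0"
  shows "a = b"
proof -
  have "a' \<ge> b'" if "F * (1 - fps_X) ^ a' = fps_of_poly g'" "F * (1 - fps_X) ^ b' = fps_of_poly h'"
    "poly h' 1 \<noteq> 0" for a' b' g' h'
  proof (rule ccontr)
    assume "\<not> a' \<ge> b'"
    then obtain c where c: "b' = a' + Suc c" using less_imp_Suc_add[of a' b'] by auto
    have "fps_of_poly h' = fps_of_poly g' * (1 - fps_X) ^ Suc c"
      unfolding that(1)[symmetric] that(2)[symmetric] c power_add by (simp only: mult.assoc)
    also have "\<dots> = fps_of_poly (g' * [:1, -1:] ^ Suc c)"
      by (simp only: fps_of_poly_mult fps_of_poly_power fps_of_poly_1_minus_X)
    finally have "h' = g' * [:1, -1:] ^ Suc c" by (simp only: fps_of_poly_eq_iff)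
    then have "poly h' 1 = 0" by simp
    then show False using that(3) by simp
  qed
  from this[OF assms(1,3,4)] this[OF assms(3,1,2)] show ?thesis by simp
qed

lemma hs_unit_ideal: "hs X (carrier (poly_ring X) :: 'k::field mpoly set) = 0"
proof (rule fps_ext)
  fix i
  have "Deg X i \<inter> carrier (poly_ring X) = (Deg X i :: 'k mpoly set)" by (auto simp: Deg_def)
  then show "fps_nth (hs X (carrier (poly_ring X) :: 'k mpoly set)) i = fps_nth 0 i"
    by (simp add: hs_def hf_def dim_mod_def)
qed

context monomial_ordered
begin

lemma has_dim_unique:
  assumes "has_dim X J d" "hs X J * (1 - fps_X) ^ d' = fps_of_poly h" "0 < poly h 1"
  shows "d = d'"
  using assms pole_unique unfolding has_dim_def by (metis less_irrefl)

lemma multiplicity_eq: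
  fixes J :: "'k::field mpoly set"
  assumes J: "ideal J (poly_ring X)" "graded J" "1 \<notin> J"
    and h: "hs X J * (1 - fps_X) ^ d = fps_of_poly h" "0 < poly h 1"
  shows "multiplicity X J = poly h 1"
proof -
  obtain d' where d': "has_dim X J d'" "krull_dim (poly_ring X Quot J) = enat d'"
    using krull_dim_eq[OF J] by blast
  have "d' = d" using has_dim_unique[OF d'(1) h] .
  then have "multiplicity X J = (THE e. \<exists>g. fps_of_poly h = fps_of_poly g \<and> e = poly g 1)"
    by (simp add: multiplicity_def d'(2) hilbert_series_eq[OF fin J(1)] h(1))
  also have "\<dots> = poly h 1" by (rule the_equality) (auto simp: fps_of_poly_eq_iff)
  finally show ?thesis .
qed

lemma unmixed_has_dim:
  fixes I :: "'k::field mpoly set"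
  assumes "unmixed (poly_ring X) I" "graded I" "has_dim X I d"
    and P: "P \<in> associated_primes (poly_ring X) I" "graded P" "I \<subseteq> P"
  shows "has_dim X P d"
proof -
  have idI: "ideal I (poly_ring X)" using assms(1) by (simp add: unmixed_def)
  have pr: "primeideal P (poly_ring X)" using P by (simp add: associated_primes_def)
  then have idP: "ideal P (poly_ring X)" "1 \<notin> P" by (auto simp: primeideal_poly_ring_iff)
  obtain d' where d': "has_dim X I d'" "krull_dim (poly_ring X Quot I) = enat d'"
    using krull_dim_eq[OF idI assms(2)] idP(2) P(3) by blast
  obtain d'' where d'': "has_dim X P d''" "krull_dim (poly_ring X Quot P) = enat d''"
    using krull_dim_eq[OF idP(1) P(2) idP(2)] by blast
  have "d' = d''" using assms(1) P(1) d'(2) d''(2) by (auto simp: unmixed_def)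
  moreover have "d = d'" using assms(3) d'(1) has_dim_unique unfolding has_dim_def by blast
  ultimately show ?thesis using d''(1) by simp
qed

end

section \<open>The dimension of \<open>N\<close>\<close>

lemma Upto_y_coeff:
  assumes "f \<in> Upto X s"
  shows "y_coeff y k f \<in> Upto (X - {y}) s"
  unfolding Upto_def
proof (intro CollectI conjI ballI)
  show "y_coeff y k f \<in> carrier (poly_ring (X - {y}))" using Upto_carrier[OF assms] by auto
  fix m assume "m \<in> keys (y_coeff y k f)"
  then have "m + single y k \<in> keys f"
    by (auto simp: in_keys_iff lookup_y_coeff when_def split: if_splits)
  then have "total_deg (m + single y k) \<le> s" using assms by (auto simp: Upto_def)
  then show "total_deg m \<le> s" by (simp add: total_deg_add)
qed

lemma prime_power_notin:
  assumes "primeideal P (poly_ring X)" "q \<in> carrier (poly_ring X)" "q \<notin> P"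
  shows "q ^ n \<notin> P"
proof (induction n)
  case (Suc n)
  then show ?case using assms poly_ring_power[OF assms(2), of n] by (auto simp: primeideal_poly_ring_iff)
qed (use assms in \<open>simp add: primeideal_poly_ring_iff\<close>)

text \<open>If \<open>q y \<equiv> r\<close> modulo a prime \<open>P\<close> for some \<open>q \<notin> P\<close> and \<open>r\<close> without \<open>y\<close>, then multiplication by a
  power of \<open>q\<close> removes \<open>y\<close>; the polynomials without \<open>y\<close> already grow as fast modulo \<open>P\<close> as all.\<close>

lemma growth_eliminate_var:
  fixes P :: "'k::field mpoly set"
  assumes X: "finite X" and y: "y \<in> X" and P: "primeideal P (poly_ring X)"
    and q: "q \<in> carrier (poly_ring (X - {y}))" "q \<notin> P"
    and r: "r \<in> carrier (poly_ring (X - {y}))" and qr: "q * var y - r \<in> P"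
  obtains D where "\<And>s. hfa X P s \<le> dim_mod P (Upto (X - {y}) (D * s))"
proof -
  let ?X = "X - {y}"
  have id: "ideal P (poly_ring X)" using P by (rule primeideal.axioms(1))
  have qX: "q \<in> carrier (poly_ring X)" and rX: "r \<in> carrier (poly_ring X)"
    using q r poly_ring_mono[of ?X X] by auto
  obtain a where "q \<in> Upto ?X a" using Upto_exists[OF q(1)] by blast
  obtain b where "r \<in> Upto ?X b" using Upto_exists[OF r] by blast
  define e where "e = a + b"
  have e: "q \<in> Upto ?X e" "r \<in> Upto ?X e"
    using \<open>q \<in> Upto ?X a\<close> \<open>r \<in> Upto ?X b\<close> Upto_mono[of a e ?X] Upto_mono[of b e ?X]
    by (auto simp: e_def)
  have "hfa X P s \<le> dim_mod P (Upto ?X (Suc e * s))" for s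
    unfolding hfa_def
  proof (rule dim_mod_inj[where f = "\<lambda>u. q ^ s * u"])
    show "mp.subspace (Upto X s)" "mp.subspace (Upto ?X (Suc e * s))" by (rule subspace_Upto)+
    show "fin_dim (Upto X s)" "fin_dim (Upto ?X (Suc e * s))" using X by (auto intro: fin_dim_Upto)
    show "mp.subspace P" by (rule ideal_subspace[OF id])
    show "mp_linear (\<lambda>u. q ^ s * u)" by (rule mp_linear_mult)
    fix u :: "'k mpoly" assume u: "u \<in> Upto X s"
    have uX: "u \<in> carrier (poly_ring X)" using u by (rule Upto_carrier)
    show "u \<in> P" if "q ^ s * u \<in> P"
      using that prime_power_notin[OF P qX q(2), of s] P poly_ring_power[OF qX, of s] uX
      by (auto simp: primeideal_poly_ring_iff)
    define w where "w = (\<Sum>k\<le>s. y_coeff y k u * (q ^ (s - k) * r ^ k))"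
    have "w \<in> Upto ?X (Suc e * s)"
      unfolding w_def
    proof (rule mp.subspace_sum[OF subspace_Upto])
      fix k assume k: "k \<in> {..s}"
      have "q ^ (s - k) * r ^ k \<in> Upto ?X ((s - k) * e + k * e)"
        by (intro Upto_mult Upto_power e)
      moreover have "(s - k) * e + k * e = s * e" using k by (simp flip: add_mult_distrib)
      ultimately have "y_coeff y k u * (q ^ (s - k) * r ^ k) \<in> Upto ?X (s + s * e)"
        using Upto_mult[OF Upto_y_coeff[OF u]] by metis
      then show "y_coeff y k u * (q ^ (s - k) * r ^ k) \<in> Upto ?X (Suc e * s)"
        by (simp add: mult.commute)
    qed
    moreover have "q ^ s * u - w \<in> P"
    proof -
      have exp: "u = (\<Sum>k\<le>s. y_coeff y k u * var y ^ k)"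
      proof (rule y_expansion_le)
        fix k assume k: "k > s"
        have "y_coeff y k u = 0"
        proof (rule y_coeff_above, unfold y_degree_eq, rule le_less_trans[OF grade_bound_leI k])
          fix m assume "m \<in> keys u"
          then have "total_deg m \<le> s" using u by (auto simp: Upto_def)
          then show "lookup m y \<le> s"
            using member_le_sum[of y "keys m" "lookup m"]
            by (cases "y \<in> keys m") (auto simp: total_deg_def in_keys_iff)
        qed
        then show "y_coeff y k u = 0" .
      qed
      have "q ^ s * u = q ^ s * (\<Sum>k\<le>s. y_coeff y k u * var y ^ k)"
        by (rule arg_cong[OF exp])
      also have "\<dots> = (\<Sum>k\<le>s. q ^ s * (y_coeff y k u * var y ^ k))"
        by (rule sum_distrib_left)
      finally have "q ^ s * u - w
          = (\<Sum>k\<le>s. q ^ s * (y_coeff y k u * var y ^ k) - y_coeff y k u * (q ^ (s - k) * r ^ k))"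
        by (simp add: w_def sum_subtractf)
      also have "\<dots> \<in> P"
      proof (rule ideal_sum[OF id])
        fix k assume k: "k \<in> {..s}"
        have "q ^ s = q ^ (s - k) * q ^ k" using k by (simp flip: power_add)
        then have "q ^ s * (y_coeff y k u * var y ^ k) - y_coeff y k u * (q ^ (s - k) * r ^ k)
            = y_coeff y k u * q ^ (s - k) * ((q * var y) ^ k - r ^ k)"
          by (simp add: power_mult_distrib algebra_simps)
        also have "\<dots> \<in> P"
          using power_diff_ideal[OF id _ rX qr, of k] qX uX y
          by (intro ideal_mult[OF id]) auto
        finally show "q ^ s * (y_coeff y k u * var y ^ k) - y_coeff y k u * (q ^ (s - k) * r ^ k) \<in> P" .
      qed
      finally show ?thesis .
    qed
    ultimately show "\<exists>v\<in>Upto ?X (Suc e * s). q ^ s * u - v \<in> P" by blast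
  qed
  then show ?thesis by (rule that)
qed

text \<open>A polynomial without \<open>y\<close> that lies in \<open>N + (y)\<close> already lies in \<open>N\<close>.\<close>

lemma dim_mod_extended_le:
  assumes X: "finite X" and y: "y \<in> X" and N: "extended X y N"
  shows "dim_mod N (Upto (X - {y}) t) \<le> hfa X (adjoin X N (var y)) t"
  unfolding hfa_def
proof (rule dim_mod_mono)
  show "mp.subspace (adjoin X N (var y))"
    using y by (intro ideal_subspace[of _ X] ideal_adjoin extended_ideal[OF N y]) auto
  show "Upto (X - {y}) t \<inter> adjoin X N (var y) \<subseteq> N"
  proof
    fix u assume u: "u \<in> Upto (X - {y}) t \<inter> adjoin X N (var y)"
    have "y_coeff y 0 u = u" using y_coeff_free[of u X y 0] u Upto_carrier by auto
    then show "u \<in> N" using u by (simp add: extended_adjoin_var[OF N y])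
  qed
qed (use X subspace_Upto fin_dim_Upto in \<open>auto intro: subsetD[OF Upto_mono_vars[of "X - {y}" X]]\<close>)

lemma growth_rescale:
  fixes K :: real
  assumes "c > 0" and "\<And>s::nat. c * (real s + 1) ^ a \<le> K * (real (D * s) + 1) ^ b"
  shows "a \<le> b"
proof (rule power_le_imp_exponent_le[OF assms(1)])
  fix s :: nat
  have "real (D * s) + 1 \<le> (real D + 1) * (real s + 1)" by (simp add: algebra_simps)
  then have "(real (D * s) + 1) ^ b \<le> ((real D + 1) * (real s + 1)) ^ b"
    by (intro power_mono) auto
  then have "K * (real (D * s) + 1) ^ b \<le> \<bar>K\<bar> * ((real D + 1) ^ b * (real s + 1) ^ b)"
    unfolding power_mult_distrib by (intro mult_mono) auto
  then show "c * (real s + 1) ^ a \<le> \<bar>K\<bar> * (real D + 1) ^ b * (real s + 1) ^ b"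
    using assms(2)[of s] by (simp add: mult.assoc)
qed

text \<open>Some associated prime \<open>P\<close> of \<open>I\<close> does not contain \<open>q\<close>. Modulo \<open>P\<close> the variable \<open>y\<close> is the
  fraction \<open>r/q\<close>, so \<open>R/P\<close> has at most the dimension of the subring generated by the other
  variables, which is a quotient of \<open>R/(N + (y))\<close>.\<close>

lemma (in gvd) dim_le_dim_N:
  assumes X: "finite X" and gr: "graded I" and un: "unmixed (poly_ring X) I" and d: "has_dim X I d"
    and e: "growth_le X (adjoin X N (var y)) e"
    and q: "q \<in> C" "q \<in> carrier (poly_ring (X - {y}))" "homogeneous b q" "q \<notin> radical (poly_ring X) N"
  shows "d \<le> e"
proof -
  interpret monomial_ordered X ord by unfold_locales (use X ord in auto)
  have qX: "q \<in> carrier (poly_ring X)" using ideal_carr[OF ideal_C q(1)] .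
  let ?S = "range (\<lambda>n. q ^ n)"
  have "?S \<inter> I = {}"
  proof (rule ccontr)
    assume "?S \<inter> I \<noteq> {}"
    then obtain n where n: "q ^ n \<in> I" by auto
    have qn: "q ^ n \<in> carrier (poly_ring (X - {y}))" using q(2) by auto
    have "y_coeff y 0 (q ^ n) * var y ^ 0 \<in> inI"
      by (rule initial_y_ideal_mem[OF I y n]) (simp add: y_coeff_free[OF qn])
    then have "q ^ n \<in> inI" by (simp add: y_coeff_free[OF qn])
    then have "y_coeff y 0 (q ^ n) \<in> N"
      unfolding inI_eq using extended_adjoin_var[OF extended_N y] by blast
    then have "q ^ n \<in> N" by (simp add: y_coeff_free[OF qn])
    then show False using q(4) qX unfolding radical_iff by blast
  qed
  moreover have "1 \<in> ?S" by (rule image_eqI[of _ _ 0]) auto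
  moreover have "s * t \<in> ?S" if "s \<in> ?S" "t \<in> ?S" for s t
    using that by (auto simp flip: power_add)
  moreover have "\<exists>e. homogeneous e s" if "s \<in> ?S" for s
    using that homogeneous_power[OF q(3)] by blast
  moreover have "?S \<subseteq> carrier (poly_ring X)" using qX by auto
  ultimately obtain P where P: "P \<in> associated_primes (poly_ring X) I" "graded P" "I \<subseteq> P" "?S \<inter> P = {}"
    using homogeneous_associated_prime[OF I gr, of ?S] by blast
  have pr: "primeideal P (poly_ring X)" using P by (simp add: associated_primes_def)
  have "q ^ 1 \<in> ?S" by blast
  then have qP: "q \<notin> P" using P(4) by auto
  obtain r where r: "r \<in> carrier (poly_ring (X - {y}))" "q * var y - r \<in> I"
    using C_lift[OF q(1,2)] by blast
  obtain D where D: "\<And>s. hfa X P s \<le> dim_mod P (Upto (X - {y}) (D * s))"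
    using growth_eliminate_var[OF X y pr q(2) qP r(1)] r(2) P(3) by blast
  have NP: "N \<subseteq> P" using N_le_I P(3) by blast
  have le: "hfa X P s \<le> hfa X (adjoin X N (var y)) (D * s)" for s
  proof -
    have "dim_mod P (Upto (X - {y}) (D * s)) \<le> dim_mod N (Upto (X - {y}) (D * s))"
      using X NP by (intro dim_mod_mono subspace_Upto fin_dim_Upto ideal_subspace[OF ideal_N]) auto
    then show ?thesis
      using D[of s] dim_mod_extended_le[OF X y extended_N, of "D * s"] by linarith
  qed
  have "has_dim X P d" by (rule unmixed_has_dim[OF un gr d P(1-3)])
  then obtain c where c: "c > 0" "\<And>s. c * (real s + 1) ^ d \<le> real (hfa X P s)"
    by (auto simp: has_dim_def growth_ge_def)
  obtain K where K: "\<And>s. real (hfa X (adjoin X N (var y)) s) \<le> K * (real s + 1) ^ e"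
    using e by (auto simp: growth_le_def)
  show ?thesis
  proof (rule growth_rescale[OF c(1)])
    fix s
    show "c * (real s + 1) ^ d \<le> K * (real (D * s) + 1) ^ e"
      using c(2)[of s] K[of "D * s"] le[of s] by linarith
  qed
qed

section \<open>Parameters\<close>

text \<open>Going up in \<open>s + 1\<close> steps of size \<open>e\<close> from degree \<open>s\<close> collects at least \<open>s + 1\<close> times the
  dimension of \<open>R/J'\<close> up to degree \<open>s\<close>, which costs one order of growth.\<close>

lemma section_growth:
  assumes X: "finite X" and J: "ideal J (poly_ring X)" and J': "ideal J' (poly_ring X)" "J \<subseteq> J'"
    and step: "\<And>t. hfa X J' (t + e) + hfa X J t \<le> hfa X J (t + e)" and d: "growth_le X J (Suc d)"
  shows "growth_le X J' d"
proof -
  obtain K where K: "\<And>s. real (hfa X J s) \<le> K * (real s + 1) ^ Suc d"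
    using d by (auto simp: growth_le_def)
  have sum: "(\<Sum>j\<le>m. hfa X J' (s + j * e)) \<le> hfa X J (s + m * e)" for s m
  proof (induction m)
    case 0 then show ?case using hfa_antimono[OF X J J'(2)] by simp
  next
    case (Suc m)
    then show ?case using step[of "s + m * e"] by (simp add: algebra_simps)
  qed
  have "real (hfa X J' s) \<le> \<bar>K\<bar> * (real e + 1) ^ Suc d * (real s + 1) ^ d" for s
  proof -
    have "(\<Sum>j\<le>s. hfa X J' s) \<le> (\<Sum>j\<le>s. hfa X J' (s + j * e))"
      using hfa_mono[OF X J'(1)] by (intro sum_mono) auto
    then have "(s + 1) * hfa X J' s \<le> hfa X J (s + s * e)" using sum[of s s] by simp
    then have "real ((s + 1) * hfa X J' s) \<le> real (hfa X J (s + s * e))" by (simp only: of_nat_le_iff)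
    also have "\<dots> \<le> K * (real (s + s * e) + 1) ^ Suc d" by (rule K)
    also have "\<dots> \<le> \<bar>K\<bar> * ((real e + 1) * (real s + 1)) ^ Suc d"
      by (intro mult_mono power_mono) (auto simp: algebra_simps)
    also have "\<dots> = (real s + 1) * (\<bar>K\<bar> * (real e + 1) ^ Suc d * (real s + 1) ^ d)"
      by (simp only: power_mult_distrib power_Suc mult_ac)
    also have "real ((s + 1) * hfa X J' s) = (real s + 1) * real (hfa X J' s)" by (simp add: distrib_right)
    finally have "(real s + 1) * real (hfa X J' s)
        \<le> (real s + 1) * (\<bar>K\<bar> * (real e + 1) ^ Suc d * (real s + 1) ^ d)" .
    then show ?thesis by (rule mult_left_le_imp_le) simp
  qed
  then show ?thesis unfolding growth_le_def by blast
qed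

lemma prime_section_growth:
  assumes X: "finite X" and J: "primeideal J (poly_ring X)" and J': "ideal J' (poly_ring X)" "J \<subseteq> J'"
    and f: "f \<in> Upto X e" "f \<in> J'" "f \<notin> J" and d: "growth_le X J (Suc d)"
  shows "growth_le X J' d"
  using hfa_prime_step[OF X J J' f, of "t + e" for t]
  by (intro section_growth[OF X primeideal.axioms(1)[OF J] J' _ d]) simp

text \<open>The points of the moment curve in the space of linear forms: only finitely many of them lie in
  a given proper subspace, so that this one-parameter family already contains generic linear forms.\<close>

definition moment_form :: "nat set \<Rightarrow> 'k::field \<Rightarrow> 'k mpoly" where
  "moment_form X c = (\<Sum>i\<in>X. const (c ^ i) * var i)"

lemma moment_form_Deg: "moment_form X c \<in> Deg X 1"
  unfolding moment_form_def
  by (intro mp.subspace_sum[OF subspace_Deg] mp.subspace_scale[OF subspace_Deg])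
    (auto simp: Deg_def intro: homogeneous_var[unfolded One_nat_def])

text \<open>Along the moment curve some coordinate modulo \<open>J\<close> is a polynomial in \<open>c\<close> whose coefficient for
  \<open>x\<close> does not vanish; it has finitely many roots.\<close>

lemma moment_form_finite:
  fixes J :: "'k::field mpoly set"
  assumes X: "finite X" and J: "mp.subspace J" and x: "x \<in> X" "var x \<notin> J"
  shows "finite {c. moment_form X c \<in> J}"
proof -
  obtain p where p: "mp_linear p" "\<And>x. p x = 0 \<longleftrightarrow> x \<in> J"
    using linear_with_kernel[OF J] by blast
  have "p (var x) \<noteq> 0" using x p(2) by blast
  then obtain m where m: "lookup (p (var x)) m \<noteq> 0"
    by (metis lookup_zero poly_mapping_eqI)
  define F where "F = (\<Sum>i\<in>X. Polynomial.monom (lookup (p (var i)) m) i)"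
  have "coeff F x = lookup (p (var x)) m"
    using X x by (simp add: F_def coeff_sum sum.delta')
  then have "F \<noteq> 0" using m by auto
  have "poly F c = lookup (p (moment_form X c)) m" for c
  proof -
    have "p (moment_form X c) = (\<Sum>i\<in>X. const (c ^ i) * p (var i))"
      using X unfolding moment_form_def
      by (induction X) (simp_all add: mp_linearD[OF p(1)])
    then have "lookup (p (moment_form X c)) m = (\<Sum>i\<in>X. c ^ i * lookup (p (var i)) m)"
      by (simp only: lookup_sum lookup_const_mult)
    also have "\<dots> = poly F c" by (simp add: F_def poly_sum poly_monom mult.commute)
    finally show ?thesis by simp
  qed
  moreover have "lookup (p f) m = 0" if "f \<in> J" for f
    using that p(2)[of f] by (metis lookup_zero)
  ultimately have "{c. moment_form X c \<in> J} \<subseteq> {c. poly F c = 0}" by auto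
  then show ?thesis using poly_roots_finite[OF \<open>F \<noteq> 0\<close>] finite_subset by blast
qed

context monomial_ordered
begin

text \<open>A linear form outside a prime lowers the dimension, and a prime that misses a variable
  contains only finitely many members of the family. The general case is reduced to primes by the
  decomposition into \<open>J : a\<close> and \<open>J + (a)\<close>, as for the Hilbert series.\<close>

lemma generic_linear_form:
  fixes J :: "'k::field mpoly set"
  assumes "ideal J (poly_ring X)" "graded J" "growth_le X J (Suc d)"
  shows "finite {c. \<not> growth_le X (adjoin X J (moment_form X c)) d}"
  using assms
proof (induction J rule: noetherian_induct)
  case (step J)
  have lc: "moment_form X c \<in> carrier (poly_ring X)" and lh: "homogeneous 1 (moment_form X c)" for c :: 'k
    using moment_form_Deg[of X c] by (auto simp: Deg_def)
  have small: ?case if "growth_le X J d"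
    using growth_le_antimono[OF fin step(1) adjoin_incl that] by simp
  show ?case
  proof (cases "1 \<in> J")
    case True
    then have "J = carrier (poly_ring X)" using ideal_proper_iff[OF step(1)] by blast
    then have "hfa X J s = 0" for s
      by (simp add: hfa_def dim_mod_def Int_absorb2 subsetI Upto_carrier)
    then show ?thesis by (intro small) (auto simp: growth_le_def intro: exI[of _ 0])
  next
    case ne: False
    show ?thesis
    proof (cases "primeideal J (poly_ring X)")
      case prime: True
      show ?thesis
      proof (cases "\<forall>x\<in>X. var x \<in> J")
        case True
        then have "has_dim X J 0" using has_dim_maximal[OF fin step(1) ne] by blast
        then show ?thesis by (intro small growth_le_mono[of X J 0 d]) (auto simp: has_dim_def)
      next
        case False
        then obtain x where x: "x \<in> X" "var x \<notin> J" by blast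
        have "growth_le X (adjoin X J (moment_form X c)) d" if "moment_form X c \<notin> J" for c
          using prime_section_growth[OF fin prime ideal_adjoin[OF step(1) lc] adjoin_incl _
              adjoin_mem[OF step(1)] that step(4)] moment_form_Deg Deg_Upto by blast
        then have "{c. \<not> growth_le X (adjoin X J (moment_form X c)) d} \<subseteq> {c. moment_form X c \<in> J}"
          by blast
        then show ?thesis
          using moment_form_finite[OF fin ideal_subspace[OF step(1)] x] finite_subset by blast
      qed
    next
      case False
      then obtain a e where a: "a \<in> carrier (poly_ring X)" "homogeneous e a"
        and sub: "J \<subset> colon X J a" "J \<subset> adjoin X J a"
        using not_graded_primeE[OF step(1,3) ne] by metis
      let ?F = "\<lambda>J. {c. \<not> growth_le X (adjoin X J (moment_form X c)) d}"
      have F1: "finite (?F (colon X J a))"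
        using step(2)[OF ideal_colon[OF step(1)] sub(1) graded_colon[OF step(1,3) a(2)]]
          growth_le_antimono[OF fin step(1) _ step(4)] sub(1) by blast
      have F2: "finite (?F (adjoin X J a))"
        using step(2)[OF ideal_adjoin[OF step(1) a(1)] sub(2) graded_adjoin[OF step(1,3) a(2)]]
          growth_le_antimono[OF fin step(1) _ step(4)] sub(2) by blast
      have "growth_le X (adjoin X J (moment_form X c)) d"
        if "c \<notin> ?F (colon X J a)" "c \<notin> ?F (adjoin X J a)" for c
      proof (rule growth_le_split[OF fin _ _ a])
        let ?l = "moment_form X c"
        have idl: "ideal (adjoin X J ?l) (poly_ring X)" by (rule ideal_adjoin[OF step(1) lc])
        show "ideal (adjoin X J ?l) (poly_ring X)" by fact
        show "graded (adjoin X J ?l)" by (rule graded_adjoin[OF step(1,3) lh])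
        show "growth_le X (adjoin X (adjoin X J ?l) a) d"
        proof (rule growth_le_antimono[OF fin _ _])
          show "growth_le X (adjoin X (adjoin X J a) ?l) d" using that by simp
          show "ideal (adjoin X (adjoin X J a) ?l) (poly_ring X)"
            by (rule ideal_adjoin[OF ideal_adjoin[OF step(1) a(1)] lc])
          show "adjoin X (adjoin X J a) ?l \<subseteq> adjoin X (adjoin X J ?l) a"
            by (rule adjoin_least[OF ideal_adjoin[OF idl a(1)] adjoin_mono[OF adjoin_incl]
                  subsetD[OF adjoin_incl adjoin_mem[OF step(1)]]])
        qed
        show "growth_le X (colon X (adjoin X J ?l) a) d"
        proof (rule growth_le_antimono[OF fin _ _])
          show "growth_le X (adjoin X (colon X J a) ?l) d" using that by simp
          show "ideal (adjoin X (colon X J a) ?l) (poly_ring X)"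
            by (rule ideal_adjoin[OF ideal_colon[OF step(1)] lc])
          show "adjoin X (colon X J a) ?l \<subseteq> colon X (adjoin X J ?l) a"
            by (rule adjoin_least[OF ideal_colon[OF idl] colon_mono[OF adjoin_incl]
                  subsetD[OF colon_incl[OF idl a(1)] adjoin_mem[OF step(1)]]])
        qed
      qed
      then have "?F J \<subseteq> ?F (colon X J a) \<union> ?F (adjoin X J a)" by blast
      then show ?thesis using F1 F2 finite_subset by blast
    qed
  qed
qed

text \<open>A bounded sum of natural numbers has finitely many nonzero terms.\<close>

lemma growth_0_imp:
  fixes J :: "'k::field mpoly set"
  assumes J: "ideal J (poly_ring X)" "graded J" and g: "growth_le X J 0"
  shows "\<exists>k. \<forall>s\<ge>k. Deg X s \<subseteq> J"
proof -
  obtain K where K: "\<And>s. real (hfa X J s) \<le> K" using g by (auto simp: growth_le_def)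
  have "finite {s. hf X J s \<noteq> 0}"
  proof (rule ccontr)
    assume "infinite {s. hf X J s \<noteq> 0}"
    then obtain A where A: "finite A" "card A = Suc (nat \<lceil>K\<rceil>)" "A \<subseteq> {s. hf X J s \<noteq> 0}"
      using infinite_arbitrarily_large by blast
    have "card A = (\<Sum>s\<in>A. 1)" by simp
    also have "\<dots> \<le> (\<Sum>s\<in>A. hf X J s)" using A(3) by (intro sum_mono) (auto simp: Suc_le_eq)
    also have "\<dots> \<le> (\<Sum>s\<le>Max A. hf X J s)" using A(1) by (intro sum_mono2) auto
    also have "\<dots> = hfa X J (Max A)" by (simp add: hfa_sum[OF fin J])
    finally have "real (card A) \<le> K" using K[of "Max A"] by linarith
    then show False using A(2) by linarith
  qed
  then obtain k where k: "\<And>s. hf X J s \<noteq> 0 \<Longrightarrow> s < k"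
    unfolding finite_nat_set_iff_bounded by auto
  have "Deg X s \<subseteq> J" if "s \<ge> k" for s using hf_0_imp[OF fin J(1), of s] k[of s] that by fastforce
  then show ?thesis by blast
qed

text \<open>This is graded Noether normalisation: one generic linear form for each dimension.\<close>

lemma parameters:
  fixes J :: "'k::{field, ring_char_0} mpoly set"
  assumes "ideal J (poly_ring X)" "graded J" "growth_le X J d"
  shows "\<exists>ls k. length ls = d \<and> set ls \<subseteq> Deg X 1 \<and> (\<forall>s\<ge>k. Deg X s \<subseteq> foldl (adjoin X) J ls)"
  using assms
proof (induction d arbitrary: J)
  case 0
  then show ?case using growth_0_imp[of J] by (intro exI[of _ "[]"]) simp
next
  case (Suc d)
  obtain c where c: "growth_le X (adjoin X J (moment_form X c)) d"
    using generic_linear_form[OF Suc.prems] infinite_UNIV_char_0 by (metis (mono_tags, lifting) UNIV_eq_I mem_Collect_eq)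
  have l: "moment_form X c \<in> carrier (poly_ring X)" "homogeneous 1 (moment_form X c)"
    using moment_form_Deg[of X c] by (auto simp: Deg_def)
  obtain ls k where "length ls = d" "set ls \<subseteq> Deg X 1"
    "\<forall>s\<ge>k. Deg X s \<subseteq> foldl (adjoin X) (adjoin X J (moment_form X c)) ls"
    using Suc.IH[OF ideal_adjoin[OF Suc.prems(1) l(1)] graded_adjoin[OF Suc.prems(1,2) l(2)] c] by blast
  then show ?case
    using moment_form_Deg[of X c] by (intro exI[of _ "moment_form X c # ls"] exI[of _ k]) simp
qed

end

section \<open>Subalgebras generated by parameters\<close>

text \<open>The span of the monomials in the list in which every exponent is at most \<open>s\<close>. Bounding the
  exponents one by one, not their sum, makes the recursion over the list keep \<open>s\<close> fixed.\<close>

fun box_span :: "'k::field mpoly list \<Rightarrow> nat \<Rightarrow> 'k mpoly set" where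
  "box_span [] s = range const"
| "box_span (l # ls) s = {\<Sum>i\<le>s. l ^ i * a i |a. \<forall>i\<le>s. a i \<in> box_span ls s}"

lemma box_subspace: "mp.subspace (box_span ls s)"
proof (induction ls)
  case Nil
  show ?case
  proof (rule mp_subspaceI)
    show "0 \<in> box_span [] s" using const_simps(1) by (metis box_span.simps(1) rangeI)
    show "x + y \<in> box_span [] s" if "x \<in> box_span [] s" "y \<in> box_span [] s" for x y :: "'a mpoly"
      using that by (auto simp flip: const_simps(3))
    show "const c * x \<in> box_span [] s" if "x \<in> box_span [] s" for c and x :: "'a mpoly"
      using that by (auto simp flip: const_simps(4))
  qed
next
  case (Cons l ls)
  show ?case
  proof (rule mp_subspaceI)
    show "0 \<in> box_span (l # ls) s"
      using mp.subspace_0[OF Cons] by (auto intro!: exI[of _ "\<lambda>_. 0"])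
    fix x y assume "x \<in> box_span (l # ls) s" "y \<in> box_span (l # ls) s"
    then obtain a b where "x = (\<Sum>i\<le>s. l ^ i * a i)" "\<forall>i\<le>s. a i \<in> box_span ls s"
      "y = (\<Sum>i\<le>s. l ^ i * b i)" "\<forall>i\<le>s. b i \<in> box_span ls s" by auto
    then show "x + y \<in> box_span (l # ls) s"
      using mp.subspace_add[OF Cons]
      by (auto intro!: exI[of _ "\<lambda>i. a i + b i"] simp: sum.distrib distrib_left)
  next
    fix c x assume "x \<in> box_span (l # ls) s"
    then obtain a where "x = (\<Sum>i\<le>s. l ^ i * a i)" "\<forall>i\<le>s. a i \<in> box_span ls s" by auto
    then show "const c * x \<in> box_span (l # ls) s"
      using mp.subspace_scale[OF Cons]
      by (auto intro!: exI[of _ "\<lambda>i. const c * a i"] simp: sum_distrib_left mult.left_commute)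
  qed
qed

lemma box_power_mem:
  assumes "k \<le> s" "x \<in> box_span ls s"
  shows "l ^ k * x \<in> box_span (l # ls) s"
proof -
  have "l ^ k * x = (\<Sum>i\<le>s. l ^ i * (if i = k then x else 0))"
    using assms(1) by (simp add: if_distrib[of "\<lambda>z. _ * z"] sum.delta' cong: if_cong)
  moreover have "\<forall>i\<le>s. (if i = k then x else 0) \<in> box_span ls s"
    using assms(2) mp.subspace_0[OF box_subspace] by auto
  ultimately show ?thesis
    unfolding box_span.simps mem_Collect_eq
    by (intro exI[of _ "\<lambda>i. if i = k then x else 0"] conjI)
qed

lemma box_Cons_mem:
  assumes "x \<in> box_span ls s"
  shows "x \<in> box_span (l # ls) s"
  using box_power_mem[of 0 s x ls l] assms by simp

lemma box_mono: "s \<le> t \<Longrightarrow> x \<in> box_span ls s \<Longrightarrow> x \<in> box_span ls t"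
proof (induction ls arbitrary: x)
  case (Cons l ls)
  obtain a where a: "x = (\<Sum>i\<le>s. l ^ i * a i)" "\<forall>i\<le>s. a i \<in> box_span ls s"
    using Cons.prems(2) by auto
  show ?case
    unfolding a(1) using a(2) Cons by (intro mp.subspace_sum[OF box_subspace] box_power_mem) auto
qed simp

lemma box_mult: "x \<in> box_span ls s \<Longrightarrow> z \<in> box_span ls t \<Longrightarrow> x * z \<in> box_span ls (s + t)"
proof (induction ls arbitrary: x z)
  case Nil
  then show ?case by (auto simp flip: const_simps(4))
next
  case (Cons l ls)
  obtain a where a: "x = (\<Sum>i\<le>s. l ^ i * a i)" "\<forall>i\<le>s. a i \<in> box_span ls s"
    using Cons.prems(1) by auto
  obtain b where b: "z = (\<Sum>i\<le>t. l ^ i * b i)" "\<forall>i\<le>t. b i \<in> box_span ls t"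
    using Cons.prems(2) by auto
  have "x * z = (\<Sum>i\<le>s. \<Sum>j\<le>t. l ^ (i + j) * (a i * b j))"
    by (simp add: a(1) b(1) sum_product power_add mult_ac)
  also have "\<dots> \<in> box_span (l # ls) (s + t)"
    using a(2) b(2) Cons.IH by (intro mp.subspace_sum[OF box_subspace] box_power_mem) auto
  finally show ?case .
qed

lemma box_const: "const c \<in> box_span ls s"
  by (induction ls) (auto intro: box_Cons_mem simp del: box_span.simps(2))

lemma box_1: "1 \<in> box_span ls s"
  using box_const[of 1] by simp

lemma box_power: "x \<in> box_span ls s \<Longrightarrow> x ^ n \<in> box_span ls (n * s)"
  by (induction n) (auto intro: box_1 box_mult)

lemma box_generator: "l \<in> set ls \<Longrightarrow> l \<in> box_span ls 1"
proof (induction ls)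
  case (Cons a ls)
  show ?case
  proof (cases "l = a")
    case True
    then show ?thesis using box_power_mem[OF order_refl box_1, of a 1 ls] by (simp del: box_span.simps)
  next
    case False
    then show ?thesis using Cons by (auto intro: box_Cons_mem simp del: box_span.simps(2))
  qed
qed simp

lemma box_Upto:
  assumes "set ls \<subseteq> Upto Y b"
  shows "box_span ls s \<subseteq> Upto Y (length ls * (s * b))"
  using assms
proof (induction ls)
  case Nil
  have "const c \<in> Upto Y 0" for c
    using Deg_Upto[of Y 0] by (auto simp: Deg_def)
  then show ?case by auto
next
  case (Cons l ls)
  show ?case
  proof
    fix x assume "x \<in> box_span (l # ls) s"
    then obtain a where a: "x = (\<Sum>i\<le>s. l ^ i * a i)" "\<forall>i\<le>s. a i \<in> box_span ls s" by auto
    show "x \<in> Upto Y (length (l # ls) * (s * b))"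
      unfolding a(1)
    proof (rule mp.subspace_sum[OF subspace_Upto])
      fix i assume i: "i \<in> {..s}"
      have "l ^ i * a i \<in> Upto Y (i * b + length ls * (s * b))"
        using Cons a(2) i by (intro Upto_mult Upto_power) auto
      moreover have "i * b + length ls * (s * b) \<le> length (l # ls) * (s * b)"
        using i by simp
      ultimately show "l ^ i * a i \<in> Upto Y (length (l # ls) * (s * b))"
        using Upto_mono by blast
    qed
  qed
qed

lemma list_Upto_exists: "set ls \<subseteq> carrier (poly_ring Y) \<Longrightarrow> \<exists>b. set ls \<subseteq> Upto Y b"
proof (induction ls)
  case (Cons l ls)
  then obtain b where b: "set ls \<subseteq> Upto Y b" by auto
  obtain b' where "l \<in> Upto Y b'" using Upto_exists[of l Y] Cons.prems by auto
  then show ?case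
    using b Upto_mono[of b "max b b'" Y] Upto_mono[of b' "max b b'" Y]
    by (intro exI[of _ "max b b'"]) auto
qed simp

lemma box_carrier: "set ls \<subseteq> carrier (poly_ring Y) \<Longrightarrow> box_span ls s \<subseteq> carrier (poly_ring Y)"
  using list_Upto_exists[of ls Y] box_Upto[of ls Y _ s] Upto_carrier by blast

lemma fin_dim_box:
  assumes "finite Y" "set ls \<subseteq> carrier (poly_ring Y)"
  shows "fin_dim (box_span ls s)"
  using list_Upto_exists[OF assms(2)] box_Upto[of ls Y _ s] fin_dim_subset[OF fin_dim_Upto[OF assms(1)]]
  by blast

lemma dim_box_Cons:
  fixes P :: "'k::field mpoly set"
  assumes X: "finite X" and P: "ideal P (poly_ring X)" and ls: "set (l # ls) \<subseteq> carrier (poly_ring X)"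
  shows "dim_mod P (box_span (l # ls) s) \<le> (s + 1) * dim_mod P (box_span ls s)"
proof -
  have "dim_mod P (box_span (l # ls) s) \<le> card {..s} * dim_mod P (box_span ls s)"
  proof (rule dim_mod_cover[where u = "\<lambda>i. l ^ i"])
    show "l ^ i * x \<in> P" if "x \<in> P" for i x using that ls by (intro ideal_mult[OF P]) auto
    show "\<exists>w. (\<forall>i\<in>{..s}. w i \<in> box_span ls s) \<and> v - (\<Sum>i\<le>s. l ^ i * w i) \<in> P"
      if "v \<in> box_span (l # ls) s" for v
      using that ideal_0[OF P] by auto
    show "fin_dim (box_span (l # ls) s)" by (rule fin_dim_box[OF X ls])
    show "fin_dim (box_span ls s)" by (rule fin_dim_box[OF X]) (use ls in simp)
  qed (auto intro: box_subspace ideal_subspace[OF P] simp del: box_span.simps)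
  then show ?thesis by simp
qed

lemma dim_box_le:
  fixes P :: "'k::field mpoly set"
  assumes X: "finite X" and P: "ideal P (poly_ring X)" and ls: "set ls \<subseteq> carrier (poly_ring X)"
  shows "dim_mod P (box_span ls s) \<le> (s + 1) ^ length ls"
  using ls
proof (induction ls)
  case Nil
  have "dim_mod P (box_span [] s) \<le> card {1 :: 'k mpoly}"
  proof (rule dim_mod_le_card[OF box_subspace fin_dim_box[OF X] ideal_subspace[OF P]])
    fix v :: "'k mpoly" assume "v \<in> box_span [] s"
    then obtain a where "v = const a" by auto
    then show "\<exists>x\<in>mp.span {1}. v - x \<in> P"
      using const_in_span[of a] ideal_0[OF P] by (intro bexI[of _ v]) auto
  qed auto
  then show ?case by simp
next
  case (Cons l ls)
  have "dim_mod P (box_span (l # ls) s) \<le> (s + 1) * dim_mod P (box_span ls s)"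
    by (rule dim_box_Cons[OF X P Cons.prems])
  also have "\<dots> \<le> (s + 1) * (s + 1) ^ length ls" using Cons by (intro mult_le_mono) auto
  finally show ?case by simp
qed

lemma foldl_adjoin_mem:
  assumes "f \<in> foldl (adjoin X) J ls"
  shows "\<exists>g\<in>J. \<exists>r. (\<forall>i. r i \<in> carrier (poly_ring X)) \<and> f = g + (\<Sum>i<length ls. r i * ls ! i)"
  using assms
proof (induction ls arbitrary: J)
  case Nil
  then show ?case by (intro bexI[of _ f] exI[of _ "\<lambda>_. 0"]) auto
next
  case (Cons l ls)
  obtain g r where g: "g \<in> adjoin X J l" "\<forall>i. r i \<in> carrier (poly_ring X)"
    "f = g + (\<Sum>i<length ls. r i * ls ! i)"
    using Cons.IH[of "adjoin X J l"] Cons.prems by auto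
  obtain g' r0 where g': "g = g' + r0 * l" "g' \<in> J" "r0 \<in> carrier (poly_ring X)"
    using g(1) by (auto simp: adjoin_def)
  show ?case
  proof (intro bexI[of _ g'] exI[of _ "case_nat r0 r"] conjI allI)
    show "case_nat r0 r i \<in> carrier (poly_ring X)" for i using g g' by (cases i) auto
    show "f = g' + (\<Sum>i<length (l # ls). case_nat r0 r i * (l # ls) ! i)"
      by (simp add: g(3) g'(1) sum.lessThan_Suc_shift del: sum.lessThan_Suc)
  qed (rule g'(2))
qed

section \<open>A finite extension\<close>

text \<open>For a finite set \<open>E\<close> this is the \<open>W\<close>-module generated by \<open>E\<close>, modulo \<open>P\<close>.\<close>

definition covered :: "'k::field mpoly set \<Rightarrow> 'k mpoly set \<Rightarrow> 'k mpoly set \<Rightarrow> 'k mpoly set" where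
  "covered P E W = {a. \<exists>w. (\<forall>e\<in>E. w e \<in> W) \<and> a - (\<Sum>e\<in>E. e * w e) \<in> P}"

lemma covered_add:
  assumes "mp.subspace P" "mp.subspace W" "a \<in> covered P E W" "b \<in> covered P E W"
  shows "a + b \<in> covered P E W"
proof -
  obtain w z where w: "\<forall>e\<in>E. w e \<in> W" "a - (\<Sum>e\<in>E. e * w e) \<in> P"
    and z: "\<forall>e\<in>E. z e \<in> W" "b - (\<Sum>e\<in>E. e * z e) \<in> P"
    using assms(3,4) by (auto simp: covered_def)
  have "(a - (\<Sum>e\<in>E. e * w e)) + (b - (\<Sum>e\<in>E. e * z e)) \<in> P"
    using mp.subspace_add[OF assms(1) w(2) z(2)] .
  then have "a + b - (\<Sum>e\<in>E. e * (w e + z e)) \<in> P"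
    by (simp add: sum.distrib distrib_left algebra_simps)
  then show ?thesis
    unfolding covered_def using w(1) z(1) mp.subspace_add[OF assms(2)]
    by (intro CollectI exI[of _ "\<lambda>e. w e + z e"]) auto
qed

lemma covered_P:
  assumes "mp.subspace P" "mp.subspace W" "a \<in> P"
  shows "a \<in> covered P E W"
  unfolding covered_def using assms mp.subspace_0[OF assms(2)]
  by (intro CollectI exI[of _ "\<lambda>_. 0"]) auto

lemma covered_sum:
  assumes "mp.subspace P" "mp.subspace W" "\<And>i. i \<in> F \<Longrightarrow> a i \<in> covered P E W"
  shows "(\<Sum>i\<in>F. a i) \<in> covered P E W"
  using assms(3)
  by (induction F rule: infinite_finite_induct)
    (auto intro: covered_add[OF assms(1,2)] covered_P[OF assms(1,2)] mp.subspace_0[OF assms(1)])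

lemma covered_mono: "W \<subseteq> W' \<Longrightarrow> covered P E W \<subseteq> covered P E W'"
  unfolding covered_def by blast

lemma covered_mult:
  assumes P: "ideal P (poly_ring X)" and l: "l \<in> carrier (poly_ring X)"
    and W: "\<And>x. x \<in> W \<Longrightarrow> l * x \<in> W'" and a: "a \<in> covered P E W"
  shows "l * a \<in> covered P E W'"
proof -
  obtain w where w: "\<forall>e\<in>E. w e \<in> W" "a - (\<Sum>e\<in>E. e * w e) \<in> P"
    using a by (auto simp: covered_def)
  have "l * (a - (\<Sum>e\<in>E. e * w e)) \<in> P" by (rule ideal_mult[OF P l w(2)])
  moreover have "l * (a - (\<Sum>e\<in>E. e * w e)) = l * a - (\<Sum>e\<in>E. e * (l * w e))"
    by (simp add: right_diff_distrib sum_distrib_left mult.left_commute)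
  ultimately show ?thesis
    unfolding covered_def using w(1) W by (intro CollectI exI[of _ "\<lambda>e. l * w e"]) auto
qed

lemma covered_generator:
  assumes "mp.subspace P" "mp.subspace W" "finite E" "e \<in> E" "x \<in> W"
  shows "e * x \<in> covered P E W"
proof -
  have "(\<Sum>e'\<in>E. e' * (if e' = e then x else 0)) = e * x"
    using assms(3,4) by (simp add: if_distrib[of "\<lambda>z. _ * z"] sum.delta' cong: if_cong)
  then show ?thesis
    unfolding covered_def using assms(5) mp.subspace_0[OF assms(1)] mp.subspace_0[OF assms(2)]
    by (intro CollectI exI[of _ "\<lambda>e'. if e' = e then x else 0"]) auto
qed

lemma y_coeff_0_mult: "y_coeff y 0 (f * g) = y_coeff y 0 f * y_coeff y 0 g"
  by (simp add: y_coeff_mult)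

text \<open>Graded Nakayama lemma: above degree \<open>k\<close> an element is a combination of the parameters, whose
  coefficients have smaller degree and are covered by induction. Working with the preimage \<open>Q\<close> of
  \<open>P\<close> under the substitution \<open>y = 0\<close> allows the parameters to be chosen in the full polynomial ring.\<close>

lemma parameters_cover:
  fixes P :: "'k::field mpoly set"
  assumes X: "finite X" and y: "y \<in> X" and P: "ideal P (poly_ring X)" "graded P"
    and v: "v \<in> Deg (X - {y}) b" "b \<ge> 1" and ls: "set ls \<subseteq> Deg X 1"
    and Q: "Q = {f \<in> carrier (poly_ring X). y_coeff y 0 f \<in> P}"
    and k: "\<And>s. s \<ge> k \<Longrightarrow> Deg X s \<subseteq> foldl (adjoin X) (adjoin X Q v) ls"
    and E: "E = (\<lambda>m. single m 1) ` {m \<in> monoms (X - {y}). total_deg m \<le> k}"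
    and L: "L = v # map (y_coeff y 0) ls"
  shows "Upto (X - {y}) s \<subseteq> covered P E (box_span L s)"
proof -
  let ?X = "X - {y}"
  have fE: "finite E" unfolding E using X by (intro finite_imageI finite_monoms) auto
  have subP: "mp.subspace P" by (rule ideal_subspace[OF P(1)])
  note cov_add = covered_add[OF subP box_subspace] and cov_sum = covered_sum[OF subP box_subspace]
    and cov_P = covered_P[OF subP box_subspace]
  have cov_mono: "covered P E (box_span L s) \<subseteq> covered P E (box_span L t)" if "s \<le> t" for s t
    using box_mono[OF that] by (intro covered_mono) blast
  have Xsub: "carrier (poly_ring ?X) \<subseteq> (carrier (poly_ring X) :: 'k mpoly set)"
    by (rule poly_ring_mono) auto
  have LX: "set L \<subseteq> carrier (poly_ring X)"
    unfolding L using v ls Xsub by (auto simp: Deg_def)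
  have cov_mult: "l * a \<in> covered P E (box_span L (Suc s))"
    if "l \<in> set L" "a \<in> covered P E (box_span L s)" for l a s
  proof (rule covered_mult[OF P(1) _ _ that(2)])
    show "l \<in> carrier (poly_ring X)" using that(1) LX by auto
    show "l * x \<in> box_span L (Suc s)" if "x \<in> box_span L s" for x
      using box_mult[OF box_generator[OF \<open>l \<in> set L\<close>] that] by simp
  qed
  have y0: "y_coeff y 0 f = f" if "f \<in> carrier (poly_ring ?X)" for f :: "'k mpoly"
    using y_coeff_free[OF that, of 0] by simp
  have hom_free: "hcomp i (y_coeff y 0 f) \<in> Deg ?X i" if "f \<in> carrier (poly_ring X)" for i and f :: "'k mpoly"
    using that by (intro hcomp_Deg) auto
  have deg: "Deg ?X s \<subseteq> covered P E (box_span L s)" for s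
  proof (induction s rule: less_induct)
    case (less s)
    show ?case
    proof
      fix a :: "'k mpoly" assume a: "a \<in> Deg ?X s"
      show "a \<in> covered P E (box_span L s)"
      proof (cases "s \<le> k")
        case True
        have "(\<Sum>m\<in>keys a. single m (lookup a m)) \<in> covered P E (box_span L s)"
        proof (rule cov_sum)
          fix m assume m: "m \<in> keys a"
          have "single m 1 * const (lookup a m) \<in> covered P E (box_span L s)"
          proof (rule covered_generator[OF subP box_subspace fE])
            show "single m 1 \<in> E"
              unfolding E using m a True by (auto simp: Deg_def in_poly_ring homogeneous_def)
          qed (rule box_const)
          then show "single m (lookup a m) \<in> covered P E (box_span L s)"
            by (simp add: const_def mult_single)
        qed
        then show ?thesis using poly_mapping_sum_single[of a] by simp
      next
        case False
        have "a \<in> Deg X s" using a Xsub by (auto simp: Deg_def)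
        then obtain g r where g: "g \<in> adjoin X Q v" "\<And>i. r i \<in> carrier (poly_ring X)"
          "a = g + (\<Sum>i<length ls. r i * ls ! i)"
          using foldl_adjoin_mem[of a X "adjoin X Q v" ls] k[of s] False by auto
        obtain g' r0 where g': "g = g' + r0 * v" "g' \<in> Q" "r0 \<in> carrier (poly_ring X)"
          using g(1) by (auto simp: adjoin_def)
        have "a = hcomp s (y_coeff y 0 a)"
          using y0[of a] a hcomp_homogeneous[OF Deg_homogeneous[OF a], of s] by (simp add: Deg_def)
        also have "y_coeff y 0 a = y_coeff y 0 g' + v * y_coeff y 0 r0
            + (\<Sum>i<length ls. y_coeff y 0 (ls ! i) * y_coeff y 0 (r i))"
          unfolding g(3) g'(1) using y0[of v] v(1)
          by (simp add: y_coeff_add y_coeff_sum y_coeff_0_mult Deg_def mult.commute)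
        also have "hcomp s \<dots> = hcomp s (y_coeff y 0 g') + hcomp s (v * y_coeff y 0 r0)
            + (\<Sum>i<length ls. hcomp s (y_coeff y 0 (ls ! i) * y_coeff y 0 (r i)))"
          by (simp add: part_add part_sum)
        also have "\<dots> \<in> covered P E (box_span L s)"
        proof (intro cov_add cov_sum)
          show "hcomp s (y_coeff y 0 g') \<in> covered P E (box_span L s)"
            using g'(2) gradedD[OF P(2)] Q by (intro cov_P) auto
          show "hcomp s (v * y_coeff y 0 r0) \<in> covered P E (box_span L s)"
          proof (cases "b \<le> s")
            case True
            then have "hcomp (s - b) (y_coeff y 0 r0) \<in> covered P E (box_span L (s - b))"
              using less[of "s - b"] hom_free[OF g'(3), of "s - b"] v(2) by auto
            then have "v * hcomp (s - b) (y_coeff y 0 r0) \<in> covered P E (box_span L (Suc (s - b)))"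
              by (intro cov_mult) (auto simp: L)
            moreover have "Suc (s - b) \<le> s" using True v(2) by linarith
            ultimately show ?thesis
              using cov_mono hcomp_homogeneous_mult[OF Deg_homogeneous[OF v(1)], of s] True by auto
          next
            case False
            then show ?thesis
              using hcomp_homogeneous_mult[OF Deg_homogeneous[OF v(1)], of s] ideal_0[OF P(1)]
              by (auto intro: cov_P)
          qed
        next
          fix i assume i: "i \<in> {..<length ls}"
          let ?l = "y_coeff y 0 (ls ! i)"
          have s: "1 \<le> s" using False by simp
          have l1: "ls ! i \<in> Deg X 1" using ls i by auto
          have "hcomp 1 (y_coeff y 0 (ls ! i)) = y_coeff y 0 (hcomp 1 (ls ! i))"
            using y_coeff_hcomp[of 1 y 0 "ls ! i"] by simp
          then have hl: "homogeneous 1 ?l"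
            using Deg_homogeneous[OF l1] by (simp add: homogeneous_iff)
          have "hcomp (s - 1) (y_coeff y 0 (r i)) \<in> covered P E (box_span L (s - 1))"
            using less[of "s - 1"] hom_free[OF g(2), of "s - 1" i] s by auto
          then have "?l * hcomp (s - 1) (y_coeff y 0 (r i)) \<in> covered P E (box_span L (Suc (s - 1)))"
            using i by (intro cov_mult) (auto simp: L)
          then show "hcomp s (?l * y_coeff y 0 (r i)) \<in> covered P E (box_span L s)"
            using hcomp_homogeneous_mult[OF hl, of s] s by simp
        qed
        finally show ?thesis .
      qed
    qed
  qed
  show ?thesis
  proof
    fix a :: "'k mpoly" assume a: "a \<in> Upto ?X s"
    have "(\<Sum>i\<le>s. hcomp i a) \<in> covered P E (box_span L s)"
      using deg cov_mono hcomp_Deg[OF Upto_carrier[OF a]] by (intro cov_sum) blast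
    then show "a \<in> covered P E (box_span L s)" using Upto_sum_hcomp[OF a] by simp
  qed
qed

lemma dim_covered:
  fixes P :: "'k::field mpoly set"
  assumes V: "mp.subspace V" "fin_dim V" and W: "mp.subspace W" "fin_dim W"
    and P: "ideal P (poly_ring X)" and E: "finite E" "E \<subseteq> carrier (poly_ring X)"
    and cov: "V \<subseteq> covered P E W"
  shows "dim_mod P V \<le> card E * dim_mod P W"
proof (rule dim_mod_cover[where u = "\<lambda>e. e", OF V W ideal_subspace[OF P] E(1)])
  show "e * x \<in> P" if "e \<in> E" "x \<in> P" for e x
    using that E(2) by (intro ideal_mult[OF P]) auto
  show "\<exists>w. (\<forall>i\<in>E. w i \<in> W) \<and> v - (\<Sum>i\<in>E. i * w i) \<in> P" if "v \<in> V" for v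
    using that cov unfolding covered_def by blast
qed

text \<open>The ring generated by the variables \<open>Y\<close> modulo \<open>P\<close> is finite over the algebra generated by \<open>v\<close>
  and \<open>ls\<close> and has dimension at least \<open>d\<close>. As there are at most \<open>d\<close> generators, none of them is
  superfluous.\<close>

locale finite_cover =
  fixes X and P :: "'k::field mpoly set" and Y E v ls c D d
  assumes X: "finite X" and YX: "Y \<subseteq> X" and P: "primeideal P (poly_ring X)"
    and E: "finite E" "E \<subseteq> carrier (poly_ring Y)"
    and v: "v \<in> carrier (poly_ring Y)" and ls: "set ls \<subseteq> Upto Y 1"
    and cov: "\<And>s. Upto Y s \<subseteq> covered P E (box_span (v # ls) s)"
    and c: "c > 0" and lower: "\<And>s. c * (real s + 1) ^ d \<le> real (dim_mod P (Upto Y (D * s)))"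
    and d: "length ls < d"
begin

lemma idP: "ideal P (poly_ring X)"
  using P by (rule primeideal.axioms(1))

lemma YXc: "f \<in> carrier (poly_ring Y) \<Longrightarrow> f \<in> carrier (poly_ring X)"
  using poly_ring_mono[OF YX] by blast

lemma ls_carr: "set ls \<subseteq> carrier (poly_ring Y)"
  using ls Upto_carrier by blast

lemma primeD: "a * b \<in> P \<Longrightarrow> a \<in> carrier (poly_ring X) \<Longrightarrow> b \<in> carrier (poly_ring X) \<Longrightarrow> a \<notin> P \<Longrightarrow> b \<in> P"
  using P by (auto simp: primeideal_poly_ring_iff)

lemma box_carr: "x \<in> box_span ls s \<Longrightarrow> x \<in> carrier (poly_ring Y)"
  using box_carrier[OF ls_carr] by blast

text \<open>Assume an equation for \<open>v\<close> over the subalgebra generated by \<open>ls\<close> with leading coefficient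
  \<open>\<gamma> \<notin> P\<close>. It replaces all powers of \<open>v\<close> by those below the degree of the equation, at the cost of a
  power of \<open>\<gamma>\<close>, so that the growth is bounded by the number of generators \<open>ls\<close>, which is less than
  \<open>d\<close>.\<close>

lemma transcendental:
  assumes p: "\<And>i. coeff p i \<in> (\<Union>s. box_span ls s)" and pv: "poly p v \<in> P"
  shows "coeff p i \<in> P"
proof (rule ccontr)
  assume "coeff p i \<notin> P"
  let ?T = "{i. coeff p i \<notin> P}"
  have sub: "?T \<subseteq> {..degree p}" using ideal_0[OF idP] coeff_eq_0[of p] by (force simp: not_le[symmetric])
  have fT: "finite ?T" by (rule finite_subset[OF sub]) simp
  define m where "m = Max ?T"
  define \<gamma> where "\<gamma> = coeff p m"
  have mT: "\<gamma> \<notin> P" using Max_in[OF fT] \<open>coeff p i \<notin> P\<close> unfolding m_def \<gamma>_def by blast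
  have above: "coeff p i \<in> P" if "i > m" for i
    using Max_ge[OF fT, of i] that unfolding m_def by force
  have pY: "coeff p i \<in> carrier (poly_ring Y)" for i using p[of i] box_carr by blast
  have vX: "v \<in> carrier (poly_ring X)" using YXc v .
  have rel: "(\<Sum>i\<le>m. coeff p i * v ^ i) \<in> P"
  proof -
    have "poly p v = (\<Sum>i\<le>max m (degree p). coeff p i * v ^ i)"
      unfolding poly_altdef by (intro sum.mono_neutral_left) (auto simp: coeff_eq_0)
    also have "\<dots> = (\<Sum>i\<le>m. coeff p i * v ^ i) + (\<Sum>i\<in>{..max m (degree p)} - {..m}. coeff p i * v ^ i)"
      by (subst sum.subset_diff[of "{..m}"]) (auto simp: add.commute)
    finally have "(\<Sum>i\<le>m. coeff p i * v ^ i)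
        = poly p v - (\<Sum>i\<in>{..max m (degree p)} - {..m}. coeff p i * v ^ i)" by simp
    moreover have "(\<Sum>i\<in>{..max m (degree p)} - {..m}. coeff p i * v ^ i) \<in> P"
      using above vX by (intro ideal_sum[OF idP] ideal_mult'[OF idP]) auto
    ultimately show ?thesis using ideal_diff[OF idP pv] by simp
  qed
  have "m \<noteq> 0"
  proof
    assume "m = 0"
    then have "coeff p m \<in> P" using rel by simp
    then show False using mT by (simp add: \<gamma>_def)
  qed
  then obtain m' where m': "m = Suc m'" using not0_implies_Suc by blast
  have "\<forall>i. \<exists>s. coeff p i \<in> box_span ls s" using p by blast
  then obtain S where S: "\<And>i. coeff p i \<in> box_span ls (S i)" by metis
  define B where "B = (\<Sum>i\<le>m. S i)"
  have B: "coeff p i \<in> box_span ls B" if "i \<le> m" for i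
    using S[of i] that unfolding B_def by (intro box_mono[OF member_le_sum[of i "{..m}" S]]) auto
  have \<gamma>B: "\<gamma> \<in> box_span ls B" unfolding \<gamma>_def by (rule B) simp
  have \<gamma>X: "\<gamma> \<in> carrier (poly_ring X)" unfolding \<gamma>_def using pY YXc by blast
  \<comment> \<open>Multiply the reduction of \<open>\<gamma>\<^sup>j v\<^sup>j\<close> by \<open>\<gamma> v\<close> and eliminate \<open>\<gamma> v\<^sup>m\<close> by the equation.\<close>
  have red: "\<exists>t. (\<forall>i<m. t i \<in> box_span ls (j * B)) \<and> \<gamma> ^ j * v ^ j - (\<Sum>i<m. v ^ i * t i) \<in> P" for j
  proof (induction j)
    case 0
    have "(\<Sum>i<m. v ^ i * (if i = 0 then 1 else 0)) = 1"
      using \<open>m \<noteq> 0\<close> by (simp add: if_distrib[of "\<lambda>z. _ * z"] sum.delta' cong: if_cong)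
    then show ?case
      using ideal_0[OF idP] box_1 mp.subspace_0[OF box_subspace]
      by (intro exI[of _ "\<lambda>i. if i = 0 then 1 else 0"]) auto
  next
    case (Suc j)
    then obtain t where t: "\<And>i. i < m \<Longrightarrow> t i \<in> box_span ls (j * B)"
      "\<gamma> ^ j * v ^ j - (\<Sum>i<m. v ^ i * t i) \<in> P" by blast
    define t' where "t' i = (if i = 0 then 0 else \<gamma> * t (i - 1)) - coeff p i * t m'" for i
    have "t' i \<in> box_span ls (Suc j * B)" if i: "i < m" for i
    proof -
      have "\<gamma> * t (i - 1) \<in> box_span ls (B + j * B)" by (rule box_mult[OF \<gamma>B t(1)]) (use i in simp)
      moreover have "coeff p i * t m' \<in> box_span ls (B + j * B)"
        by (rule box_mult[OF B t(1)]) (use i m' in auto)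
      ultimately show ?thesis
        unfolding t'_def using mp.subspace_0[OF box_subspace]
        by (auto intro!: mp.subspace_diff[OF box_subspace] mp.subspace_neg[OF box_subspace])
    qed
    moreover have "\<gamma> ^ Suc j * v ^ Suc j - (\<Sum>i<m. v ^ i * t' i) \<in> P"
    proof -
      have e1: "(\<Sum>i<m. v ^ i * (if i = 0 then 0 else \<gamma> * t (i - 1))) = (\<Sum>i<m'. v ^ Suc i * (\<gamma> * t i))"
        unfolding m' by (simp add: sum.lessThan_Suc_shift del: sum.lessThan_Suc)
      have e2: "(\<Sum>i<m. v ^ i * t' i)
          = (\<Sum>i<m'. v ^ Suc i * (\<gamma> * t i)) - (\<Sum>i<m. v ^ i * (coeff p i * t m'))"
        unfolding t'_def right_diff_distrib sum_subtractf e1 ..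
      have e3: "\<gamma> * v * (\<Sum>i<m. v ^ i * t i) = (\<Sum>i<m'. v ^ Suc i * (\<gamma> * t i)) + \<gamma> * v ^ m * t m'"
        unfolding m' by (simp add: sum_distrib_left distrib_left mult_ac)
      have e4: "(\<Sum>i\<le>m. coeff p i * v ^ i) * t m' = (\<Sum>i<m. v ^ i * (coeff p i * t m')) + \<gamma> * v ^ m * t m'"
        unfolding \<gamma>_def lessThan_Suc_atMost[symmetric] sum.lessThan_Suc distrib_right sum_distrib_right
        by (simp add: mult_ac)
      have "\<gamma> ^ Suc j * v ^ Suc j - (\<Sum>i<m. v ^ i * t' i)
          = \<gamma> * v * (\<gamma> ^ j * v ^ j - (\<Sum>i<m. v ^ i * t i)) + (\<Sum>i\<le>m. coeff p i * v ^ i) * t m'"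
        unfolding right_diff_distrib e2 e3 e4 by (simp add: algebra_simps)
      also have "\<dots> \<in> P"
      proof (rule ideal_add[OF idP])
        show "\<gamma> * v * (\<gamma> ^ j * v ^ j - (\<Sum>i<m. v ^ i * t i)) \<in> P"
          using \<gamma>X vX t(2) by (intro ideal_mult[OF idP]) auto
        have "t m' \<in> carrier (poly_ring X)" using YXc[OF box_carr[OF t(1)]] m' by simp
        then show "(\<Sum>i\<le>m. coeff p i * v ^ i) * t m' \<in> P" using rel by (intro ideal_mult'[OF idP])
      qed
      finally show ?thesis .
    qed
    ultimately show ?case by blast
  qed
  have dim: "dim_mod P (Upto Y s) \<le> card (E \<times> {..<m}) * (s * B + s + 1) ^ length ls" for s
  proof -
    let ?V = "(\<lambda>u. \<gamma> ^ s * u) ` Upto Y s" and ?W = "box_span ls (s * B + s)"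
    have fY: "finite Y" using YX X by (rule finite_subset)
    have \<gamma>s: "\<gamma> ^ s \<notin> P" by (rule prime_power_notin[OF P \<gamma>X mT])
    have subV: "mp.subspace ?V" "fin_dim ?V"
      by (intro linear_image_subspace fin_dim_image mp_linear_mult subspace_Upto fin_dim_Upto fY)+
    have fW: "fin_dim ?W" by (rule fin_dim_box[OF fY ls_carr])
    have "dim_mod P (Upto Y s) \<le> dim_mod P ?V"
    proof (rule dim_mod_inj[where f = "\<lambda>u. \<gamma> ^ s * u"])
      show "\<exists>v\<in>?V. \<gamma> ^ s * u - v \<in> P" if "u \<in> Upto Y s" for u
        using that ideal_0[OF idP] by (intro bexI[of _ "\<gamma> ^ s * u"]) auto
      show "u \<in> P" if "u \<in> Upto Y s" "\<gamma> ^ s * u \<in> P" for u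
        using primeD[OF that(2) poly_ring_power[OF \<gamma>X] YXc[OF Upto_carrier[OF that(1)]] \<gamma>s] .
    qed (use subV fY in \<open>auto intro: subspace_Upto fin_dim_Upto ideal_subspace[OF idP] mp_linear_mult\<close>)
    also have "\<dots> \<le> card (E \<times> {..<m}) * dim_mod P ?W"
    proof (rule dim_mod_cover[where u = "\<lambda>(e, i). e * v ^ i", OF subV box_subspace fW ideal_subspace[OF idP]])
      show "finite (E \<times> {..<m})" using E by simp
      show "(case ei of (e, i) \<Rightarrow> e * v ^ i) * x \<in> P" if "ei \<in> E \<times> {..<m}" "x \<in> P" for ei x
        using that E(2) YXc vX by (auto intro!: ideal_mult[OF idP])
      fix u assume "u \<in> ?V"
      then obtain a where a: "a \<in> Upto Y s" "u = \<gamma> ^ s * a" by auto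
      then obtain w where w: "\<And>e. e \<in> E \<Longrightarrow> w e \<in> box_span (v # ls) s" "a - (\<Sum>e\<in>E. e * w e) \<in> P"
        using cov[of s] unfolding covered_def by blast
      have "\<forall>e\<in>E. \<exists>b. w e = (\<Sum>j\<le>s. v ^ j * b j) \<and> (\<forall>j\<le>s. b j \<in> box_span ls s)"
        using w(1) by auto
      then have "\<exists>b. \<forall>e\<in>E. w e = (\<Sum>j\<le>s. v ^ j * b e j) \<and> (\<forall>j\<le>s. b e j \<in> box_span ls s)"
        by (rule bchoice)
      then obtain b where "\<forall>e\<in>E. w e = (\<Sum>j\<le>s. v ^ j * b e j) \<and> (\<forall>j\<le>s. b e j \<in> box_span ls s)" ..
      then have b: "\<And>e. e \<in> E \<Longrightarrow> w e = (\<Sum>j\<le>s. v ^ j * b e j)"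
        "\<And>e j. e \<in> E \<Longrightarrow> j \<le> s \<Longrightarrow> b e j \<in> box_span ls s" by simp_all
      have "\<exists>t. \<forall>j. (\<forall>i<m. t j i \<in> box_span ls (j * B)) \<and> \<gamma> ^ j * v ^ j - (\<Sum>i<m. v ^ i * t j i) \<in> P"
        by (intro choice allI red)
      then obtain t where "\<forall>j. (\<forall>i<m. t j i \<in> box_span ls (j * B)) \<and>
        \<gamma> ^ j * v ^ j - (\<Sum>i<m. v ^ i * t j i) \<in> P" ..
      then have t: "\<And>i j. i < m \<Longrightarrow> t j i \<in> box_span ls (j * B)"
        "\<And>j. \<gamma> ^ j * v ^ j - (\<Sum>i<m. v ^ i * t j i) \<in> P" by simp_all
      define z where "z = (\<lambda>(e, i). \<Sum>j\<le>s. \<gamma> ^ (s - j) * b e j * t j i)"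
      have "z (e, i) \<in> ?W" if e: "e \<in> E" and i: "i < m" for e i
        unfolding z_def prod.case
      proof (rule mp.subspace_sum[OF box_subspace])
        fix j assume j: "j \<in> {..s}"
        have "\<gamma> ^ (s - j) * b e j * t j i \<in> box_span ls ((s - j) * B + s + j * B)"
          using b(2)[OF e, of j] t(1)[OF i, of j] j by (intro box_mult box_power \<gamma>B) auto
        moreover have "(s - j) * B + s + j * B = s * B + s"
        proof -
          obtain q where "s = j + q" using j by (auto simp: le_iff_add)
          then show ?thesis by (simp add: algebra_simps)
        qed
        ultimately show "\<gamma> ^ (s - j) * b e j * t j i \<in> ?W" by simp
      qed
      moreover have "u - (\<Sum>ei\<in>E \<times> {..<m}. (case ei of (e, i) \<Rightarrow> e * v ^ i) * z ei) \<in> P"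
      proof -
        have "\<gamma> ^ s * w e - (\<Sum>i<m. v ^ i * z (e, i)) \<in> P" if e: "e \<in> E" for e
        proof -
          have "\<gamma> ^ s * w e = (\<Sum>j\<le>s. \<gamma> ^ (s - j) * b e j * (\<gamma> ^ j * v ^ j))"
            unfolding b(1)[OF e] sum_distrib_left
          proof (intro sum.cong refl)
            fix j assume "j \<in> {..s}"
            then have "\<gamma> ^ s = \<gamma> ^ (s - j) * \<gamma> ^ j" by (simp flip: power_add)
            then show "\<gamma> ^ s * (v ^ j * b e j) = \<gamma> ^ (s - j) * b e j * (\<gamma> ^ j * v ^ j)"
              by (simp add: mult_ac)
          qed
          moreover have "(\<Sum>i<m. v ^ i * z (e, i)) = (\<Sum>j\<le>s. \<gamma> ^ (s - j) * b e j * (\<Sum>i<m. v ^ i * t j i))"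
            unfolding z_def prod.case sum_distrib_left by (subst sum.swap) (simp add: mult_ac)
          ultimately have "\<gamma> ^ s * w e - (\<Sum>i<m. v ^ i * z (e, i))
              = (\<Sum>j\<le>s. \<gamma> ^ (s - j) * b e j * (\<gamma> ^ j * v ^ j - (\<Sum>i<m. v ^ i * t j i)))"
            by (simp add: right_diff_distrib sum_subtractf)
          also have "\<dots> \<in> P"
            using t(2) \<gamma>X YXc[OF box_carr[OF b(2)[OF e]]] by (intro ideal_sum[OF idP] ideal_mult[OF idP]) auto
          finally show ?thesis .
        qed
        then have "(\<Sum>e\<in>E. e * (\<gamma> ^ s * w e - (\<Sum>i<m. v ^ i * z (e, i)))) \<in> P"
          using E(2) YXc by (intro ideal_sum[OF idP] ideal_mult[OF idP]) auto
        then have "\<gamma> ^ s * (a - (\<Sum>e\<in>E. e * w e)) + (\<Sum>e\<in>E. e * (\<gamma> ^ s * w e - (\<Sum>i<m. v ^ i * z (e, i)))) \<in> P"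
          using ideal_mult[OF idP poly_ring_power[OF \<gamma>X] w(2)] by (intro ideal_add[OF idP])
        also have "\<gamma> ^ s * (a - (\<Sum>e\<in>E. e * w e)) + (\<Sum>e\<in>E. e * (\<gamma> ^ s * w e - (\<Sum>i<m. v ^ i * z (e, i))))
            = u - (\<Sum>e\<in>E. \<Sum>i<m. e * v ^ i * z (e, i))"
          by (simp add: a(2) right_diff_distrib sum_subtractf sum_distrib_left mult_ac)
        also have "(\<Sum>e\<in>E. \<Sum>i<m. e * v ^ i * z (e, i))
            = (\<Sum>ei\<in>E \<times> {..<m}. (case ei of (e, i) \<Rightarrow> e * v ^ i) * z ei)"
          by (simp add: sum.cartesian_product split_def)
        finally show ?thesis .
      qed
      ultimately show "\<exists>z. (\<forall>ei\<in>E \<times> {..<m}. z ei \<in> ?W) \<and>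
          u - (\<Sum>ei\<in>E \<times> {..<m}. (case ei of (e, i) \<Rightarrow> e * v ^ i) * z ei) \<in> P"
        by (intro exI[of _ z]) auto
    qed
    also have "\<dots> \<le> card (E \<times> {..<m}) * (s * B + s + 1) ^ length ls"
      using dim_box_le[OF X idP, of ls "s * B + s"] ls_carr YXc by (intro mult_le_mono) auto
    finally show ?thesis .
  qed
  have "d \<le> length ls"
  proof (rule growth_rescale[OF c])
    fix s
    have "real (dim_mod P (Upto Y (D * s))) \<le> real (card (E \<times> {..<m}) * (D * s * B + D * s + 1) ^ length ls)"
      using dim[of "D * s"] by (simp only: of_nat_le_iff)
    also have "\<dots> = real (card (E \<times> {..<m})) * (real ((D * B + D) * s) + 1) ^ length ls"
      by (simp add: algebra_simps)
    finally show "c * (real s + 1) ^ d \<le> real (card (E \<times> {..<m})) * (real ((D * B + D) * s) + 1) ^ length ls"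
      using lower[of s] by linarith
  qed
  then show False using d by simp
qed

text \<open>If the subalgebra generated by \<open>ls\<close> met \<open>C\<close> only inside \<open>P\<close>, it would embed into \<open>R/C\<close>, and
  the whole ring would grow by at most one degree faster than \<open>R/C\<close>.\<close>

lemma meets:
  assumes C: "mp.subspace C" and K: "\<And>t. real (dim_mod C (Upto Y t)) \<le> K * (real t + 1) ^ e" and e: "Suc e < d"
  shows "\<exists>s. \<exists>x\<in>box_span ls s. x \<in> C \<and> x \<notin> P"
proof (rule ccontr)
  assume "\<not> ?thesis"
  then have CP: "box_span ls s \<inter> C \<subseteq> P" for s by blast
  have fY: "finite Y" using YX X by (rule finite_subset)
  have vls: "set (v # ls) \<subseteq> carrier (poly_ring Y)" using v ls_carr by simp
  let ?n = "length ls"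
  have dim: "dim_mod P (Upto Y s) \<le> card E * ((s + 1) * dim_mod C (Upto Y (?n * s)))" for s
  proof -
    have 1: "dim_mod P (Upto Y s) \<le> card E * dim_mod P (box_span (v # ls) s)"
      using E YXc by (intro dim_covered[OF subspace_Upto fin_dim_Upto[OF fY] box_subspace fin_dim_box[OF fY vls] idP _ _ cov]) auto
    have 2: "dim_mod P (box_span (v # ls) s) \<le> (s + 1) * dim_mod P (box_span ls s)"
      using vls YXc by (intro dim_box_Cons[OF X idP]) auto
    have 3: "dim_mod P (box_span ls s) \<le> dim_mod C (Upto Y (?n * s))"
      using box_Upto[OF ls, of s] by (intro dim_mod_mono box_subspace subspace_Upto fin_dim_Upto fY C CP) simp
    show ?thesis by (rule order_trans[OF 1 mult_le_mono2[OF order_trans[OF 2 mult_le_mono2[OF 3]]]])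
  qed
  have "d \<le> Suc e"
  proof (rule growth_rescale[OF c])
    fix s
    let ?s = "D * s" and ?D = "D * Suc ?n"
    have le: "real ?s + 1 \<le> real (?D * s) + 1" "real (?n * ?s) + 1 \<le> real (?D * s) + 1"
      by (simp_all add: algebra_simps)
    have "real (dim_mod P (Upto Y ?s)) \<le> real (card E * ((?s + 1) * dim_mod C (Upto Y (?n * ?s))))"
      using dim[of ?s] by (simp only: of_nat_le_iff)
    also have "\<dots> = real (card E) * ((real ?s + 1) * real (dim_mod C (Upto Y (?n * ?s))))"
      by (simp only: of_nat_mult of_nat_add of_nat_1)
    also have "\<dots> \<le> real (card E) * ((real (?D * s) + 1) * (\<bar>K\<bar> * (real (?D * s) + 1) ^ e))"
    proof (intro mult_left_mono mult_mono le)
      have "K * (real (?n * ?s) + 1) ^ e \<le> \<bar>K\<bar> * (real (?D * s) + 1) ^ e"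
        by (intro mult_mono power_mono le) auto
      then show "real (dim_mod C (Upto Y (?n * ?s))) \<le> \<bar>K\<bar> * (real (?D * s) + 1) ^ e"
        using K[of "?n * ?s"] by linarith
    qed auto
    also have "\<dots> = real (card E) * \<bar>K\<bar> * (real (?D * s) + 1) ^ Suc e"
      by (simp only: power_Suc mult_ac)
    finally show "c * (real s + 1) ^ d \<le> real (card E) * \<bar>K\<bar> * (real (?D * s) + 1) ^ Suc e"
      using lower[of s] by linarith
  qed
  then show False using e by simp
qed

end

section \<open>Almost integral elements\<close>

lemma prime_prod_notin:
  assumes P: "primeideal P (poly_ring X)" and "\<And>e. e \<in> E \<Longrightarrow> f e \<in> carrier (poly_ring X) \<and> f e \<notin> P"
  shows "(\<Prod>e\<in>E. f e) \<in> carrier (poly_ring X) \<and> (\<Prod>e\<in>E. f e) \<notin> P"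
  using assms(2)
  by (induction E rule: infinite_finite_induct) (use P in \<open>auto simp: primeideal_poly_ring_iff\<close>)

text \<open>Let \<open>T = T\<^sub>0[v]\<close>, a polynomial ring modulo \<open>P\<close> by the assumption \<open>trans\<close>, and consider the ring
  generated by the variables \<open>Y\<close>, which is finite over \<open>T\<close> modulo \<open>P\<close>. Some \<open>w \<in> T - P\<close> maps this
  ring into a free \<open>T\<close>-module, namely the one on a maximal independent subset of the generators.
  Both \<open>c z\<close> and \<open>v z\<close> lie in the ring. Therefore \<open>w z\<^sup>m\<close> lies in the free module, coordinate by
  coordinate: both \<open>c\<^sup>m\<close> and \<open>v\<^sup>m\<close> multiply it into the free module, and they form a regular sequence
  on \<open>T\<close>.\<close>

lemma almost_integral:
  fixes P :: "'k::field mpoly set"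
  assumes P: "primeideal P (poly_ring X)" and YX: "Y \<subseteq> X"
    and T0: "T0 \<subseteq> carrier (poly_ring Y)" "range const \<subseteq> T0"
      "\<And>a b. a \<in> T0 \<Longrightarrow> b \<in> T0 \<Longrightarrow> a + b \<in> T0" "\<And>a b. a \<in> T0 \<Longrightarrow> b \<in> T0 \<Longrightarrow> a * b \<in> T0"
    and v: "v \<in> carrier (poly_ring Y)" and E: "finite E" "E \<subseteq> carrier (poly_ring Y)"
    and T: "T = {poly p v |p. \<forall>i. coeff p i \<in> T0}"
    and gen: "carrier (poly_ring Y) \<subseteq> covered P E T"
    and trans: "\<And>p i. (\<And>i. coeff p i \<in> T0) \<Longrightarrow> poly p v \<in> P \<Longrightarrow> coeff p i \<in> P"
    and c: "c \<in> T0" "c \<notin> P" and z: "z \<in> carrier (poly_ring X)"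
    and r1: "r1 \<in> carrier (poly_ring Y)" "c * z - r1 \<in> P"
    and r2: "r2 \<in> carrier (poly_ring Y)" "v * z - r2 \<in> P"
  obtains w where "w \<in> carrier (poly_ring Y)" "w \<notin> P"
    "\<And>m. \<exists>r\<in>carrier (poly_ring Y). w * z ^ m - r \<in> P"
proof -
  have id: "ideal P (poly_ring X)" using P by (rule primeideal.axioms(1))
  have subP: "mp.subspace P" by (rule ideal_subspace[OF id])
  have YXc: "f \<in> carrier (poly_ring X)" if "f \<in> carrier (poly_ring Y)" for f :: "'k mpoly"
    using that poly_ring_mono[OF YX] by blast
  have primeD: "b \<in> P" if "a * b \<in> P" "a \<in> carrier (poly_ring X)" "b \<in> carrier (poly_ring X)" "a \<notin> P" for a b
    using that P by (auto simp: primeideal_poly_ring_iff)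
  have T0_const: "const k \<in> T0" for k using T0(2) by blast
  have T0_0: "0 \<in> T0" using T0_const[of 0] by simp
  have T0_1: "1 \<in> T0" using T0_const[of 1] by simp
  have T0_uminus: "- a \<in> T0" if "a \<in> T0" for a
    using T0(4)[OF T0_const[of "- 1"] that] by simp
  have T0_diff: "a - b \<in> T0" if "a \<in> T0" "b \<in> T0" for a b
    using T0(3)[OF that(1) T0_uminus[OF that(2)]] by simp
  have T0_sum: "(\<Sum>i\<in>F. a i) \<in> T0" if "\<And>i. i \<in> F \<Longrightarrow> a i \<in> T0" for F :: "nat set" and a
    using that by (induction F rule: infinite_finite_induct) (auto intro: T0_0 T0(3))
  have T0_power: "a ^ n \<in> T0" if "a \<in> T0" for a n
    by (induction n) (auto intro: T0_1 T0(4) that)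
  have TI: "poly p v \<in> T" if "\<And>i. coeff p i \<in> T0" for p unfolding T using that by blast
  have T_T0: "a \<in> T" if "a \<in> T0" for a
    using TI[of "[:a:]"] that T0_0 by (simp add: coeff_pCons split: nat.splits)
  have T_1: "1 \<in> T" by (rule T_T0[OF T0_1])
  have T_mult: "a * b \<in> T" if ab: "a \<in> T" "b \<in> T" for a b
  proof -
    obtain p q where pq: "a = poly p v" "b = poly q v" "\<And>i. coeff p i \<in> T0" "\<And>i. coeff q i \<in> T0"
      using ab unfolding T by blast
    have "poly (p * q) v \<in> T" by (rule TI) (auto simp: coeff_mult intro!: T0_sum T0(4) pq)
    then show ?thesis by (simp add: pq)
  qed
  have T_add: "a + b \<in> T" if ab: "a \<in> T" "b \<in> T" for a b
  proof -
    obtain p q where pq: "a = poly p v" "b = poly q v" "\<And>i. coeff p i \<in> T0" "\<And>i. coeff q i \<in> T0"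
      using ab unfolding T by blast
    have "poly (p + q) v \<in> T" by (rule TI) (auto intro!: T0(3) pq)
    then show ?thesis by (simp add: pq)
  qed
  have subT: "mp.subspace T"
    by (rule mp_subspaceI) (auto intro: T_T0 T0_0 T_add T_mult T0_const)
  have T_prod: "(\<Prod>e\<in>F. a e) \<in> T" if "\<And>e. e \<in> F \<Longrightarrow> a e \<in> T" for F :: "'k mpoly set" and a
    using that by (induction F rule: infinite_finite_induct) (auto intro: T_1 T_mult)
  have TY: "a \<in> carrier (poly_ring Y)" if "a \<in> T" for a
    using that T0(1) v unfolding T by (auto simp: poly_altdef intro!: poly_ring_sum poly_ring_mult poly_ring_power)
  note cov_add = covered_add[OF subP subT] and cov_sum = covered_sum[OF subP subT]
    and cov_P = covered_P[OF subP subT]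
  have cov_mult: "l * a \<in> covered P F T" if "l \<in> T" "a \<in> covered P F T" for l a F
    using YXc[OF TY[OF that(1)]] T_mult[OF that(1)] that(2) by (rule covered_mult[OF id])
  define indep where "indep F \<longleftrightarrow>
    (\<forall>\<tau>. (\<forall>e\<in>F. \<tau> e \<in> T) \<longrightarrow> (\<Sum>e\<in>F. e * \<tau> e) \<in> P \<longrightarrow> (\<forall>e\<in>F. \<tau> e \<in> P))" for F :: "'k mpoly set"
  have fin: "finite {F. F \<subseteq> E \<and> indep F}" using E(1) by simp
  have "{} \<in> {F. F \<subseteq> E \<and> indep F}" by (simp add: indep_def)
  then have "{F. F \<subseteq> E \<and> indep F} \<noteq> {}" by blast
  from finite_has_maximal[OF fin this] obtain F where F0: "F \<in> {F. F \<subseteq> E \<and> indep F}"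
    "\<forall>F'\<in>{F. F \<subseteq> E \<and> indep F}. F \<subseteq> F' \<longrightarrow> F = F'" ..
  have F: "F \<subseteq> E" "indep F" using F0(1) by simp_all
  have max: "F = F'" if "F' \<subseteq> E" "indep F'" "F \<subseteq> F'" for F'
    using F0(2) that by simp
  have finF: "finite F" using F(1) E(1) by (rule finite_subset)
  \<comment> \<open>By maximality every generator depends on \<open>F\<close>; its coefficient in a relation is the wanted multiplier.\<close>
  have "\<exists>u\<in>T. u \<notin> P \<and> u * e \<in> covered P F T" if e: "e \<in> E" for e
  proof (cases "e \<in> F")
    case True
    have "e * 1 \<in> covered P F T" by (rule covered_generator[OF subP subT finF True T_1])
    then show ?thesis using T_1 P by (intro bexI[of _ 1]) (auto simp: primeideal_poly_ring_iff)
  next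
    case False
    have "\<not> indep (insert e F)" using max[of "insert e F"] e F(1) False by blast
    then obtain \<tau> where \<tau>: "\<And>x. x \<in> insert e F \<Longrightarrow> \<tau> x \<in> T" "(\<Sum>x\<in>insert e F. x * \<tau> x) \<in> P"
      "\<not> (\<forall>x\<in>insert e F. \<tau> x \<in> P)" unfolding indep_def by blast
    have sum: "e * \<tau> e + (\<Sum>x\<in>F. x * \<tau> x) \<in> P" using \<tau>(2) finF False by simp
    have "\<tau> e \<notin> P"
    proof
      assume "\<tau> e \<in> P"
      then have "e * \<tau> e \<in> P" using e E(2) YXc by (intro ideal_mult[OF id]) auto
      then have "(\<Sum>x\<in>F. x * \<tau> x) \<in> P" using sum ideal_add_iff[OF id] by blast
      then have "\<forall>x\<in>F. \<tau> x \<in> P" using F(2) \<tau>(1) unfolding indep_def by blast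
      then show False using \<tau>(3) \<open>\<tau> e \<in> P\<close> by blast
    qed
    moreover have "\<tau> e * e \<in> covered P F T"
      unfolding covered_def
    proof (intro CollectI exI[of _ "\<lambda>x. - \<tau> x"] conjI ballI)
      show "- \<tau> x \<in> T" if "x \<in> F" for x using \<tau>(1)[of x] that mp.subspace_neg[OF subT] by blast
      show "\<tau> e * e - (\<Sum>x\<in>F. x * - \<tau> x) \<in> P" using sum by (simp add: sum_negf mult.commute)
    qed
    ultimately show ?thesis using \<tau>(1)[of e] by blast
  qed
  then have "\<exists>u. \<forall>e\<in>E. u e \<in> T \<and> u e \<notin> P \<and> u e * e \<in> covered P F T"
    by (intro bchoice) blast
  then obtain u where u: "\<And>e. e \<in> E \<Longrightarrow> u e \<in> T" "\<And>e. e \<in> E \<Longrightarrow> u e \<notin> P"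
    "\<And>e. e \<in> E \<Longrightarrow> u e * e \<in> covered P F T" by blast
  define w where "w = (\<Prod>e\<in>E. u e)"
  have wT: "w \<in> T" unfolding w_def by (rule T_prod) (rule u(1))
  have wP: "w \<notin> P" unfolding w_def using prime_prod_notin[OF P, of E u] u(1,2) TY YXc by blast
  have we: "w * e \<in> covered P F T" if e: "e \<in> E" for e
  proof -
    have "w * e = (\<Prod>x\<in>E - {e}. u x) * (u e * e)"
      unfolding w_def prod.remove[OF E(1) e] by (simp add: mult_ac)
    moreover have "(\<Prod>x\<in>E - {e}. u x) * (u e * e) \<in> covered P F T"
      by (rule cov_mult[OF T_prod u(3)[OF e]]) (use u(1) in simp)
    ultimately show ?thesis by (simp only:)
  qed
  have wa: "w * a \<in> covered P F T" if a: "a \<in> carrier (poly_ring Y)" for a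
  proof -
    obtain t where t: "\<And>e. e \<in> E \<Longrightarrow> t e \<in> T" "a - (\<Sum>e\<in>E. e * t e) \<in> P"
      using gen a unfolding covered_def by blast
    have "w * (a - (\<Sum>e\<in>E. e * t e)) + (\<Sum>e\<in>E. t e * (w * e)) \<in> covered P F T"
      using YXc[OF TY[OF wT]] t by (intro cov_add cov_sum cov_P cov_mult we ideal_mult[OF id]) auto
    also have "w * (a - (\<Sum>e\<in>E. e * t e)) + (\<Sum>e\<in>E. t e * (w * e)) = w * a"
      by (simp add: right_diff_distrib sum_distrib_left mult_ac)
    finally show ?thesis .
  qed
  have FX: "e \<in> carrier (poly_ring X)" if "e \<in> F" for e using that F(1) E(2) YXc by blast
  have cX: "c \<in> carrier (poly_ring X)" using c(1) T0(1) YXc by blast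
  have vX: "v \<in> carrier (poly_ring X)" using v YXc by blast
  have wX: "w \<in> carrier (poly_ring X)" using YXc[OF TY[OF wT]] .
  have "\<exists>r\<in>carrier (poly_ring Y). w * z ^ m - r \<in> P" for m
  proof -
    obtain \<sigma> where \<sigma>: "\<And>e. e \<in> F \<Longrightarrow> \<sigma> e \<in> T" "w * r1 ^ m - (\<Sum>e\<in>F. e * \<sigma> e) \<in> P"
      using wa[OF poly_ring_power[OF r1(1), of m]] unfolding covered_def by blast
    obtain \<tau> where \<tau>: "\<And>e. e \<in> F \<Longrightarrow> \<tau> e \<in> T" "w * r2 ^ m - (\<Sum>e\<in>F. e * \<tau> e) \<in> P"
      using wa[OF poly_ring_power[OF r2(1), of m]] unfolding covered_def by blast
    have cz: "(c * z) ^ m - r1 ^ m \<in> P"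
      using cX z YXc[OF r1(1)] by (intro power_diff_ideal[OF id] r1(2)) auto
    have vz: "(v * z) ^ m - r2 ^ m \<in> P"
      using vX z YXc[OF r2(1)] by (intro power_diff_ideal[OF id] r2(2)) auto
    have 1: "c ^ m * (w * z ^ m) - (\<Sum>e\<in>F. e * \<sigma> e) \<in> P"
    proof -
      have "w * ((c * z) ^ m - r1 ^ m) + (w * r1 ^ m - (\<Sum>e\<in>F. e * \<sigma> e)) \<in> P"
        by (intro ideal_add[OF id] ideal_mult[OF id] wX cz \<sigma>(2))
      then show ?thesis by (simp add: power_mult_distrib algebra_simps)
    qed
    have 2: "v ^ m * (w * z ^ m) - (\<Sum>e\<in>F. e * \<tau> e) \<in> P"
    proof -
      have "w * ((v * z) ^ m - r2 ^ m) + (w * r2 ^ m - (\<Sum>e\<in>F. e * \<tau> e)) \<in> P"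
        by (intro ideal_add[OF id] ideal_mult[OF id] wX vz \<tau>(2))
      then show ?thesis by (simp add: power_mult_distrib algebra_simps)
    qed
    have cmT: "c ^ m \<in> T" and cmT0: "c ^ m \<in> T0" using T0_power[OF c(1)] T_T0 by auto
    have vmT: "v ^ m \<in> T"
    proof -
      have "poly (Polynomial.monom 1 m) v \<in> T" by (rule TI) (simp add: T0_0 T0_1)
      then show ?thesis by (simp add: poly_monom)
    qed
    have "(\<Sum>e\<in>F. e * (v ^ m * \<sigma> e - c ^ m * \<tau> e)) \<in> P"
    proof -
      have "c ^ m * (v ^ m * (w * z ^ m) - (\<Sum>e\<in>F. e * \<tau> e))
          - v ^ m * (c ^ m * (w * z ^ m) - (\<Sum>e\<in>F. e * \<sigma> e)) \<in> P"
        using cX vX by (intro ideal_diff[OF id] ideal_mult[OF id] 1 2) auto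
      moreover have "c ^ m * (v ^ m * (w * z ^ m) - (\<Sum>e\<in>F. e * \<tau> e))
          - v ^ m * (c ^ m * (w * z ^ m) - (\<Sum>e\<in>F. e * \<sigma> e))
          = v ^ m * (\<Sum>e\<in>F. e * \<sigma> e) - c ^ m * (\<Sum>e\<in>F. e * \<tau> e)"
        by (simp add: right_diff_distrib mult.left_commute)
      moreover have "v ^ m * (\<Sum>e\<in>F. e * \<sigma> e) - c ^ m * (\<Sum>e\<in>F. e * \<tau> e)
          = (\<Sum>e\<in>F. e * (v ^ m * \<sigma> e - c ^ m * \<tau> e))"
        unfolding right_diff_distrib sum_subtractf sum_distrib_left by (simp add: mult.left_commute)
      ultimately show ?thesis by metis
    qed
    moreover have "\<forall>e\<in>F. v ^ m * \<sigma> e - c ^ m * \<tau> e \<in> T"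
      by (intro ballI mp.subspace_diff[OF subT] T_mult vmT cmT \<sigma> \<tau>)
    ultimately have diff: "\<forall>e\<in>F. v ^ m * \<sigma> e - c ^ m * \<tau> e \<in> P"
      using F(2)[unfolded indep_def, THEN spec[of _ "\<lambda>e. v ^ m * \<sigma> e - c ^ m * \<tau> e"]] by simp
    \<comment> \<open>In \<open>v\<^sup>m \<sigma> = c\<^sup>m \<tau>\<close> compare the coefficients with respect to \<open>v\<close>: those of \<open>\<sigma>\<close> are \<open>c\<^sup>m\<close> times those of
      \<open>\<tau>\<close> shifted by \<open>m\<close>.\<close>
    have "\<exists>\<rho>\<in>T. \<sigma> e - c ^ m * \<rho> \<in> P" if e: "e \<in> F" for e
    proof -
      obtain p where p: "\<sigma> e = poly p v" "\<And>i. coeff p i \<in> T0" using \<sigma>(1)[OF e] unfolding T by blast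
      obtain q where q: "\<tau> e = poly q v" "\<And>i. coeff q i \<in> T0" using \<tau>(1)[OF e] unfolding T by blast
      let ?d = "Polynomial.monom 1 m * p - smult (c ^ m) q"
      have "coeff ?d i \<in> T0" for i
        using p(2) q(2) T0_0 cmT0 by (auto simp: coeff_monom_mult intro!: T0_diff T0_uminus T0(4))
      moreover have "poly ?d v \<in> P" using bspec[OF diff e] by (simp add: p q poly_monom)
      ultimately have "coeff ?d i \<in> P" for i by (rule trans)
      then have co: "coeff p i - c ^ m * coeff q (i + m) \<in> P" for i
        using \<open>\<And>i. coeff ?d i \<in> P\<close>[of "i + m"] by (simp add: coeff_monom_mult)
      let ?\<rho> = "poly (poly_shift m q) v"
      have "?\<rho> \<in> T" by (rule TI) (simp add: coeff_poly_shift q(2))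
      moreover have "\<sigma> e - c ^ m * ?\<rho> \<in> P"
      proof -
        let ?h = "p - smult (c ^ m) (poly_shift m q)"
        have "poly ?h v \<in> P"
          unfolding poly_altdef using co vX
          by (intro ideal_sum[OF id] ideal_mult'[OF id]) (auto simp: coeff_poly_shift)
        then show ?thesis by (simp add: p)
      qed
      ultimately show ?thesis by blast
    qed
    then have "\<exists>\<rho>. \<forall>e\<in>F. \<rho> e \<in> T \<and> \<sigma> e - c ^ m * \<rho> e \<in> P" by (intro bchoice) blast
    then obtain \<rho> where \<rho>: "\<And>e. e \<in> F \<Longrightarrow> \<rho> e \<in> T" "\<And>e. e \<in> F \<Longrightarrow> \<sigma> e - c ^ m * \<rho> e \<in> P" by blast
    let ?r = "\<Sum>e\<in>F. e * \<rho> e"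
    have rY: "?r \<in> carrier (poly_ring Y)"
      using F(1) E(2) TY[OF \<rho>(1)] by (intro poly_ring_sum poly_ring_mult) blast+
    have "(c ^ m * (w * z ^ m) - (\<Sum>e\<in>F. e * \<sigma> e)) + (\<Sum>e\<in>F. e * (\<sigma> e - c ^ m * \<rho> e)) \<in> P"
      by (intro ideal_add[OF id] ideal_sum[OF id] ideal_mult[OF id] 1 \<rho>(2) FX)
    moreover have "(\<Sum>e\<in>F. e * (\<sigma> e - c ^ m * \<rho> e)) = (\<Sum>e\<in>F. e * \<sigma> e) - c ^ m * ?r"
      unfolding right_diff_distrib sum_subtractf sum_distrib_left by (simp add: mult.left_commute)
    ultimately have "c ^ m * (w * z ^ m - ?r) \<in> P" by (simp add: right_diff_distrib)
    then have "w * z ^ m - ?r \<in> P"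
    proof (rule primeD)
      show "w * z ^ m - ?r \<in> carrier (poly_ring X)"
        using wX z YXc[OF rY] by (intro poly_ring_diff poly_ring_mult poly_ring_power)
    qed (use cX prime_power_notin[OF P cX c(2)] in auto)
    then show ?thesis using rY by blast
  qed
  then show ?thesis using that[OF TY[OF wT] wP] by blast
qed

text \<open>By noetherianity some \<open>r\<^sub>m \<equiv> w y\<^sup>m\<close> is a combination of the earlier ones. The same combination
  of powers of \<open>y\<close> is an equation for \<open>y\<close> after cancellation of \<open>w\<close>, and its component of degree \<open>m\<close>
  is monic in \<open>y\<close>.\<close>

lemma (in monomial_ordered) almost_integral_monic:
  fixes P :: "'k::field mpoly set"
  assumes P: "primeideal P (poly_ring X)" "graded P" and y: "y \<in> X"
    and w: "w \<in> carrier (poly_ring (X - {y}))" "w \<notin> P"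
    and int: "\<And>m. \<exists>r\<in>carrier (poly_ring (X - {y})). w * var y ^ m - r \<in> P"
  shows "\<exists>f\<in>P. \<exists>m. homogeneous m f \<and> y_coeff y m f = 1"
proof -
  have id: "ideal P (poly_ring X)" using P(1) by (rule primeideal.axioms(1))
  have sub: "f \<in> carrier (poly_ring X)" if "f \<in> carrier (poly_ring (X - {y}))" for f :: "'k mpoly"
    using that poly_ring_mono[of "X - {y}" X] by blast
  have "\<exists>r. \<forall>m. r m \<in> carrier (poly_ring (X - {y})) \<and> w * var y ^ m - r m \<in> P"
    using int by (intro choice) blast
  then obtain r where r: "\<And>m. r m \<in> carrier (poly_ring (X - {y}))" "\<And>m. w * var y ^ m - r m \<in> P" by blast
  define J where "J m = {\<Sum>j<m. a j * r j |a. \<forall>j. a j \<in> carrier (poly_ring X)}" for m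
  have "ideal (J m) (poly_ring X)" for m
  proof (rule ideal_poly_ringI)
    show "J m \<subseteq> carrier (poly_ring X)" unfolding J_def using sub[OF r(1)] by auto
    show "0 \<in> J m" unfolding J_def by (intro CollectI exI[of _ "\<lambda>_. 0"]) auto
    fix f g assume "f \<in> J m" "g \<in> J m"
    then obtain a b where "f = (\<Sum>j<m. a j * r j)" "\<forall>j. a j \<in> carrier (poly_ring X)"
      "g = (\<Sum>j<m. b j * r j)" "\<forall>j. b j \<in> carrier (poly_ring X)" unfolding J_def by blast
    then show "f + g \<in> J m" unfolding J_def
      by (intro CollectI exI[of _ "\<lambda>j. a j + b j"]) (auto simp: sum.distrib distrib_right)
  next
    fix s f :: "'k mpoly" assume s: "s \<in> carrier (poly_ring X)" and "f \<in> J m"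
    then obtain a where "f = (\<Sum>j<m. a j * r j)" "\<forall>j. a j \<in> carrier (poly_ring X)" unfolding J_def by blast
    then show "s * f \<in> J m" unfolding J_def using s
      by (intro CollectI exI[of _ "\<lambda>j. s * a j"]) (auto simp: sum_distrib_left mult.assoc)
  qed
  then obtain m where m: "\<not> J m \<subset> J (Suc m)" using no_ascending_chain[of J] by blast
  have "J m \<subseteq> J (Suc m)"
  proof
    fix f assume "f \<in> J m"
    then obtain a where "f = (\<Sum>j<m. a j * r j)" "\<forall>j. a j \<in> carrier (poly_ring X)" unfolding J_def by blast
    then show "f \<in> J (Suc m)" unfolding J_def
      by (intro CollectI exI[of _ "\<lambda>j. if j < m then a j else 0"]) auto
  qed
  then have "J (Suc m) \<subseteq> J m" using m by blast
  moreover have "r m \<in> J (Suc m)"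
    unfolding J_def by (intro CollectI exI[of _ "\<lambda>j. if j = m then 1 else 0"]) auto
  ultimately obtain a where a: "r m = (\<Sum>j<m. a j * r j)" "\<And>j. a j \<in> carrier (poly_ring X)"
    unfolding J_def by blast
  define b where "b j = y_coeff y 0 (a j)" for j
  have b: "b j \<in> carrier (poly_ring (X - {y}))" for j unfolding b_def using a(2) by auto
  have rm: "r m = (\<Sum>j<m. b j * r j)"
  proof -
    have "r m = y_coeff y 0 (r m)" using y_coeff_free[OF r(1), of 0 m] by simp
    also have "\<dots> = (\<Sum>j<m. b j * r j)"
      unfolding a(1) y_coeff_sum y_coeff_0_mult b_def using y_coeff_free[OF r(1), of 0] by simp
    finally show ?thesis .
  qed
  define g where "g = var y ^ m - (\<Sum>j<m. b j * var y ^ j)"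
  have gX: "g \<in> carrier (poly_ring X)"
    unfolding g_def using y sub[OF b]
    by (intro poly_ring_diff poly_ring_sum poly_ring_mult poly_ring_power poly_ring_var)
  have "w * g \<in> P"
  proof -
    have "(w * var y ^ m - r m) - (\<Sum>j<m. b j * (w * var y ^ j - r j)) \<in> P"
      using sub[OF b] by (intro ideal_diff[OF id] ideal_sum[OF id] ideal_mult[OF id] r(2))
    moreover have "(\<Sum>j<m. b j * (w * var y ^ j - r j)) = w * (\<Sum>j<m. b j * var y ^ j) - r m"
      unfolding rm right_diff_distrib sum_subtractf sum_distrib_left by (simp add: mult.left_commute)
    ultimately show ?thesis by (simp add: g_def right_diff_distrib)
  qed
  then have "g \<in> P" using P(1) w(2) sub[OF w(1)] gX by (auto simp: primeideal_poly_ring_iff)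
  then have "hcomp m g \<in> P" by (rule gradedD[OF P(2)])
  moreover have "y_coeff y m (hcomp m g) = 1"
  proof -
    have "y_coeff y m (b j * var y ^ j) = 0" if "j < m" for j
      using that y_coeff_free[OF b, of "m - j" j] by (simp add: y_coeff_mult_var)
    then have "y_coeff y m g = 1"
      by (simp add: g_def y_coeff_diff y_coeff_sum y_coeff_var_power)
    moreover have "hcomp 0 (1 :: 'k mpoly) = 1"
      using hcomp_homogeneous[OF homogeneous_1, of 0] by simp
    ultimately show ?thesis using y_coeff_hcomp[of 0 y m g] by simp
  qed
  ultimately show ?thesis by blast
qed

section \<open>The dimension of \<open>C\<close>\<close>

lemma y_coeff_homogeneous_above:
  assumes "homogeneous e f" "i > e"
  shows "y_coeff y i f = 0"
proof (rule y_coeff_above, unfold y_degree_eq, rule le_less_trans[OF grade_bound_leI assms(2)])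
  fix m assume "m \<in> keys f"
  then have "total_deg m = e" using assms(1) by (auto simp: homogeneous_def)
  then show "lookup m y \<le> e"
    using member_le_sum[of y "keys m" "lookup m"]
    by (cases "y \<in> keys m") (auto simp: total_deg_def in_keys_iff)
qed

definition monic_forms :: "nat set \<Rightarrow> nat \<Rightarrow> 'k::field mpoly set" where
  "monic_forms X y = {f \<in> carrier (poly_ring X). \<exists>e. homogeneous e f \<and> y_coeff y e f = 1}"

lemma monic_forms_1: "1 \<in> monic_forms X y"
  using y_coeff_var_power[of y 0 0] unfolding monic_forms_def by auto

lemma monic_forms_mult:
  assumes "f \<in> monic_forms X y" "g \<in> monic_forms X y"
  shows "f * g \<in> monic_forms X y"
proof -
  obtain d where d: "homogeneous d f" "y_coeff y d f = 1" using assms(1) by (auto simp: monic_forms_def)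
  obtain e where e: "homogeneous e g" "y_coeff y e g = 1" using assms(2) by (auto simp: monic_forms_def)
  have "y_coeff y (d + e) (f * g) = (\<Sum>i\<le>d + e. if i = d then 1 else 0)"
    unfolding y_coeff_mult
  proof (intro sum.cong refl)
    fix i
    consider "i = d" | "i > d" | "i < d" by linarith
    then show "y_coeff y i f * y_coeff y (d + e - i) g = (if i = d then 1 else 0)"
    proof cases
      case 1
      then show ?thesis using d(2) e(2) by simp
    next
      case 2
      then show ?thesis using y_coeff_homogeneous_above[OF d(1)] by simp
    next
      case 3
      then have "y_coeff y (d + e - i) g = 0" by (intro y_coeff_homogeneous_above[OF e(1)]) simp
      then show ?thesis using 3 by simp
    qed
  qed
  then have "y_coeff y (d + e) (f * g) = 1" by (simp add: sum.delta')
  then show ?thesis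
    using assms homogeneous_mult[OF d(1) e(1)] by (auto simp: monic_forms_def)
qed

text \<open>The substitution \<open>y = 0\<close> identifies \<open>R/Q\<close> with the subring of \<open>R/P\<close> generated by the other
  variables. In this way the subring is described by a homogeneous ideal of the same polynomial
  ring.\<close>

lemma restricted_prime:
  fixes P :: "'k::field mpoly set"
  assumes X: "finite X" and P: "primeideal P (poly_ring X)" "graded P"
    and Q: "Q = {f \<in> carrier (poly_ring X). y_coeff y 0 f \<in> P}"
  shows "primeideal Q (poly_ring X)" "graded Q" "growth_le X P d \<Longrightarrow> growth_le X Q d"
proof -
  have id: "ideal P (poly_ring X)" using P(1) by (rule primeideal.axioms(1))
  have y1: "y_coeff y 0 1 = (1 :: 'k mpoly)" using y_coeff_var_power[of y 0 0] by simp
  have idQ: "ideal Q (poly_ring X)"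
    unfolding Q using ideal_0[OF id]
    by (intro ideal_poly_ringI)
      (auto simp: y_coeff_add y_coeff_0_mult intro!: ideal_add[OF id] ideal_mult[OF id])
  then show "primeideal Q (poly_ring X)"
    using P(1) y1 unfolding primeideal_poly_ring_iff Q by (auto simp: y_coeff_0_mult)
  show "graded Q"
    unfolding graded_def
  proof (intro ballI allI)
    fix f s assume f: "f \<in> Q"
    have "y_coeff y 0 (hcomp s f) = hcomp s (y_coeff y 0 f)"
      using y_coeff_hcomp[of s y 0 f] by simp
    then show "hcomp s f \<in> Q" using f gradedD[OF P(2)] unfolding Q by auto
  qed
  assume "growth_le X P d"
  moreover have "hfa X Q s \<le> hfa X P s" for s
    unfolding hfa_def
  proof (rule dim_mod_inj[where f = "y_coeff y 0"])
    show "mp_linear (y_coeff y 0 :: 'k mpoly \<Rightarrow> _)"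
      by (rule mp_linearI) (simp_all add: y_coeff_add y_coeff_const_mult)
    fix u :: "'k mpoly" assume u: "u \<in> Upto X s"
    have "y_coeff y 0 u \<in> Upto X s"
      using Upto_y_coeff[OF u] Upto_mono_vars[of "X - {y}" X s] by blast
    then show "\<exists>w\<in>Upto X s. y_coeff y 0 u - w \<in> P"
      using ideal_0[OF id] by (intro bexI[of _ "y_coeff y 0 u"]) simp_all
    show "u \<in> Q" if "y_coeff y 0 u \<in> P" using that Upto_carrier[OF u] Q by simp
  qed (use X subspace_Upto fin_dim_Upto ideal_subspace[OF id] in auto)
  ultimately show "growth_le X Q d" unfolding growth_le_def by (meson of_nat_le_iff order_trans)
qed

text \<open>The zeros of \<open>C\<close> are the limits at infinity, in the direction of \<open>y\<close>, of the zeros of \<open>I\<close>. As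
  \<open>C\<close> is proper, some associated prime \<open>P\<close> of \<open>I\<close> contains no form that is monic in \<open>y\<close>. Assume that
  \<open>R/C\<close> has smaller dimension than \<open>R/P\<close>. Take \<open>v \<in> C - P\<close> without \<open>y\<close> as one parameter of the image
  of \<open>K[X - {y}]\<close> in \<open>R/P\<close>, complete it to a system of parameters, and find \<open>x \<in> C - P\<close> that is a
  polynomial in the other parameters. Modulo \<open>P\<close>, both \<open>v y\<close> and \<open>x y\<close> are polynomials without \<open>y\<close>.
  Hence the fraction \<open>y\<close> is almost integral and then integral, and \<open>P\<close> contains a form monic in \<open>y\<close>.\<close>

lemma dim_le_dim_C:
  fixes I G :: "'k::{field, ring_char_0} mpoly set"
  assumes gvd: "geometric_vertex_decomposition X y ord G I"
    and X: "finite X" and gr: "graded I" and un: "unmixed (poly_ring X) I" and d: "has_dim X I d"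
    and C1: "1 \<notin> C_ideal X y G" and e: "growth_le X (C_ideal X y G) e"
  shows "d \<le> e"
proof (rule ccontr)
  interpret gvd X y ord G I by unfold_locales (rule gvd)
  interpret monomial_ordered X ord by unfold_locales (use X ord in auto)
  assume ed: "\<not> d \<le> e"
  let ?X = "X - {y}"
  let ?S = "monic_forms X y :: 'k mpoly set"
  have sub: "f \<in> carrier (poly_ring X)" if "f \<in> carrier (poly_ring ?X)" for f :: "'k mpoly"
    using that poly_ring_mono[of ?X X] by blast
  have no_power: "var y ^ n \<notin> C" for n
    using extended_cancel_var_power[OF extended_C y, of 1 n] C1 by auto
  have "?S \<inter> I = {}"
  proof (rule ccontr)
    assume "?S \<inter> I \<noteq> {}"
    then obtain f n where f: "f \<in> I" "homogeneous n f" "y_coeff y n f = 1" by (auto simp: monic_forms_def)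
    have "y_coeff y n f * var y ^ n \<in> inI"
      by (rule initial_y_ideal_mem[OF I y f(1)]) (rule y_coeff_homogeneous_above[OF f(2)])
    then show False using no_power[of n] by (simp add: f(3) inI_eq)
  qed
  moreover have "?S \<subseteq> carrier (poly_ring X)" by (auto simp: monic_forms_def)
  moreover have "1 \<in> ?S" by (rule monic_forms_1)
  moreover have "s * t \<in> ?S" if "s \<in> ?S" "t \<in> ?S" for s t
    using that by (rule monic_forms_mult)
  moreover have "\<exists>e. homogeneous e s" if "s \<in> ?S" for s
    using that by (auto simp: monic_forms_def)
  ultimately obtain P where P: "P \<in> associated_primes (poly_ring X) I" "graded P" "I \<subseteq> P" "?S \<inter> P = {}"
    using homogeneous_associated_prime[OF I gr, of ?S] by blast
  have pr: "primeideal P (poly_ring X)" using P by (simp add: associated_primes_def)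
  have idP: "ideal P (poly_ring X)" using pr by (rule primeideal.axioms(1))
  have dP: "has_dim X P d" by (rule unmixed_has_dim[OF un gr d P(1-3)])
  have grC: "graded C" by (rule graded_ideals(2)[OF gr])
  have "\<not> C \<subseteq> P"
  proof
    assume "C \<subseteq> P"
    then have "growth_le X P e" by (rule growth_le_antimono[OF X ideal_C _ e])
    then show False using dP ed growth_ge_le unfolding has_dim_def by blast
  qed
  then obtain f where f: "f \<in> C" "f \<notin> P" by blast
  obtain k where k: "y_coeff y k f \<notin> P" using extendedI_mem[OF idP y, of f] f(2) by blast
  let ?a = "y_coeff y k f"
  have "?a = (\<Sum>i\<le>grade_bound total_deg ?a. hcomp i ?a)" by (rule sum_parts) simp
  then obtain b where b: "hcomp b ?a \<notin> P" using ideal_sum[OF idP] k by metis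
  define v where "v = hcomp b ?a"
  have vC: "v \<in> C" unfolding v_def using gradedD[OF grC] extended_coeff[OF extended_C y f(1)] by blast
  have vD: "v \<in> Deg ?X b" unfolding v_def using ideal_carr[OF ideal_C f(1)] by (intro hcomp_Deg) auto
  have vP: "v \<notin> P" using b by (simp add: v_def)
  have vY: "v \<in> carrier (poly_ring ?X)" using vD by (rule Deg_carrier)
  have "b \<noteq> 0"
  proof
    assume "b = 0"
    then have vc: "v = const (lookup v 0)" using homogeneous_0_const Deg_homogeneous[OF vD] by simp
    then have "lookup v 0 \<noteq> 0" using vP ideal_0[OF idP] by (metis const_simps(1))
    have "const (inverse (lookup v 0)) * v \<in> C" by (rule ideal_const_mult[OF ideal_C vC])
    also have "const (inverse (lookup v 0)) * v = const (inverse (lookup v 0) * lookup v 0)"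
      unfolding const_simps(4) using vc by (rule arg_cong)
    also have "\<dots> = 1" using \<open>lookup v 0 \<noteq> 0\<close> by simp
    finally show False using C1 by simp
  qed
  then have b1: "b \<ge> 1" by simp
  obtain r2 where r2: "r2 \<in> carrier (poly_ring ?X)" "v * var y - r2 \<in> P"
    using C_lift[OF vC vY] P(3) by blast
  \<comment> \<open>The contraction of \<open>C\<close> has one dimension less than \<open>C\<close>, because \<open>y\<close> is regular on \<open>R/C\<close>.\<close>
  have dC: "growth_le X (adjoin X C (var y)) (e - 1)" and e0: "e \<noteq> 0"
  proof -
    show "e \<noteq> 0"
    proof
      assume "e = 0"
      then obtain n where "Deg X n \<subseteq> C" using growth_0_imp[OF ideal_C grC] e by blast
      moreover have "var y ^ n \<in> Deg X n"
        using homogeneous_power[OF homogeneous_var[of y], of n] var_carr by (auto simp: Deg_def)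
      ultimately show False using no_power by blast
    qed
    then have e': "growth_le X C (Suc (e - 1))" using e by simp
    show "growth_le X (adjoin X C (var y)) (e - 1)"
    proof (rule section_growth[OF X ideal_C ideal_adjoin[OF ideal_C var_carr] adjoin_incl _ e'])
      fix t
      show "hfa X (adjoin X C (var y)) (t + 1) + hfa X C t \<le> hfa X C (t + 1)"
        using hfa_exact[OF X ideal_C grC var_carr homogeneous_var, of "t + 1"]
          extended_colon_var[OF extended_C y] by simp
    qed
  qed
  define Q where "Q = {f \<in> carrier (poly_ring X). y_coeff y 0 f \<in> P}"
  note Q = restricted_prime[OF X pr P(2) Q_def]
  obtain d' where d': "d = Suc d'" using ed by (cases d) auto
  have gQ: "growth_le X Q (Suc d')" using Q(3)[of d] dP d' by (simp add: has_dim_def)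
  have idQ: "ideal Q (poly_ring X)" using Q(1) by (rule primeideal.axioms(1))
  have vX: "v \<in> carrier (poly_ring X)" using sub[OF vY] .
  have vQ: "v \<notin> Q" using vP y_coeff_free[OF vY, of 0] by (simp add: Q_def)
  have "v \<in> Upto X b" using Deg_Upto[of ?X b] Upto_mono_vars[of ?X X b] vD by blast
  then have gQv: "growth_le X (adjoin X Q v) d'"
    by (rule prime_section_growth[OF X Q(1) ideal_adjoin[OF idQ vX] adjoin_incl _ adjoin_mem[OF idQ] vQ gQ])
  obtain ls k where ls: "length ls = d'" "set ls \<subseteq> Deg X 1"
    and k: "\<And>s. s \<ge> k \<Longrightarrow> Deg X s \<subseteq> foldl (adjoin X) (adjoin X Q v) ls"
    using parameters[OF ideal_adjoin[OF idQ vX] graded_adjoin[OF idQ Q(2) Deg_homogeneous[OF vD]] gQv]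
    by blast
  define E :: "'k mpoly set" where "E = (\<lambda>m. single m 1) ` {m \<in> monoms ?X. total_deg m \<le> k}"
  define ls' where "ls' = map (y_coeff y 0) ls"
  have cov: "Upto ?X s \<subseteq> covered P E (box_span (v # ls') s)" for s
    unfolding ls'_def by (rule parameters_cover[OF X y idP P(2) vD b1 ls(2) Q_def k E_def refl])
  have E: "finite E" "E \<subseteq> carrier (poly_ring ?X)"
    unfolding E_def using X by (auto intro!: finite_monoms)
  have ls1: "set ls' \<subseteq> Upto ?X 1"
  proof
    fix l assume "l \<in> set ls'"
    then obtain l0 where "l = y_coeff y 0 l0" "l0 \<in> Upto X 1"
      using ls(2) Deg_Upto[of X 1] unfolding ls'_def by auto
    then show "l \<in> Upto ?X 1" using Upto_y_coeff by blast
  qed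
  obtain D where D: "\<And>s. hfa X P s \<le> dim_mod P (Upto ?X (D * s))"
    using growth_eliminate_var[OF X y pr vY vP r2] by blast
  obtain c where c: "c > 0" "\<And>s. c * (real s + 1) ^ d \<le> real (hfa X P s)"
    using dP by (auto simp: has_dim_def growth_ge_def)
  interpret fc: finite_cover X P ?X E v ls' c D d
  proof (rule finite_cover.intro)
    show "c * (real s + 1) ^ d \<le> real (dim_mod P (Upto ?X (D * s)))" for s
      using c(2)[of s] D[of s] by linarith
    show "length ls' < d" using ls(1) d' by (simp add: ls'_def)
    show "Upto ?X s \<subseteq> covered P E (box_span (v # ls') s)" for s by (rule cov)
    show "?X \<subseteq> X" by blast
  qed (rule X pr E vY ls1 c(1))+
  obtain K where K: "\<And>s. real (hfa X (adjoin X C (var y)) s) \<le> K * (real s + 1) ^ (e - 1)"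
    using dC by (auto simp: growth_le_def)
  have "real (dim_mod C (Upto ?X t)) \<le> K * (real t + 1) ^ (e - 1)" for t
    using dim_mod_extended_le[OF X y extended_C, of t] K[of t] by linarith
  then obtain s0 x where x: "x \<in> box_span ls' s0" "x \<in> C" "x \<notin> P"
    using fc.meets[OF ideal_subspace[OF ideal_C], of K "e - 1"] ed e0 by auto
  obtain r1 where r1: "r1 \<in> carrier (poly_ring ?X)" "x * var y - r1 \<in> P"
    using C_lift[OF x(2) fc.box_carr[OF x(1)]] P(3) by blast
  \<comment> \<open>\<open>T0\<close> is the subalgebra generated by \<open>ls'\<close>, and \<open>T = T0[v]\<close>.\<close>
  define T0 where "T0 = (\<Union>s. box_span ls' s)"
  define T where "T = {poly p v |p. \<forall>i. coeff p i \<in> T0}"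
  have T0_add: "a + b \<in> T0" if "a \<in> T0" "b \<in> T0" for a b
  proof -
    obtain s t where "a \<in> box_span ls' s" "b \<in> box_span ls' t" using \<open>a \<in> T0\<close> \<open>b \<in> T0\<close> by (auto simp: T0_def)
    then have "a \<in> box_span ls' (max s t)" "b \<in> box_span ls' (max s t)"
      using box_mono[of s "max s t"] box_mono[of t "max s t"] by auto
    then show ?thesis using mp.subspace_add[OF box_subspace] unfolding T0_def by blast
  qed
  have T0_mult: "a * b \<in> T0" if "a \<in> T0" "b \<in> T0" for a b
    using that box_mult[of a ls' _ b] unfolding T0_def by blast
  have gen: "carrier (poly_ring ?X) \<subseteq> covered P E T"
  proof
    fix a :: "'k mpoly" assume "a \<in> carrier (poly_ring ?X)"
    then obtain s where "a \<in> Upto ?X s" using Upto_exists by blast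
    then have "a \<in> covered P E (box_span (v # ls') s)" using cov by blast
    moreover have "box_span (v # ls') s \<subseteq> T"
    proof
      fix u assume "u \<in> box_span (v # ls') s"
      then obtain g where g: "u = (\<Sum>i\<le>s. v ^ i * g i)" "\<forall>i\<le>s. g i \<in> box_span ls' s" by auto
      define p where "p = (\<Sum>i\<le>s. Polynomial.monom (g i) i)"
      have "coeff p i = (if i \<le> s then g i else 0)" for i
        by (simp add: p_def coeff_sum sum.delta')
      then have "coeff p i \<in> T0" for i
        using g(2) mp.subspace_0[OF box_subspace, of ls' s] unfolding T0_def by auto
      moreover have "u = poly p v" by (simp add: p_def g(1) poly_sum poly_monom mult.commute)
      ultimately show "u \<in> T" unfolding T_def by blast
    qed
    ultimately show "a \<in> covered P E T" using covered_mono by blast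
  qed
  obtain w where w: "w \<in> carrier (poly_ring ?X)" "w \<notin> P"
    "\<And>m. \<exists>r\<in>carrier (poly_ring ?X). w * var y ^ m - r \<in> P"
  proof (rule almost_integral[OF pr _ _ _ T0_add T0_mult vY E T_def gen _ _ x(3) var_carr r1 r2])
    show "?X \<subseteq> X" by blast
    show "T0 \<subseteq> carrier (poly_ring ?X)" unfolding T0_def using fc.box_carr by blast
    show "range const \<subseteq> T0" unfolding T0_def using box_const by blast
    show "coeff p i \<in> P" if "\<And>i. coeff p i \<in> T0" "poly p v \<in> P" for p i
      using fc.transcendental[of p i] that unfolding T0_def by blast
    show "x \<in> T0" using x(1) unfolding T0_def by blast
  qed (assumption, assumption, assumption, assumption, use that in blast)
  obtain g n where g: "g \<in> P" "homogeneous n g" "y_coeff y n g = 1"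
    using almost_integral_monic[OF pr P(2) y w] by blast
  then have "g \<in> ?S" using ideal_carr[OF idP] by (auto simp: monic_forms_def)
  then show False using P(4) g(1) by blast
qed

section \<open>Additivity of the multiplicity\<close>

lemma radical_add:
  assumes J: "ideal J (poly_ring X)"
    and f: "f \<in> radical (poly_ring X) J" and g: "g \<in> radical (poly_ring X) J"
  shows "f + g \<in> radical (poly_ring X) J"
proof -
  obtain a b where ab: "f ^ a \<in> J" "g ^ b \<in> J" "f \<in> carrier (poly_ring X)" "g \<in> carrier (poly_ring X)"
    using f g by (auto simp: radical_iff)
  have "(f + g) ^ (a + b) = (\<Sum>k\<le>a + b. of_nat (a + b choose k) * f ^ k * g ^ (a + b - k))"
    by (rule binomial_ring)
  also have "\<dots> \<in> J"
  proof (rule ideal_sum[OF J])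
    fix k
    have n: "of_nat m \<in> (carrier (poly_ring X) :: 'a mpoly set)" for m by (induction m) auto
    show "of_nat (a + b choose k) * f ^ k * g ^ (a + b - k) \<in> J"
    proof (cases "k \<ge> a")
      case True
      then have "f ^ k = f ^ a * f ^ (k - a)" by (simp flip: power_add)
      then have "of_nat (a + b choose k) * f ^ k * g ^ (a + b - k)
          = (of_nat (a + b choose k) * f ^ (k - a) * g ^ (a + b - k)) * f ^ a" by (simp add: mult_ac)
      also have "\<dots> \<in> J" using ab n by (intro ideal_mult[OF J]) auto
      finally show ?thesis .
    next
      case False
      then have "g ^ (a + b - k) = g ^ (a - k) * g ^ b" by (simp flip: power_add)
      then have "of_nat (a + b choose k) * f ^ k * g ^ (a + b - k)
          = (of_nat (a + b choose k) * f ^ k * g ^ (a - k)) * g ^ b" by (simp add: mult_ac)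
      also have "\<dots> \<in> J" using ab n by (intro ideal_mult[OF J]) auto
      finally show ?thesis .
    qed
  qed
  finally show ?thesis using ab by (auto simp: radical_iff)
qed

context gvd
begin

text \<open>Otherwise all homogeneous components of the generators of \<open>C\<close> would lie in the radical of \<open>N\<close>,
  and the two radicals would agree.\<close>

lemma nondegenerate_witness:
  assumes gr: "graded I" and nd: "\<not> degenerate X y G"
  obtains b q where "q \<in> C" "q \<in> carrier (poly_ring (X - {y}))" "homogeneous b q"
    "q \<notin> radical (poly_ring X) N"
proof (rule ccontr)
  let ?rad = "radical (poly_ring X) N"
  note witness = that
  assume no: "\<not> thesis"
  have rad: "q \<in> ?rad" if q: "q \<in> C" "q \<in> carrier (poly_ring (X - {y}))" "homogeneous b q" for q b
    using witness[OF q] no by blast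
  have rad_0: "0 \<in> ?rad" unfolding radical_iff using ideal_0[OF ideal_N] by (auto intro!: exI[of _ 1])
  have "y_lead_coeff y ` G \<subseteq> ?rad"
  proof
    fix a assume a: "a \<in> y_lead_coeff y ` G"
    have aY: "a \<in> carrier (poly_ring (X - {y}))" using a lead_coeffs_carr by blast
    have "y_lead_coeff y ` G \<subseteq> carrier (poly_ring X)"
      using lead_coeffs_carr poly_ring_mono[of "X - {y}" X] by blast
    then have aC: "a \<in> C" unfolding C_ideal_def using a Idl_incl by blast
    have "hcomp i a \<in> ?rad" for i
      using gradedD[OF graded_ideals(2)[OF gr] aC] aY by (intro rad[of _ i]) auto
    then have "(\<Sum>i\<in>F. hcomp i a) \<in> ?rad" for F
      by (induction F rule: infinite_finite_induct) (auto intro: rad_0 radical_add[OF ideal_N])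
    then show "a \<in> ?rad" using sum_parts[of total_deg a, OF order_refl] by metis
  qed
  moreover have "ideal ?rad (poly_ring X)"
  proof (rule ideal_poly_ringI)
    show "r * f \<in> ?rad" if r: "r \<in> carrier (poly_ring X)" and f: "f \<in> ?rad" for r f
    proof -
      obtain n where "f ^ n \<in> N" "f \<in> carrier (poly_ring X)" using f by (auto simp: radical_iff)
      then have "(r * f) ^ n \<in> N" "r * f \<in> carrier (poly_ring X)"
        using r ideal_mult[OF ideal_N, of "r ^ n" "f ^ n"] by (auto simp: power_mult_distrib)
      then show ?thesis by (auto simp: radical_iff)
    qed
  qed (use rad_0 radical_add[OF ideal_N] in \<open>auto simp: radical_iff\<close>)
  ultimately have CN: "C \<subseteq> ?rad" unfolding C_ideal_def by (intro Idl_least)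
  have "radical (poly_ring X) C = ?rad"
  proof
    show "radical (poly_ring X) C \<subseteq> ?rad"
    proof
      fix f assume "f \<in> radical (poly_ring X) C"
      then obtain n where n: "f ^ n \<in> C" "f \<in> carrier (poly_ring X)" by (auto simp: radical_iff)
      then have "f ^ n \<in> ?rad" using CN by blast
      then show "f \<in> ?rad" using n(2) by (auto simp: radical_iff simp flip: power_mult)
    qed
    show "?rad \<subseteq> radical (poly_ring X) C" using N_le_C by (auto simp: radical_iff)
  qed
  then show False using nd by (simp add: degenerate_def)
qed

lemma C_unit_if_I_unit:
  assumes "1 \<in> I"
  shows "1 \<in> C"
proof -
  have one: "y_coeff y i 1 = (if i = 0 then 1 else 0 :: 'k mpoly)" for i
    using y_coeff_var_power[of y i 0] by simp
  have "y_coeff y 0 1 * var y ^ 0 \<in> inI"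
    by (rule initial_y_ideal_mem[OF I y assms]) (simp add: one)
  then show ?thesis by (simp add: one inI_eq)
qed

text \<open>Here \<open>H\<^sub>I = (1 - t) H\<^sub>N\<close>: only the order of the pole changes.\<close>

lemma multiplicity_C_unit:
  assumes X: "finite X" and gr: "graded I" and C: "C = carrier (poly_ring X)"
  shows "multiplicity X I = multiplicity X N"
proof -
  interpret monomial_ordered X ord by unfold_locales (use X ord in auto)
  have hs: "hs X I = (1 - fps_X) * hs X N"
    using hs_decomposition[OF X gr] hs_N[OF X gr] hs_unit_ideal[of X] by (simp add: C)
  show ?thesis
  proof (cases "1 \<in> I")
    case True
    then have Iu: "I = carrier (poly_ring X)" using ideal_proper_iff[OF I] by blast
    have "1 \<in> N"
    proof (rule ccontr)
      assume N1: "1 \<notin> N"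
      obtain n where n: "has_dim X N n"
        using has_dim_exists[OF ideal_N graded_ideals(3)[OF gr] N1] by blast
      then obtain h where h: "hs X N * (1 - fps_X) ^ n = fps_of_poly h" "0 < poly h 1"
        by (auto simp: has_dim_def)
      have "(1 - fps_X) * hs X N = 0" using hs Iu hs_unit_ideal by metis
      then have "fps_of_poly ([:1, -1:] * h) = 0"
        unfolding fps_of_poly_mult fps_of_poly_1_minus_X h(1)[symmetric] by (simp add: mult.assoc[symmetric])
      then have "[:1, -1:] * h = 0" by (metis fps_of_poly_0 fps_of_poly_eq_iff)
      then have "h = 0" unfolding mult_eq_0_iff by simp
      then show False using h(2) by simp
    qed
    then have "N = carrier (poly_ring X)" using ideal_proper_iff[OF ideal_N] by blast
    then show ?thesis using Iu by simp
  next
    case False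
    have N1: "1 \<notin> N" using False N_le_I by blast
    obtain i where "has_dim X I i" using has_dim_exists[OF I gr False] by blast
    then obtain h where h: "hs X I * (1 - fps_X) ^ i = fps_of_poly h" "0 < poly h 1"
      by (auto simp: has_dim_def)
    have "hs X N * (1 - fps_X) ^ Suc i = fps_of_poly h"
      unfolding h(1)[symmetric] hs by (simp add: mult_ac)
    then show ?thesis
      using multiplicity_eq[OF I gr False h] multiplicity_eq[OF ideal_N graded_ideals(3)[OF gr] N1 _ h(2)]
      by metis
  qed
qed

text \<open>Here \<open>H\<^sub>I = (1 - t) H\<^sub>N + t H\<^sub>N = H\<^sub>N\<close>.\<close>

lemma multiplicity_C_eq_N:
  assumes X: "finite X" and gr: "graded I" and C: "C = N" "1 \<notin> C"
  shows "multiplicity X I = multiplicity X N"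
proof -
  interpret monomial_ordered X ord by unfold_locales (use X ord in auto)
  have I1: "1 \<notin> I" using C_unit_if_I_unit C(2) by blast
  have "hs X I = hs X N"
    using hs_decomposition[OF X gr] hs_N[OF X gr] by (simp add: C(1) algebra_simps)
  moreover obtain i where "has_dim X I i" using has_dim_exists[OF I gr I1] by blast
  then obtain h where h: "hs X I * (1 - fps_X) ^ i = fps_of_poly h" "0 < poly h 1"
    by (auto simp: has_dim_def)
  ultimately show ?thesis
    using multiplicity_eq[OF I gr I1 h] multiplicity_eq[OF ideal_N graded_ideals(3)[OF gr] _ _ h(2), of i] C
    by metis
qed

end

text \<open>In the nondegenerate case the dimensions of \<open>R/I\<close>, \<open>R/(N + (y))\<close> and \<open>R/C\<close> agree, so that the
  numerators of the Hilbert series are added.\<close>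

lemma multiplicity_nondegenerate:
  fixes I G :: "'k::{field, ring_char_0} mpoly set"
  assumes gvd: "geometric_vertex_decomposition X y ord G I"
    and X: "finite X" and gr: "graded I" and un: "unmixed (poly_ring X) I" and nd: "\<not> degenerate X y G"
  shows "multiplicity X I = multiplicity X (N_ideal X y G) + multiplicity X (C_ideal X y G)"
proof -
  interpret gvd X y ord G I by unfold_locales (rule gvd)
  interpret monomial_ordered X ord by unfold_locales (use X ord in auto)
  let ?A = "adjoin X N (var y)"
  note grs = graded_ideals[OF gr]
  have C1: "1 \<notin> C" using nd ideal_proper_iff[OF ideal_C] by (auto simp: degenerate_def)
  have I1: "1 \<notin> I" using C_unit_if_I_unit C1 by blast
  have N1: "1 \<notin> N" using N_le_C C1 by blast
  have A: "ideal ?A (poly_ring X)" "graded ?A" "1 \<notin> ?A"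
    using ideal_adjoin[OF ideal_N var_carr] graded_adjoin[OF ideal_N grs(3) homogeneous_var]
      adjoin_var_proper[OF ideal_N grs(3) N1 homogeneous_var] by auto
  obtain d where d: "has_dim X I d" using has_dim_exists[OF I gr I1] by blast
  obtain e where e: "has_dim X ?A e" using has_dim_exists[OF A] by blast
  obtain f where f: "has_dim X C f" using has_dim_exists[OF ideal_C grs(2) C1] by blast
  obtain h where h: "hs X I * (1 - fps_X) ^ d = fps_of_poly h" "0 < poly h 1"
    using d by (auto simp: has_dim_def)
  obtain h1 where h1: "hs X ?A * (1 - fps_X) ^ e = fps_of_poly h1" "0 < poly h1 1"
    using e by (auto simp: has_dim_def)
  obtain h2 where h2: "hs X C * (1 - fps_X) ^ f = fps_of_poly h2" "0 < poly h2 1"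
    using f by (auto simp: has_dim_def)
  obtain b q where q: "q \<in> C" "q \<in> carrier (poly_ring (X - {y}))" "homogeneous b q"
    "q \<notin> radical (poly_ring X) N"
    using nondegenerate_witness[OF gr nd] by metis
  have de: "d \<le> e" by (rule dim_le_dim_N[OF X gr un d _ q]) (use e in \<open>simp add: has_dim_def\<close>)
  have df: "d \<le> f" by (rule dim_le_dim_C[OF gvd X gr un d C1]) (use f in \<open>simp add: has_dim_def\<close>)
  define M where "M = max e f"
  define H where "H = [:1, -1:] ^ (M - e) * h1 + [:0, 1:] * [:1, -1:] ^ (M - f) * h2"
  have X1: "fps_of_poly [:0, 1:] = (fps_X :: int fps)" by (simp add: fps_of_poly_pCons)
  have pow: "(1 - fps_X :: int fps) ^ M = (1 - fps_X) ^ (M - i) * (1 - fps_X) ^ i" if "i \<le> M" for i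
    using that by (simp flip: power_add)
  have "hs X I * (1 - fps_X) ^ M = hs X ?A * (1 - fps_X) ^ M + fps_X * (hs X C * (1 - fps_X) ^ M)"
    unfolding hs_decomposition[OF X gr] by (simp add: algebra_simps)
  also have "hs X ?A * (1 - fps_X) ^ M = (1 - fps_X) ^ (M - e) * fps_of_poly h1"
    using pow[of e] by (simp add: M_def mult_ac flip: h1(1))
  also have "hs X C * (1 - fps_X) ^ M = (1 - fps_X) ^ (M - f) * fps_of_poly h2"
    using pow[of f] by (simp add: M_def mult_ac flip: h2(1))
  finally have HM: "hs X I * (1 - fps_X) ^ M = fps_of_poly H"
    by (simp only: H_def fps_of_poly_add fps_of_poly_mult fps_of_poly_power X1 fps_of_poly_1_minus_X mult.assoc)
  moreover have Hpos: "0 < poly H 1"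
    using h1(2) h2(2) by (cases "e \<le> f"; cases "e = f") (auto simp: H_def M_def max_def power_0_left)
  ultimately have "d = M" using has_dim_unique[OF d] by blast
  then have eq: "e = M" "f = M" using de df by (auto simp: M_def)
  then have "poly H 1 = poly h1 1 + poly h2 1" by (simp add: H_def)
  moreover have "multiplicity X I = poly H 1" by (rule multiplicity_eq[OF I gr I1 HM Hpos])
  moreover have "multiplicity X C = poly h2 1" by (rule multiplicity_eq[OF ideal_C grs(2) C1 h2])
  moreover have "hs X N * (1 - fps_X) ^ Suc e = fps_of_poly h1"
    unfolding h1(1)[symmetric] hs_N[OF X gr] by (simp add: mult_ac)
  then have "multiplicity X N = poly h1 1" by (rule multiplicity_eq[OF ideal_N grs(3) N1 _ h1(2)])
  ultimately show ?thesis by simp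
qed

theorem theorem4p2:
  fixes n j :: nat
    and X :: "nat set"
    and I G :: "'k::{alg_closed_field, field_char_0} mpoly set"
    and ord :: "monom rel"
  assumes "X = {1..n}"
    and "homogeneous_ideal X I"
    and "geometrically_vertex_decomposable X I \<and> gvd_witness X j ord G I \<or>
         weakly_geometrically_vertex_decomposable X I \<and> weak_gvd_witness X j ord G I"
  shows
    "(\<not> degenerate X j G \<longrightarrow>
        multiplicity X I = multiplicity X (N_ideal X j G) + multiplicity X (C_ideal X j G)) \<and>
     (degenerate X j G \<longrightarrow>
        (C_ideal X j G \<noteq> carrier (poly_ring X) \<longrightarrow>
           multiplicity X I = multiplicity X (N_ideal X j G) \<and>
           multiplicity X (N_ideal X j G) = multiplicity X (C_ideal X j G)) \<and>
        (C_ideal X j G = carrier (poly_ring X) \<longrightarrow>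
           multiplicity X I = multiplicity X (N_ideal X j G)))"
proof -
  have X: "finite X" using assms(1) by simp
  have gr: "graded I" using homogeneous_ideal_graded(2)[OF assms(2)] .
  have gvd: "geometric_vertex_decomposition X j ord G I"
    using assms(3) by (auto simp: gvd_witness_def weak_gvd_witness_def)
  interpret gvd X j ord G I by unfold_locales (rule gvd)
  have un: "unmixed (poly_ring X) I"
    using assms(3) by (auto elim: geometrically_vertex_decomposable.cases
        weakly_geometrically_vertex_decomposable.cases)
  have CN: "C = N" if deg: "degenerate X j G" and C: "C \<noteq> carrier (poly_ring X)"
  proof -
    have "radical (poly_ring (X - {j})) (contract (X - {j}) N) = contract (X - {j}) N"
    proof -
      have "geometrically_vertex_decomposable (X - {j}) (contract (X - {j}) N) \<or>
          weakly_geometrically_vertex_decomposable (X - {j}) (contract (X - {j}) N)"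
        using assms(3) deg unfolding gvd_witness_def weak_gvd_witness_def by blast
      then show ?thesis
        using X radical_geometrically_vertex_decomposable[of "X - {j}"]
          radical_weakly_geometrically_vertex_decomposable[of "X - {j}"] by blast
    qed
    then have "radical (poly_ring X) N = N" by (rule radical_extended[OF extended_N y])
    then show ?thesis using degenerate_cases[OF _ deg] C by blast
  qed
  have "1 \<notin> C" if "C \<noteq> carrier (poly_ring X)" using that ideal_proper_iff[OF ideal_C] by blast
  then have "multiplicity X I = multiplicity X N" if "degenerate X j G" "C \<noteq> carrier (poly_ring X)"
    using multiplicity_C_eq_N[OF X gr CN[OF that]] that by blast
  then show ?thesis
    using multiplicity_nondegenerate[OF gvd X gr un] multiplicity_C_unit[OF X gr] CN by metis
qed

end
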